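(* Let $(S,\eta,g)$ be a $(2n+1)$-dimensional compact Sasaki–Einstein manifold (i.e. a compact Sasakian manifold whose metric $g$ is Einstein). Assume that there exists a Sasakian immersion of $S$ into $\mathbb{S}^{2N+1}$, equipped with its standard Sasakian structure, for some non-negative integer $N$. Then $S$ is Sasaki equivalent to $\mathbb{S}^{2n+1}$ with its standard Sasakian structure.
   Context: A contact metric manifold $(S,\eta,g)$ is a connected contact manifold $(S,\eta)$ of dimension $2n+1$ with a Riemannian metric $g$ such that the $(1,1)$-tensor $\phi$ defined by $d\eta(X,Y)=2g(X,\phi Y)$ satisfies $\phi^2X=-X+\eta(X)\xi$ and $g(\phi X,\phi Y)=g(X,Y)-\eta(X)\eta(Y)$, where $\xi$ is the Reeb vector field ($\eta(\xi)=1$, $i_\xi d\eta=0$). It is Sasakian if moreover $[\phi,\phi](X,Y)=-d\eta(X,Y)\xi$ for all vector fields $X,Y$, where $[\phi,\phi]$ is the Nijenhuis torsion of $\phi$: $[\phi,\phi](X,Y)=\phi^2[X,Y]+[\phi X,\phi Y]-\phi[\phi X,Y]-\phi[X,\phi Y]$. The standard Sasakian structure $(\eta_0,g_0)$ on $\mathbb{S}^{2m+1}\subset\mathbb{R}^{2m+2}$ consists of the usual round metric $g_0$ and the contact form $\eta_0$ induced by $\sum_{j=1}^{m+1}(x_jdy_j-y_jdx_j)$. A Sasakian immersion $\varphi:(S_1,\eta_1,g_1)\to(S_2,\eta_2,g_2)$ between Sasakian manifolds is an immersion with $\varphi^*g_2=g_1$, $\varphi^*\eta_2=\eta_1$, $\varphi_*\xi_1=\xi_2$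 and $\varphi_*\circ\phi_1=\phi_2\circ\varphi_*$. Two Sasakian manifolds $(S_1,\eta_1,g_1)$, $(S_2,\eta_2,g_2)$ are (Sasaki) equivalent if there is a diffeomorphism $F:S_1\to S_2$ with $F^*\eta_2=\eta_1$ and $F^*g_2=g_1$.
   Formalization: The formal theorem assumes n ≥ 1: for n = 0 the claim fails, since the circle of length 4π (η = dt, g = dt²) is Sasaki–Einstein and immerses as the double cover of a Reeb orbit, but is not equivalent to the standard S¹. *)

theory Defs
  imports "HOL-Analysis.Analysis" "HOL-Library.Function_Algebras" "HOL-Combinatorics.Permutations"
begin

section \<open>Smooth manifolds\<close>

text \<open>The real vector space of functions with values in a real vector space; the tangent spaces
  below are subspaces of such function spaces.\<close>

instantiation "fun" :: (type, real_vector) real_vector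
begin

definition "r *\<^sub>R f = (\<lambda>x. r *\<^sub>R f x)"

instance
  by standard (simp_all add: scaleR_fun_def fun_eq_iff algebra_simps)

end

text \<open>To be used on open sets only: being \<open>k\<close> times continuously differentiable.\<close>

primrec C_k_on :: "nat \<Rightarrow> 'e::euclidean_space set \<Rightarrow> ('e \<Rightarrow> 'b::real_normed_vector) \<Rightarrow> bool" where
  "C_k_on 0 S f \<longleftrightarrow> continuous_on S f"
| "C_k_on (Suc k) S f \<longleftrightarrow>
     (\<forall>x\<in>S. f differentiable (at x)) \<and> (\<forall>v. C_k_on k S (\<lambda>x. frechet_derivative f (at x) v))"

definition smooth_on :: "'e::euclidean_space set \<Rightarrow> ('e \<Rightarrow> 'b::real_normed_vector) \<Rightarrow> bool" where
  "smooth_on S f \<longleftrightarrow> (\<forall>k. C_k_on k S f)"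

text \<open>A chart is a pair of its domain and a (total) function that matters only on the domain.
  Atlases need not be maximal.\<close>

type_synonym ('a, 'e) chart = "'a set \<times> ('a \<Rightarrow> 'e)"

definition chart_inv :: "('a, 'e) chart \<Rightarrow> 'e \<Rightarrow> 'a" where
  "chart_inv c = inv_into (fst c) (snd c)"

record ('a, 'e) manifold =
  mtop :: "'a topology"
  atlas :: "('a, 'e) chart set"

abbreviation points :: "('a, 'e, 'z) manifold_scheme \<Rightarrow> 'a set" where
  "points M \<equiv> topspace (mtop M)"

definition smooth_manifold :: "('a, 'e::euclidean_space, 'z) manifold_scheme \<Rightarrow> bool" where
  "smooth_manifold M \<longleftrightarrow>
     Hausdorff_space (mtop M) \<and> second_countable (mtop M) \<and>
     \<Union> (fst ` atlas M) = points M \<and>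
     (\<forall>c\<in>atlas M. openin (mtop M) (fst c) \<and> open (snd c ` fst c) \<and>
        homeomorphic_map (subtopology (mtop M) (fst c)) (top_of_set (snd c ` fst c)) (snd c)) \<and>
     (\<forall>c\<in>atlas M. \<forall>c'\<in>atlas M. smooth_on (snd c ` (fst c \<inter> fst c')) (snd c' \<circ> chart_inv c))"

definition charts_at :: "('a, 'e, 'z) manifold_scheme \<Rightarrow> 'a \<Rightarrow> ('a, 'e) chart set" where
  "charts_at M p = {c \<in> atlas M. p \<in> fst c}"

definition chart_at :: "('a, 'e, 'z) manifold_scheme \<Rightarrow> 'a \<Rightarrow> ('a, 'e) chart" where
  "chart_at M p = (SOME c. c \<in> charts_at M p)"

text \<open>Smoothness of a function on an open set \<open>W\<close> of points.\<close>

definition smooth_fun ::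
    "('a, 'e::euclidean_space, 'z) manifold_scheme \<Rightarrow> 'a set \<Rightarrow> ('a \<Rightarrow> 'b::real_normed_vector) \<Rightarrow> bool" where
  "smooth_fun M W f \<longleftrightarrow> (\<forall>c\<in>atlas M. smooth_on (snd c ` (fst c \<inter> W)) (f \<circ> chart_inv c))"

definition smooth_map ::
    "('a, 'e::euclidean_space, 'y) manifold_scheme \<Rightarrow> ('b, 'f::euclidean_space, 'z) manifold_scheme
       \<Rightarrow> ('a \<Rightarrow> 'b) \<Rightarrow> bool" where
  "smooth_map M N F \<longleftrightarrow> continuous_map (mtop M) (mtop N) F \<and>
     (\<forall>c\<in>atlas M. \<forall>c'\<in>atlas N.
        smooth_on (snd c ` (fst c \<inter> F -` fst c')) (snd c' \<circ> F \<circ> chart_inv c))"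

definition diffeomorphism ::
    "('a, 'e::euclidean_space, 'y) manifold_scheme \<Rightarrow> ('b, 'f::euclidean_space, 'z) manifold_scheme
       \<Rightarrow> ('a \<Rightarrow> 'b) \<Rightarrow> bool" where
  "diffeomorphism M N F \<longleftrightarrow> bij_betw F (points M) (points N) \<and>
     smooth_map M N F \<and> smooth_map N M (inv_into (points M) F)"


section \<open>Tangent vectors and vector fields\<close>

text \<open>A tangent vector at \<open>p\<close> is the family of its components in all charts around \<open>p\<close>, related by
  the derivatives of the transition maps; at other charts it is set to \<open>0\<close>, so that equality of
  tangent vectors is equality of functions.\<close>

type_synonym ('a, 'e) tvec = "('a, 'e) chart \<Rightarrow> 'e"

definition tangent_space ::
    "('a, 'e::euclidean_space, 'z) manifold_scheme \<Rightarrow> 'a \<Rightarrow> ('a, 'e) tvec set" where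
  "tangent_space M p = {v.
     (\<forall>c. c \<notin> charts_at M p \<longrightarrow> v c = 0) \<and>
     (\<forall>c\<in>charts_at M p. \<forall>c'\<in>charts_at M p.
        v c' = frechet_derivative (snd c' \<circ> chart_inv c) (at (snd c p)) (v c))}"

text \<open>The derivative of \<open>f\<close> at \<open>p\<close> along the tangent vector \<open>v\<close>; by the chain rule it does not
  depend on the chart.\<close>

definition dir_deriv ::
    "('a, 'e::euclidean_space, 'z) manifold_scheme \<Rightarrow> 'a \<Rightarrow> ('a, 'e) tvec
       \<Rightarrow> ('a \<Rightarrow> 'b::real_normed_vector) \<Rightarrow> 'b" where
  "dir_deriv M p v f =
     (let c = chart_at M p in frechet_derivative (f \<circ> chart_inv c) (at (snd c p)) (v c))"

text \<open>The differential of \<open>F\<close> at \<open>p\<close>.\<close>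

definition push ::
    "('a, 'e::euclidean_space, 'y) manifold_scheme \<Rightarrow> ('b, 'f::euclidean_space, 'z) manifold_scheme
       \<Rightarrow> ('a \<Rightarrow> 'b) \<Rightarrow> 'a \<Rightarrow> ('a, 'e) tvec \<Rightarrow> ('b, 'f) tvec" where
  "push M N F p v =
     (\<lambda>c'. if c' \<in> charts_at N (F p) then dir_deriv M p v (snd c' \<circ> F) else 0)"

definition immersion ::
    "('a, 'e::euclidean_space, 'y) manifold_scheme \<Rightarrow> ('b, 'f::euclidean_space, 'z) manifold_scheme
       \<Rightarrow> ('a \<Rightarrow> 'b) \<Rightarrow> bool" where
  "immersion M N F \<longleftrightarrow> smooth_map M N F \<and>
     (\<forall>p\<in>points M. inj_on (push M N F p) (tangent_space M p))"

text \<open>Smooth vector fields on an open set \<open>W\<close>.\<close>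

definition vector_field ::
    "('a, 'e::euclidean_space, 'z) manifold_scheme \<Rightarrow> 'a set \<Rightarrow> ('a \<Rightarrow> ('a, 'e) tvec) \<Rightarrow> bool" where
  "vector_field M W X \<longleftrightarrow> openin (mtop M) W \<and> (\<forall>p\<in>W. X p \<in> tangent_space M p) \<and>
     (\<forall>c\<in>atlas M. smooth_fun M (W \<inter> fst c) (\<lambda>q. X q c))"

text \<open>The bracket with \<open>[X,Y] f = X (Y f) - Y (X f)\<close>, by its components
  \<open>X (Y\<^sup>c) - Y (X\<^sup>c)\<close> in each chart \<open>c\<close>.\<close>

definition lie_bracket ::
    "('a, 'e::euclidean_space, 'z) manifold_scheme \<Rightarrow> ('a \<Rightarrow> ('a, 'e) tvec) \<Rightarrow> ('a \<Rightarrow> ('a, 'e) tvec)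
       \<Rightarrow> 'a \<Rightarrow> ('a, 'e) tvec" where
  "lie_bracket M X Y p =
     (\<lambda>c. if c \<in> charts_at M p
          then dir_deriv M p (X p) (\<lambda>q. Y q c) - dir_deriv M p (Y p) (\<lambda>q. X q c) else 0)"

text \<open>The vector field on the domain of \<open>c\<close> with constant components \<open>e\<close> in the chart \<open>c\<close>, and
  an extension of the tangent vector \<open>v\<close> at \<open>p\<close> to a neighbourhood of \<open>p\<close>. The extension serves to
  evaluate at single tangent vectors those expressions in vector fields that are tensorial.\<close>

definition coord_field ::
    "('a, 'e::euclidean_space, 'z) manifold_scheme \<Rightarrow> ('a, 'e) chart \<Rightarrow> 'e \<Rightarrow> 'a \<Rightarrow> ('a, 'e) tvec" where
  "coord_field M c e q =
     (\<lambda>c'. if c' \<in> charts_at M q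
           then frechet_derivative (snd c' \<circ> chart_inv c) (at (snd c q)) e else 0)"

definition extend_vec ::
    "('a, 'e::euclidean_space, 'z) manifold_scheme \<Rightarrow> 'a \<Rightarrow> ('a, 'e) tvec \<Rightarrow> 'a \<Rightarrow> ('a, 'e) tvec" where
  "extend_vec M p v = coord_field M (chart_at M p) (v (chart_at M p))"

definition trace_on_tangent ::
    "('a, 'e::euclidean_space, 'z) manifold_scheme \<Rightarrow> 'a \<Rightarrow> (('a, 'e) tvec \<Rightarrow> ('a, 'e) tvec) \<Rightarrow> real" where
  "trace_on_tangent M p L =
     (let c = chart_at M p in \<Sum>b\<in>Basis. L (coord_field M c b p) c \<bullet> b)"


section \<open>Differential forms and Riemannian metrics\<close>

definition one_form ::
    "('a, 'e::euclidean_space, 'z) manifold_scheme \<Rightarrow> ('a \<Rightarrow> ('a, 'e) tvec \<Rightarrow> real) \<Rightarrow> bool" where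
  "one_form M \<omega> \<longleftrightarrow>
     (\<forall>p\<in>points M. \<forall>u\<in>tangent_space M p. \<forall>v\<in>tangent_space M p. \<forall>r.
        \<omega> p (u + v) = \<omega> p u + \<omega> p v \<and> \<omega> p (r *\<^sub>R u) = r * \<omega> p u) \<and>
     (\<forall>W X. vector_field M W X \<longrightarrow> smooth_fun M W (\<lambda>p. \<omega> p (X p)))"

text \<open>The convention \<open>d\<omega>(X,Y) = X(\<omega>(Y)) - Y(\<omega>(X)) - \<omega>([X,Y])\<close>, without a factor \<open>1/2\<close>; it is the
  one for which the standard structure on the sphere satisfies \<open>d\<eta>(X,Y) = 2 g(X, \<phi> Y)\<close> with
  \<open>\<phi>\<^sup>2 X = - X + \<eta>(X) \<xi>\<close>.\<close>

definition ext_deriv_fields ::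
    "('a, 'e::euclidean_space, 'z) manifold_scheme \<Rightarrow> ('a \<Rightarrow> ('a, 'e) tvec \<Rightarrow> real)
       \<Rightarrow> ('a \<Rightarrow> ('a, 'e) tvec) \<Rightarrow> ('a \<Rightarrow> ('a, 'e) tvec) \<Rightarrow> 'a \<Rightarrow> real" where
  "ext_deriv_fields M \<omega> X Y p =
     dir_deriv M p (X p) (\<lambda>q. \<omega> q (Y q)) - dir_deriv M p (Y p) (\<lambda>q. \<omega> q (X q))
       - \<omega> p (lie_bracket M X Y p)"

definition ext_deriv ::
    "('a, 'e::euclidean_space, 'z) manifold_scheme \<Rightarrow> ('a \<Rightarrow> ('a, 'e) tvec \<Rightarrow> real)
       \<Rightarrow> 'a \<Rightarrow> ('a, 'e) tvec \<Rightarrow> ('a, 'e) tvec \<Rightarrow> real" where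
  "ext_deriv M \<omega> p u v = ext_deriv_fields M \<omega> (extend_vec M p u) (extend_vec M p v) p"

text \<open>The value of the \<open>(2n+1)\<close>-form \<open>\<omega> \<and> (d\<omega>)\<^sup>n\<close> on \<open>v 0, \<dots>, v (2n)\<close>, up to a positive constant
  that depends on the normalisation of the wedge product.\<close>

definition contact_volume ::
    "('a, 'e::euclidean_space, 'z) manifold_scheme \<Rightarrow> ('a \<Rightarrow> ('a, 'e) tvec \<Rightarrow> real)
       \<Rightarrow> nat \<Rightarrow> 'a \<Rightarrow> (nat \<Rightarrow> ('a, 'e) tvec) \<Rightarrow> real" where
  "contact_volume M \<omega> n p v =
     (\<Sum>\<sigma> | \<sigma> permutes {..<2 * n + 1}.
        of_int (sign \<sigma>) * \<omega> p (v (\<sigma> 0)) *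
        (\<Prod>i<n. ext_deriv M \<omega> p (v (\<sigma> (2 * i + 1))) (v (\<sigma> (2 * i + 2)))))"

definition contact_form ::
    "('a, 'e::euclidean_space, 'z) manifold_scheme \<Rightarrow> nat \<Rightarrow> ('a \<Rightarrow> ('a, 'e) tvec \<Rightarrow> real) \<Rightarrow> bool" where
  "contact_form M n \<omega> \<longleftrightarrow> DIM('e) = 2 * n + 1 \<and> one_form M \<omega> \<and>
     (\<forall>p\<in>points M. \<exists>v. (\<forall>i < 2 * n + 1. v i \<in> tangent_space M p) \<and> contact_volume M \<omega> n p v \<noteq> 0)"

definition riemannian_metric ::
    "('a, 'e::euclidean_space, 'z) manifold_scheme
       \<Rightarrow> ('a \<Rightarrow> ('a, 'e) tvec \<Rightarrow> ('a, 'e) tvec \<Rightarrow> real) \<Rightarrow> bool" where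
  "riemannian_metric M g \<longleftrightarrow>
     (\<forall>p\<in>points M. \<forall>u\<in>tangent_space M p. \<forall>v\<in>tangent_space M p. \<forall>w\<in>tangent_space M p. \<forall>r.
        g p (u + v) w = g p u w + g p v w \<and> g p (r *\<^sub>R u) w = r * g p u w \<and>
        g p u v = g p v u \<and> (u \<noteq> 0 \<longrightarrow> g p u u > 0)) \<and>
     (\<forall>W X Y. vector_field M W X \<and> vector_field M W Y \<longrightarrow> smooth_fun M W (\<lambda>p. g p (X p) (Y p)))"

text \<open>The Levi-Civita connection, given by the Koszul formula.\<close>

definition koszul ::
    "('a, 'e::euclidean_space, 'z) manifold_scheme
       \<Rightarrow> ('a \<Rightarrow> ('a, 'e) tvec \<Rightarrow> ('a, 'e) tvec \<Rightarrow> real)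
       \<Rightarrow> ('a \<Rightarrow> ('a, 'e) tvec) \<Rightarrow> ('a \<Rightarrow> ('a, 'e) tvec) \<Rightarrow> ('a \<Rightarrow> ('a, 'e) tvec) \<Rightarrow> 'a \<Rightarrow> real" where
  "koszul M g X Y Z p =
     dir_deriv M p (X p) (\<lambda>q. g q (Y q) (Z q)) + dir_deriv M p (Y p) (\<lambda>q. g q (X q) (Z q))
       - dir_deriv M p (Z p) (\<lambda>q. g q (X q) (Y q))
       + g p (lie_bracket M X Y p) (Z p) - g p (lie_bracket M X Z p) (Y p)
       - g p (lie_bracket M Y Z p) (X p)"

definition levi_civita ::
    "('a, 'e::euclidean_space, 'z) manifold_scheme
       \<Rightarrow> ('a \<Rightarrow> ('a, 'e) tvec \<Rightarrow> ('a, 'e) tvec \<Rightarrow> real)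
       \<Rightarrow> ('a \<Rightarrow> ('a, 'e) tvec) \<Rightarrow> ('a \<Rightarrow> ('a, 'e) tvec) \<Rightarrow> 'a \<Rightarrow> ('a, 'e) tvec" where
  "levi_civita M g X Y p =
     (THE w. w \<in> tangent_space M p \<and>
        (\<forall>u\<in>tangent_space M p. 2 * g p w u = koszul M g X Y (extend_vec M p u) p))"

definition riemann_fields ::
    "('a, 'e::euclidean_space, 'z) manifold_scheme
       \<Rightarrow> ('a \<Rightarrow> ('a, 'e) tvec \<Rightarrow> ('a, 'e) tvec \<Rightarrow> real)
       \<Rightarrow> ('a \<Rightarrow> ('a, 'e) tvec) \<Rightarrow> ('a \<Rightarrow> ('a, 'e) tvec) \<Rightarrow> ('a \<Rightarrow> ('a, 'e) tvec)
       \<Rightarrow> 'a \<Rightarrow> ('a, 'e) tvec" where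
  "riemann_fields M g X Y Z p =
     levi_civita M g X (levi_civita M g Y Z) p - levi_civita M g Y (levi_civita M g X Z) p
       - levi_civita M g (lie_bracket M X Y) Z p"

definition ricci ::
    "('a, 'e::euclidean_space, 'z) manifold_scheme
       \<Rightarrow> ('a \<Rightarrow> ('a, 'e) tvec \<Rightarrow> ('a, 'e) tvec \<Rightarrow> real)
       \<Rightarrow> 'a \<Rightarrow> ('a, 'e) tvec \<Rightarrow> ('a, 'e) tvec \<Rightarrow> real" where
  "ricci M g p v w =
     trace_on_tangent M p
       (\<lambda>u. riemann_fields M g (extend_vec M p u) (extend_vec M p v) (extend_vec M p w) p)"

definition einstein_metric ::
    "('a, 'e::euclidean_space, 'z) manifold_scheme
       \<Rightarrow> ('a \<Rightarrow> ('a, 'e) tvec \<Rightarrow> ('a, 'e) tvec \<Rightarrow> real) \<Rightarrow> bool" where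
  "einstein_metric M g \<longleftrightarrow> riemannian_metric M g \<and>
     (\<exists>l::real. \<forall>p\<in>points M. \<forall>v\<in>tangent_space M p. \<forall>w\<in>tangent_space M p.
        ricci M g p v w = l * g p v w)"


section \<open>Sasakian manifolds\<close>

record ('a, 'e) contact_metric = "('a, 'e) manifold" +
  eta :: "'a \<Rightarrow> ('a, 'e) tvec \<Rightarrow> real"
  riem :: "'a \<Rightarrow> ('a, 'e) tvec \<Rightarrow> ('a, 'e) tvec \<Rightarrow> real"

definition reeb :: "('a, 'e::euclidean_space, 'z) contact_metric_scheme \<Rightarrow> 'a \<Rightarrow> ('a, 'e) tvec" where
  "reeb S p = (THE v. v \<in> tangent_space S p \<and> eta S p v = 1 \<and>
     (\<forall>u\<in>tangent_space S p. ext_deriv S (eta S) p v u = 0))"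

definition phi ::
    "('a, 'e::euclidean_space, 'z) contact_metric_scheme \<Rightarrow> 'a \<Rightarrow> ('a, 'e) tvec \<Rightarrow> ('a, 'e) tvec" where
  "phi S p v = (THE w. w \<in> tangent_space S p \<and>
     (\<forall>u\<in>tangent_space S p. ext_deriv S (eta S) p u v = 2 * riem S p u w))"

text \<open>\<open>connected_space\<close> does not exclude the empty space.\<close>

definition contact_metric_manifold ::
    "nat \<Rightarrow> ('a, 'e::euclidean_space, 'z) contact_metric_scheme \<Rightarrow> bool" where
  "contact_metric_manifold n S \<longleftrightarrow>
     smooth_manifold S \<and> connected_space (mtop S) \<and> points S \<noteq> {} \<and>
     contact_form S n (eta S) \<and> riemannian_metric S (riem S) \<and>
     (\<forall>p\<in>points S. \<forall>u\<in>tangent_space S p. \<forall>v\<in>tangent_space S p.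
        phi S p (phi S p u) = - u + eta S p u *\<^sub>R reeb S p \<and>
        riem S p (phi S p u) (phi S p v) = riem S p u v - eta S p u * eta S p v)"

definition nijenhuis ::
    "('a, 'e::euclidean_space, 'z) manifold_scheme \<Rightarrow> ('a \<Rightarrow> ('a, 'e) tvec \<Rightarrow> ('a, 'e) tvec)
       \<Rightarrow> ('a \<Rightarrow> ('a, 'e) tvec) \<Rightarrow> ('a \<Rightarrow> ('a, 'e) tvec) \<Rightarrow> 'a \<Rightarrow> ('a, 'e) tvec" where
  "nijenhuis M P X Y p =
     P p (P p (lie_bracket M X Y p)) + lie_bracket M (\<lambda>q. P q (X q)) (\<lambda>q. P q (Y q)) p
       - P p (lie_bracket M (\<lambda>q. P q (X q)) Y p) - P p (lie_bracket M X (\<lambda>q. P q (Y q)) p)"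

definition sasakian_manifold ::
    "nat \<Rightarrow> ('a, 'e::euclidean_space, 'z) contact_metric_scheme \<Rightarrow> bool" where
  "sasakian_manifold n S \<longleftrightarrow> contact_metric_manifold n S \<and>
     (\<forall>W X Y. vector_field S W X \<and> vector_field S W Y \<longrightarrow>
        (\<forall>p\<in>W. nijenhuis S (phi S) X Y p = - (ext_deriv_fields S (eta S) X Y p *\<^sub>R reeb S p)))"

definition sasakian_immersion ::
    "('a, 'e::euclidean_space, 'y) contact_metric_scheme
       \<Rightarrow> ('b, 'f::euclidean_space, 'z) contact_metric_scheme \<Rightarrow> ('a \<Rightarrow> 'b) \<Rightarrow> bool" where
  "sasakian_immersion S1 S2 F \<longleftrightarrow> immersion S1 S2 F \<and>
     (\<forall>p\<in>points S1.
        push S1 S2 F p (reeb S1 p) = reeb S2 (F p) \<and>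
        (\<forall>u\<in>tangent_space S1 p.
           eta S2 (F p) (push S1 S2 F p u) = eta S1 p u \<and>
           push S1 S2 F p (phi S1 p u) = phi S2 (F p) (push S1 S2 F p u) \<and>
           (\<forall>v\<in>tangent_space S1 p.
              riem S2 (F p) (push S1 S2 F p u) (push S1 S2 F p v) = riem S1 p u v)))"

definition sasaki_equivalent ::
    "('a, 'e::euclidean_space, 'y) contact_metric_scheme
       \<Rightarrow> ('b, 'f::euclidean_space, 'z) contact_metric_scheme \<Rightarrow> bool" where
  "sasaki_equivalent S1 S2 \<longleftrightarrow> (\<exists>F. diffeomorphism S1 S2 F \<and>
     (\<forall>p\<in>points S1. \<forall>u\<in>tangent_space S1 p.
        eta S2 (F p) (push S1 S2 F p u) = eta S1 p u \<and>
        (\<forall>v\<in>tangent_space S1 p.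
           riem S2 (F p) (push S1 S2 F p u) (push S1 S2 F p v) = riem S1 p u v)))"


section \<open>The standard Sasakian structure on the sphere\<close>

text \<open>The space with coordinates \<open>x\<^sub>j\<close>, \<open>y\<^sub>j\<close> is rendered as \<open>complex ^ 'k\<close> with
  \<open>x\<^sub>j = Re (z $ j)\<close> and \<open>y\<^sub>j = Im (z $ j)\<close>, where the index type \<open>'k\<close> has \<open>m + 1\<close> elements. The
  charts of the unit sphere are all inverses of regular parametrisations of open subsets, so that the
  sphere is a submanifold. The model space \<open>'e\<close> has to be of dimension \<open>2m + 1\<close>; for other dimensions
  there are no charts with non-empty domain.\<close>

definition sphere_manifold :: "(complex ^ 'k, 'e::euclidean_space) manifold" where
  "sphere_manifold =
     \<lparr>mtop = top_of_set (sphere 0 1),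
      atlas = {c. openin (top_of_set (sphere 0 1)) (fst c) \<and> open (snd c ` fst c) \<and>
                  homeomorphism (fst c) (snd c ` fst c) (snd c) (chart_inv c) \<and>
                  smooth_on (snd c ` fst c) (chart_inv c) \<and>
                  (\<forall>x\<in>snd c ` fst c. inj (frechet_derivative (chart_inv c) (at x)))}\<rparr>"

text \<open>The image of a tangent vector of the sphere in the ambient space, that is, its image under the
  differential of the inclusion map.\<close>

definition ambient :: "complex ^ 'k \<Rightarrow> (complex ^ 'k, 'e::euclidean_space) tvec \<Rightarrow> complex ^ 'k" where
  "ambient p v = dir_deriv sphere_manifold p v (\<lambda>q. q)"

definition standard_sphere :: "(complex ^ 'k, 'e::euclidean_space) contact_metric" where
  "standard_sphere =
     \<lparr>mtop = mtop (sphere_manifold :: (complex ^ 'k, 'e) manifold),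
      atlas = atlas sphere_manifold,
      eta = (\<lambda>p v. \<Sum>j\<in>UNIV. Re (p $ j) * Im (ambient p v $ j) - Im (p $ j) * Re (ambient p v $ j)),
      riem = (\<lambda>p u v. ambient p u \<bullet> ambient p v)\<rparr>"

end

theory Submission
  imports Defs
begin

text \<open>Locally, the ambient-valued immersion is a map \<open>f\<close> with \<open>|f| = 1\<close> that induces \<open>g\<close>. Compatibility of
  \<open>g\<close> and \<open>\<phi>\<close> makes the tangent spaces \<open>V = im df + \<real> f\<close> of the cone over the image complex, hence the second
  fundamental form \<open>\<alpha>\<close> of the cone is complex bilinear, so it is trace-free and vanishes on the Reeb
  direction. As the ambient space of the cone is flat, the Gauss equation becomes
  \<open>Ric(v,v) = 2n |v|\<^sup>2 - \<Sum> |\<alpha>(e\<^sub>i,v)|\<^sup>2\<close>. Taking the Reeb vector for \<open>v\<close> shows that the Einstein constant is \<open>2n\<close>,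
  whence \<open>\<alpha> = 0\<close>. Then \<open>V\<close> is locally constant, so that the image lies in the unit sphere of a fixed
  complex subspace of dimension \<open>n + 1\<close>. The immersion is thus a local isometry from a compact connected
  manifold to \<open>S\<^sup>2\<^sup>n\<^sup>+\<^sup>1\<close>, that is, a covering, and \<open>S\<^sup>2\<^sup>n\<^sup>+\<^sup>1\<close> is simply connected for \<open>n \<ge> 1\<close>.\<close>

section \<open>Smooth maps between Euclidean spaces\<close>

text \<open>The cone turns contact geometry into complex geometry: on the image itself the
  compatibility tensor has a kernel and a Reeb correction, whereas the tangent spaces of the cone
  are complex subspaces. The constant 2n is the Ricci curvature of the unit sphere of dimension 2n +
  1; the Reeb direction detects it because \<alpha> vanishes there for every such immersion.

  The obstacle is the dependence on charts. \<open>ricci\<close> extends tangent vectors by the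
  chosen chart \<open>chart_at M p\<close>, so that \<alpha> = 0 is obtained at each point in a
  chart that varies with the point, while the constancy of \<open>V\<close> is proved by
  differentiating in one chart over a neighbourhood. The bridge is that lying in \<open>V\<close>,
  for second derivatives of the immersion, does not depend on the chart.

  Smoothness of coordinate expressions and of inverse maps rests on one lemma: a continuous solution
  \<open>w\<close> of \<open>\<psi> (w y) = h y\<close> with an immersion \<psi> and a smooth
  \<open>h\<close> is smooth.\<close>

lemma frechet_derivative_eqI:
  "(f has_derivative f') (at x) \<Longrightarrow> frechet_derivative f (at x) = f'"
  by (metis frechet_derivative_at)

section \<open>Calculus of maps of class \<open>C_k_on\<close>\<close>

lemma C_k_on_0: "C_k_on (Suc k) S f \<Longrightarrow> continuous_on S f"
  by (auto intro!: continuous_at_imp_continuous_on intro: differentiable_imp_continuous_within)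

lemma C_k_on_Suc_D: "C_k_on (Suc k) S f \<Longrightarrow> C_k_on k S f"
proof (induction k arbitrary: f)
  case 0
  then show ?case using C_k_on_0[of 0 S f] by simp
next
  case (Suc k)
  have "C_k_on k S (\<lambda>x. frechet_derivative f (at x) v)" for v
    using Suc.prems by (intro Suc.IH) simp
  then show ?case using Suc.prems by simp
qed

lemma C_k_on_continuous: "C_k_on k S f \<Longrightarrow> continuous_on S f"
  by (cases k) (simp_all add: C_k_on_0 del: C_k_on.simps(2))

lemma C_k_on_has_derivative:
  "C_k_on (Suc k) S f \<Longrightarrow> x \<in> S \<Longrightarrow> (f has_derivative frechet_derivative f (at x)) (at x)"
  by (simp add: frechet_derivative_works)

lemma C_k_on_subset: "C_k_on k S f \<Longrightarrow> T \<subseteq> S \<Longrightarrow> C_k_on k T f"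
  by (induction k arbitrary: f) (auto intro: continuous_on_subset)

lemma frechet_derivative_cong_open:
  assumes "open S" "x \<in> S" "\<And>y. y \<in> S \<Longrightarrow> f y = g y"
  shows "frechet_derivative f (at x) = frechet_derivative g (at x)"
proof -
  have "(f has_derivative D) (at x) \<longleftrightarrow> (g has_derivative D) (at x)" for D
    by (metis assms has_derivative_transform_within_open)
  then show ?thesis by (simp add: frechet_derivative_def)
qed

lemma has_derivative_const_on_open:
  assumes "open S" "x \<in> S" "(f has_derivative f') (at x)" "\<And>y. y \<in> S \<Longrightarrow> f y = c"
  shows "f' v = 0"
proof -
  have "((\<lambda>y. c) has_derivative f') (at x)"
    by (rule has_derivative_transform_within_open[OF assms(3,1,2,4)])
  then have "f' = (\<lambda>v. 0)" using has_derivative_unique has_derivative_const by blast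
  then show ?thesis by simp
qed

lemma differentiable_cong_open:
  assumes "open S" "x \<in> S" "\<And>y. y \<in> S \<Longrightarrow> f y = g y"
  shows "f differentiable (at x) \<longleftrightarrow> g differentiable (at x)"
  unfolding differentiable_def by (metis assms has_derivative_transform_within_open)

lemma C_k_on_cong:
  assumes "open S" "\<And>y. y \<in> S \<Longrightarrow> f y = g y" "C_k_on k S f"
  shows "C_k_on k S g"
  using assms(2,3)
proof (induction k arbitrary: f g)
  case 0
  then show ?case using continuous_on_cong by force
next
  case (Suc k)
  have f: "f differentiable (at x)" "C_k_on k S (\<lambda>x. frechet_derivative f (at x) v)" if "x \<in> S" for x v
    using Suc.prems(2) that by simp_all
  have eq: "frechet_derivative f (at x) = frechet_derivative g (at x)" if "x \<in> S" for x
    using assms(1) that Suc.prems(1) by (rule frechet_derivative_cong_open)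
  have "g differentiable (at x)" if "x \<in> S" for x
    using differentiable_cong_open[of S x f g] assms(1) that f(1)[OF that] Suc.prems(1) by metis
  moreover have "C_k_on k S (\<lambda>x. frechet_derivative g (at x) v)" for v
  proof (rule Suc.IH)
    show "C_k_on k S (\<lambda>x. frechet_derivative f (at x) v)" using Suc.prems(2) by simp
  qed (simp add: eq)
  ultimately show ?case by simp
qed

text \<open>The derivative may be presented by any formula \<open>f'\<close> that the
  differentiation rules produce; the inductions over \<open>k\<close> below all enter the successor
  case through this.\<close>

lemma C_k_on_SucI:
  assumes "open S" "\<And>x. x \<in> S \<Longrightarrow> (f has_derivative f' x) (at x)"
    "\<And>v. C_k_on k S (\<lambda>x. f' x v)"
  shows "C_k_on (Suc k) S f"
proof -
  have "frechet_derivative f (at x) = f' x" if "x \<in> S" for x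
    using assms(2)[OF that] by (rule frechet_derivative_eqI)
  then have "C_k_on k S (\<lambda>x. frechet_derivative f (at x) v)" for v
    by (intro C_k_on_cong[OF assms(1) _ assms(3)[of v]]) auto
  then show ?thesis using assms(2) by (auto simp: differentiable_def)
qed

lemma C_k_on_const: "C_k_on k S (\<lambda>x. c)"
  by (induction k arbitrary: c) auto

lemma C_k_on_bounded_linear:
  assumes "bounded_linear L" "open S" "C_k_on k S f"
  shows "C_k_on k S (\<lambda>x. L (f x))"
  using assms(3)
proof (induction k arbitrary: f)
  case 0
  then show ?case by (simp add: assms(1) linear_continuous_on_compose bounded_linear.continuous_on)
next
  case (Suc k)
  then show ?case
    by (intro C_k_on_SucI[where f'="\<lambda>x v. L (frechet_derivative f (at x) v)"] assms(2))
      (auto intro!: bounded_linear.has_derivative[OF assms(1)] simp: frechet_derivative_works)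
qed

lemma C_k_on_ident: "C_k_on k S (\<lambda>x. x)"
proof (cases k)
  case (Suc k)
  then show ?thesis by (simp add: C_k_on_const)
qed simp

lemma C_k_on_add:
  assumes "open S" "C_k_on k S f" "C_k_on k S g"
  shows "C_k_on k S (\<lambda>x. f x + g x)"
  using assms(2,3)
proof (induction k arbitrary: f g)
  case 0
  then show ?case by (simp add: continuous_on_add)
next
  case (Suc k)
  then show ?case
    by (intro C_k_on_SucI[where f'="\<lambda>x v. frechet_derivative f (at x) v + frechet_derivative g (at x) v"] assms(1))
      (auto intro!: has_derivative_add simp: frechet_derivative_works)
qed

lemma C_k_on_sum:
  assumes "open S" "\<And>i. i \<in> I \<Longrightarrow> C_k_on k S (f i)"
  shows "C_k_on k S (\<lambda>x. \<Sum>i\<in>I. f i x)"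
  using assms(2)
  by (induction I rule: infinite_finite_induct) (auto intro: C_k_on_const C_k_on_add assms(1))

lemma C_k_on_bilinear:
  assumes "bounded_bilinear P" "open S" "C_k_on k S f" "C_k_on k S g"
  shows "C_k_on k S (\<lambda>x. P (f x) (g x))"
  using assms(3,4)
proof (induction k arbitrary: f g)
  case 0
  then show ?case by (simp add: assms(1) bounded_bilinear.continuous_on)
next
  case (Suc k)
  have "C_k_on k S (\<lambda>x. P (f x) (frechet_derivative g (at x) v) + P (frechet_derivative f (at x) v) (g x))" for v
    using Suc.prems
    by (intro C_k_on_add[OF assms(2)] Suc.IH) (simp_all add: C_k_on_Suc_D del: C_k_on.simps(2), simp_all)
  with Suc.prems show ?case
    by (intro C_k_on_SucI[where f'="\<lambda>x v. P (f x) (frechet_derivative g (at x) v) + P (frechet_derivative f (at x) v) (g x)"] assms(2))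
      (auto intro!: bounded_bilinear.FDERIV[OF assms(1)] simp: frechet_derivative_works)
qed

lemmas C_k_on_scaleR = C_k_on_bilinear[OF bounded_bilinear_scaleR]
lemmas C_k_on_inner = C_k_on_bilinear[OF bounded_bilinear_inner]

lemma C_k_on_diff:
  assumes "open S" "C_k_on k S f" "C_k_on k S g"
  shows "C_k_on k S (\<lambda>x. f x - g x)"
  using C_k_on_add[OF assms(1,2) C_k_on_bounded_linear[OF bounded_linear_minus[OF bounded_linear_ident] assms(1,3)]]
  by simp

lemma linear_eq_sum_Basis:
  fixes L :: "'a::euclidean_space \<Rightarrow> 'b::real_vector"
  assumes "linear L"
  shows "L v = (\<Sum>b\<in>Basis. (v \<bullet> b) *\<^sub>R L b)"
proof -
  have "L v = L (\<Sum>b\<in>Basis. (v \<bullet> b) *\<^sub>R b)" by (simp add: euclidean_representation)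
  also have "\<dots> = (\<Sum>b\<in>Basis. (v \<bullet> b) *\<^sub>R L b)"
    using assms by (simp add: linear_sum linear_scale)
  finally show ?thesis .
qed

text \<open>Only \<open>g\<close> varies in the induction: expanding the derivative of
  \<open>g\<close> at \<open>f x\<close> over \<open>Basis\<close> leaves partial derivatives of
  \<open>g\<close> in fixed directions, composed with the same \<open>f\<close>, and these are one
  order less smooth.\<close>

lemma C_k_on_compose:
  fixes f :: "'a::euclidean_space \<Rightarrow> 'b::euclidean_space"
  assumes "open S" "open T" "\<And>x. x \<in> S \<Longrightarrow> f x \<in> T" "C_k_on k S f" "C_k_on k T g"
  shows "C_k_on k S (\<lambda>x. g (f x))"
  using assms(4,5)
proof (induction k arbitrary: g)
  case 0
  then have "continuous_on T g" "continuous_on S f" by simp_all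
  then have "continuous_on S (\<lambda>x. g (f x))"
    by (rule continuous_on_compose2) (use assms(3) in blast)
  then show ?case by simp
next
  case (Suc k)
  have der: "((\<lambda>x. g (f x)) has_derivative
      (\<lambda>v. \<Sum>b\<in>Basis. (frechet_derivative f (at x) v \<bullet> b) *\<^sub>R frechet_derivative g (at (f x)) b)) (at x)"
    if "x \<in> S" for x
  proof -
    have 1: "(f has_derivative frechet_derivative f (at x)) (at x)"
      by (rule C_k_on_has_derivative[OF Suc.prems(1) that])
    have 2: "(g has_derivative frechet_derivative g (at (f x))) (at (f x))"
      by (rule C_k_on_has_derivative[OF Suc.prems(2) assms(3)[OF that]])
    have "(\<lambda>v. frechet_derivative g (at (f x)) (frechet_derivative f (at x) v)) =
      (\<lambda>v. \<Sum>b\<in>Basis. (frechet_derivative f (at x) v \<bullet> b) *\<^sub>R frechet_derivative g (at (f x)) b)"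
      by (rule ext, rule linear_eq_sum_Basis[OF has_derivative_linear[OF 2]])
    with has_derivative_compose[OF 1 2] show ?thesis by (simp only:)
  qed
  have "C_k_on k S (\<lambda>x. \<Sum>b\<in>Basis. (frechet_derivative f (at x) v \<bullet> b) *\<^sub>R frechet_derivative g (at (f x)) b)" for v
    using Suc.prems
    by (intro C_k_on_sum[OF assms(1)] C_k_on_scaleR[OF assms(1)]
        C_k_on_inner[OF assms(1)] Suc.IH C_k_on_const)
      (simp_all add: C_k_on_Suc_D del: C_k_on.simps(2), simp_all)
  with der show ?case
    by (intro C_k_on_SucI[OF assms(1), where f'="\<lambda>x v. \<Sum>b\<in>Basis. (frechet_derivative f (at x) v \<bullet> b) *\<^sub>R frechet_derivative g (at (f x)) b"])
qed

section \<open>Smooth solutions of linear and implicit equations\<close>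

text \<open>A factor tending to 0 times a factor of order \<open>norm (y - x)\<close> is negligible
  to first order. The error terms of both solution lemmas below have this shape.\<close>

lemma has_derivative_zero_product_bound:
  assumes m: "(m has_derivative m') (at x)" "m x = 0" and s: "(s \<longlongrightarrow> 0) (at x)"
    and E: "E x = 0" "\<forall>\<^sub>F y in at x. norm (E y) \<le> s y * norm (m y)"
  shows "(E has_derivative (\<lambda>v. 0)) (at x)"
proof -
  have lim: "((\<lambda>y. norm (m y - m x - m' (y - x)) / norm (y - x)) \<longlongrightarrow> 0) (at x)"
    using m(1) by (simp add: has_derivative_iff_norm)
  interpret m': bounded_linear m' using m(1) by (rule has_derivative_bounded_linear)
  obtain K where K: "\<And>v. norm (m' v) \<le> norm v * K" using m'.bounded by blast
  have "\<forall>\<^sub>F y in at x. norm (m y - m x - m' (y - x)) / norm (y - x) < 1"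
    using lim by (rule order_tendstoD) simp
  moreover have "\<forall>\<^sub>F y in at x. y \<noteq> x" by (simp add: eventually_at_filter)
  ultimately have ev: "\<forall>\<^sub>F y in at x. norm (norm (E y - E x - 0) / norm (y - x)) \<le> norm (s y) * (1 + K)"
    using E(2)
  proof eventually_elim
    case (elim y)
    have pos: "norm (y - x) > 0" using elim by simp
    have "norm (m y - m' (y - x)) \<le> norm (y - x)" using elim m(2) pos by (simp add: field_simps)
    then have mb: "norm (m y) \<le> norm (y - x) * (1 + K)"
      using K[of "y - x"] norm_triangle_sub[of "m y" "m' (y - x)"] by (simp add: algebra_simps)
    have "norm (E y) \<le> norm (s y) * norm (m y)"
      using elim(3) by (smt (verit, best) mult_right_mono norm_ge_zero real_norm_def)
    also have "\<dots> \<le> norm (s y) * (norm (y - x) * (1 + K))" using mb by (rule mult_left_mono) simp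
    finally show ?case using pos E(1) by (simp add: divide_le_eq algebra_simps)
  qed
  have "((\<lambda>y. norm (s y) * (1 + K)) \<longlongrightarrow> 0) (at x)"
    using tendsto_mult_left_zero[OF tendsto_norm_zero[OF s]] .
  then have "((\<lambda>y. norm (E y - E x - 0) / norm (y - x)) \<longlongrightarrow> 0) (at x)"
    by (rule Lim_null_comparison[OF ev])
  then show ?thesis by (simp add: has_derivative_iff_norm)
qed

lemma linear_inj_left_inverse:
  fixes A :: "'a::euclidean_space \<Rightarrow> 'b::euclidean_space"
  assumes "linear A" "inj A"
  obtains B K where "bounded_linear B" "\<And>v. B (A v) = v" "K > 0" "\<And>y. norm (B y) \<le> K * norm y"
proof -
  obtain B where B: "linear B" "B \<circ> A = id"
    using linear_injective_left_inverse[OF assms] by blast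
  obtain K where "K > 0" "\<And>y. norm (B y) \<le> K * norm y"
    using linear_bounded_pos[OF B(1)] by blast
  then show ?thesis using B that[of B K] by (auto simp: linear_conv_bounded_linear fun_eq_iff)
qed

text \<open>\<open>M x\<close> is injective but the system may be overdetermined, so a left inverse
  takes the place of the inverse: with its bound \<open>K\<close> one gets
  \<open>norm e \<le> 2 * K * norm (M y e)\<close> for \<open>e = w y - w x\<close> and
  \<open>y\<close> near \<open>x\<close>.\<close>

lemma continuous_solve:
  fixes M :: "'a::euclidean_space \<Rightarrow> 'b::euclidean_space \<Rightarrow> 'c::euclidean_space"
  assumes M: "\<And>e. isCont (\<lambda>y. M y e) x" and r: "isCont r x"
    and lin: "\<forall>\<^sub>F y in at x. linear (M y)" "linear (M x)" "inj (M x)"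
    and w: "\<forall>\<^sub>F y in at x. M y (w y) = r y" "M x (w x) = r x"
  shows "isCont w x"
proof -
  obtain B K where B: "bounded_linear B" "\<And>v. B (M x v) = v" "K > 0" "\<And>y. norm (B y) \<le> K * norm y"
    using linear_inj_left_inverse[OF lin(2,3)] by blast
  define d where "d y = (\<Sum>b\<in>Basis. norm (M y b - M x b))" for y
  have "(d \<longlongrightarrow> (\<Sum>b\<in>Basis. norm (M x b - M x b))) (at x)"
    unfolding d_def using M by (intro tendsto_intros) (simp add: isCont_def)
  then have d0: "(d \<longlongrightarrow> 0) (at x)" by simp
  have "((\<lambda>y. norm (r y - M y (w x))) \<longlongrightarrow> norm (r x - M x (w x))) (at x)"
    using M r by (intro tendsto_intros) (simp_all add: isCont_def)
  then have lim: "((\<lambda>y. 2 * K * norm (r y - M y (w x))) \<longlongrightarrow> 0) (at x)"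
    using w(2) by (auto intro: tendsto_mult_right_zero)
  \<comment> \<open>Below this threshold, replacing \<open>M y\<close> by \<open>M x\<close> costs
    at most half of \<open>norm e\<close>, which can be absorbed.\<close>
  have "\<forall>\<^sub>F y in at x. d y < 1 / (2 * K)" using d0 by (rule order_tendstoD) (use B in simp)
  then have "\<forall>\<^sub>F y in at x. norm (w y - w x) \<le> 2 * K * norm (r y - M y (w x))"
    using lin(1) w(1)
  proof eventually_elim
    case (elim y)
    define e where "e = w y - w x"
    have *: "M y e - M x e = (\<Sum>b\<in>Basis. (e \<bullet> b) *\<^sub>R (M y b - M x b))"
      using linear_eq_sum_Basis[OF elim(2), of e] linear_eq_sum_Basis[OF lin(2), of e]
      by (simp add: sum_subtractf scaleR_diff_right)
    have "norm (M y e - M x e) \<le> (\<Sum>b\<in>Basis. norm e * norm (M y b - M x b))"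
      unfolding * by (intro sum_norm_le) (simp add: Basis_le_norm mult_right_mono)
    then have 1: "norm (M y e - M x e) \<le> norm e * d y" by (simp add: d_def sum_distrib_left)
    have 2: "norm e \<le> K * norm (M x e)" using B(4)[of "M x e"] B(2) by simp
    have 3: "norm (M x e) \<le> norm (M y e) + norm (M y e - M x e)"
      by (metis norm_minus_commute norm_triangle_sub)
    have "norm e * d y \<le> norm e * (1 / (2 * K))" using elim(1) by (intro mult_left_mono) auto
    then have "norm (M x e) \<le> norm (M y e) + norm e * (1 / (2 * K))" using 1 3 by linarith
    then have "K * norm (M x e) \<le> K * (norm (M y e) + norm e * (1 / (2 * K)))"
      using B(3) by (intro mult_left_mono) auto
    moreover have "K * (norm e * (1 / (2 * K))) = norm e / 2" using B(3) by simp
    ultimately have "norm e \<le> K * norm (M y e) + norm e / 2" using 2 by (simp add: distrib_left)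
    then have "norm e \<le> 2 * K * norm (M y e)" by simp
    moreover have "M y e = r y - M y (w x)"
      using elim by (simp add: e_def linear_diff)
    ultimately show ?case by (simp add: e_def)
  qed
  then have "((\<lambda>y. w y - w x) \<longlongrightarrow> 0) (at x)"
    by (rule Lim_null_comparison[OF _ lim])
  then show ?thesis by (simp add: isCont_def LIM_zero_iff)
qed

text \<open>Near \<open>x\<close>, \<open>w y\<close> is the candidate
  \<open>w x + B (r y - M y (w x))\<close> minus \<open>B\<close> of the terms \<open>E b y\<close>.
  Those are products of two factors vanishing at \<open>x\<close>, one of them differentiable there,
  and so have derivative 0.\<close>

lemma differentiable_solve:
  fixes M :: "'a::euclidean_space \<Rightarrow> 'b::euclidean_space \<Rightarrow> 'c::euclidean_space"
  assumes S: "open S" "x \<in> S"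
    and M: "\<And>e. (\<lambda>y. M y e) differentiable (at x)" and r: "r differentiable (at x)"
    and lin: "\<And>y. y \<in> S \<Longrightarrow> linear (M y)" "inj (M x)"
    and w: "\<And>y. y \<in> S \<Longrightarrow> M y (w y) = r y"
  shows "w differentiable (at x)"
proof -
  have evS: "\<forall>\<^sub>F y in at x. y \<in> S" using S by (simp add: eventually_at_in_open' )
  have cont: "isCont w x"
  proof (rule continuous_solve[where M=M and r=r])
    show "\<forall>\<^sub>F y in at x. linear (M y)" "\<forall>\<^sub>F y in at x. M y (w y) = r y"
      using evS by (auto elim!: eventually_mono intro: lin w)
  qed (use S lin w M r in \<open>auto intro: differentiable_imp_continuous_within\<close>)
  obtain B K where B: "bounded_linear B" "\<And>v. B (M x v) = v" "K > 0" "\<And>y. norm (B y) \<le> K * norm y"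
    using linear_inj_left_inverse[OF lin] S by blast
  interpret B: bounded_linear B by (rule B)
  have linx: "linear (M x)" using lin S by blast
  define E where "E b y = ((w y - w x) \<bullet> b) *\<^sub>R (M y b - M x b)" for b y
  have E: "(E b has_derivative (\<lambda>v. 0)) (at x)" if "b \<in> Basis" for b
  proof -
    have 1: "((\<lambda>y. M y b - M x b) has_derivative frechet_derivative (\<lambda>y. M y b) (at x)) (at x)"
      using has_derivative_diff[OF M[of b, unfolded frechet_derivative_works] has_derivative_const[of "M x b"]]
      by simp
    have 2: "((\<lambda>y. norm (w y - w x)) \<longlongrightarrow> 0) (at x)"
      using cont by (simp add: isCont_def LIM_zero tendsto_norm_zero)
    show ?thesis
    proof (rule has_derivative_zero_product_bound[OF 1 _ 2])
      show "\<forall>\<^sub>F y in at x. norm (E b y) \<le> norm (w y - w x) * norm (M y b - M x b)"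
        using that by (auto simp: E_def intro!: eventuallyI mult_right_mono Basis_le_norm)
    qed (auto simp: E_def)
  qed
  have eq: "w x + B (r y - M y (w x)) - B (\<Sum>b\<in>Basis. E b y) = w y" if "y \<in> S" for y
  proof -
    have "(\<Sum>b\<in>Basis. E b y) = M y (w y - w x) - M x (w y - w x)"
      using linear_eq_sum_Basis[OF linx, of "w y - w x"] linear_eq_sum_Basis[OF lin(1)[OF that], of "w y - w x"]
      by (simp add: E_def sum_subtractf scaleR_diff_right)
    also have "\<dots> = r y - M y (w x) - M x (w y - w x)"
      using lin(1)[OF that] w[OF that] by (simp add: linear_diff)
    finally show ?thesis using B(2) by (simp add: B.diff)
  qed
  have "((\<lambda>y. w x + B (r y - M y (w x)) - B (\<Sum>b\<in>Basis. E b y)) has_derivative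
      (\<lambda>v. 0 + B (frechet_derivative r (at x) v - frechet_derivative (\<lambda>y. M y (w x)) (at x) v) - B (\<Sum>b\<in>(Basis::'b set). 0))) (at x)"
    using r M E by (intro has_derivative_diff has_derivative_add has_derivative_const B.has_derivative has_derivative_sum)
      (simp_all add: frechet_derivative_works)
  then have "(\<lambda>y. w x + B (r y - M y (w x)) - B (\<Sum>b\<in>Basis. E b y)) differentiable (at x)"
    by (rule differentiableI)
  moreover have "(\<lambda>y. w x + B (r y - M y (w x)) - B (\<Sum>b\<in>Basis. E b y)) differentiable (at x) \<longleftrightarrow> w differentiable (at x)"
    using S eq by (rule differentiable_cong_open)
  ultimately show ?thesis by simp
qed

text \<open>Differentiating \<open>M y (w y) = r y\<close> shows that the derivative of
  \<open>w\<close> solves a system with the same \<open>M\<close> and a right-hand side of one order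
  less; therefore \<open>r\<close> and \<open>w\<close> vary in the induction while \<open>M\<close>
  stays.\<close>

lemma C_k_on_solve:
  fixes M :: "'a::euclidean_space \<Rightarrow> 'b::euclidean_space \<Rightarrow> 'c::euclidean_space"
  assumes S: "open S" and lin: "\<And>y. y \<in> S \<Longrightarrow> linear (M y)" "\<And>y. y \<in> S \<Longrightarrow> inj (M y)"
    and M: "\<And>e. C_k_on k S (\<lambda>y. M y e)" and r: "C_k_on k S r"
    and w: "\<And>y. y \<in> S \<Longrightarrow> M y (w y) = r y"
  shows "C_k_on k S w"
  using M r w
proof (induction k arbitrary: r w)
  case 0
  have "isCont w x" if "x \<in> S" for x
  proof -
    have evS: "\<forall>\<^sub>F y in at x. y \<in> S" using S that by (simp add: eventually_at_in_open' )
    show ?thesis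
    proof (rule continuous_solve[where M=M and r=r])
      show "\<forall>\<^sub>F y in at x. linear (M y)" "\<forall>\<^sub>F y in at x. M y (w y) = r y"
        using evS by (auto elim!: eventually_mono intro: lin 0)
    qed (use S lin 0 that in \<open>auto simp: continuous_on_eq_continuous_at\<close>)
  qed
  then show ?case by (simp add: continuous_at_imp_continuous_on)
next
  case (Suc k)
  have wk: "C_k_on k S w"
    using Suc.prems by (intro Suc.IH[of r]) (auto intro: C_k_on_Suc_D simp del: C_k_on.simps(2))
  have wd: "w differentiable (at x)" if "x \<in> S" for x
    using Suc.prems lin that by (intro differentiable_solve[OF S that, of M r]) auto
  have eq: "M x (frechet_derivative w (at x) v) = frechet_derivative r (at x) v
      - (\<Sum>b\<in>Basis. (w x \<bullet> b) *\<^sub>R frechet_derivative (\<lambda>y. M y b) (at x) v)" if x: "x \<in> S" for x v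
  proof -
    let ?Dw = "frechet_derivative w (at x)"
    have dM: "((\<lambda>y. M y b) has_derivative frechet_derivative (\<lambda>y. M y b) (at x)) (at x)" for b
      using Suc.prems(1)[of b] x by (rule C_k_on_has_derivative)
    have dw: "(w has_derivative ?Dw) (at x)" using wd[OF x] by (simp add: frechet_derivative_works)
    have dr: "(r has_derivative frechet_derivative r (at x)) (at x)"
      using Suc.prems(2) x by (rule C_k_on_has_derivative)
    have "((\<lambda>y. \<Sum>b\<in>Basis. (w y \<bullet> b) *\<^sub>R M y b) has_derivative
       (\<lambda>v. \<Sum>b\<in>Basis. (w x \<bullet> b) *\<^sub>R frechet_derivative (\<lambda>y. M y b) (at x) v + (?Dw v \<bullet> b) *\<^sub>R M x b)) (at x)"
      by (intro has_derivative_sum has_derivative_scaleR has_derivative_inner_left dM dw)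
    moreover have "(\<Sum>b\<in>Basis. (w y \<bullet> b) *\<^sub>R M y b) = r y" if "y \<in> S" for y
      using linear_eq_sum_Basis[OF lin(1)[OF that]] Suc.prems(3)[OF that] by metis
    ultimately have "(r has_derivative
       (\<lambda>v. \<Sum>b\<in>Basis. (w x \<bullet> b) *\<^sub>R frechet_derivative (\<lambda>y. M y b) (at x) v + (?Dw v \<bullet> b) *\<^sub>R M x b)) (at x)"
      using S x has_derivative_transform_within_open by fastforce
    from has_derivative_unique[OF this dr] have
      "(\<Sum>b\<in>Basis. (w x \<bullet> b) *\<^sub>R frechet_derivative (\<lambda>y. M y b) (at x) v + (?Dw v \<bullet> b) *\<^sub>R M x b)
        = frechet_derivative r (at x) v" by (rule fun_cong)
    moreover have "M x (?Dw v) = (\<Sum>b\<in>Basis. (?Dw v \<bullet> b) *\<^sub>R M x b)"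
      using linear_eq_sum_Basis[OF lin(1)[OF x]] .
    ultimately show ?thesis by (simp add: sum.distrib algebra_simps)
  qed
  have "C_k_on k S (\<lambda>x. frechet_derivative w (at x) v)" for v
  proof (rule Suc.IH[OF _ _ eq])
    show "C_k_on k S (\<lambda>y. M y e)" for e using Suc.prems(1) C_k_on_Suc_D by blast
    show "C_k_on k S (\<lambda>x. frechet_derivative r (at x) v
      - (\<Sum>b\<in>Basis. (w x \<bullet> b) *\<^sub>R frechet_derivative (\<lambda>y. M y b) (at x) v))"
      using Suc.prems(1,2)
      by (intro C_k_on_diff C_k_on_sum C_k_on_scaleR C_k_on_inner C_k_on_const S wk) auto
  qed
  then show ?case using wd by simp
qed

text \<open>The nonlinear analogue of \<open>differentiable_solve\<close>: a left inverse
  \<open>B\<close> of the derivative of \<psi> predicts the derivative of \<open>w\<close>, and the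
  continuity of \<open>w\<close> makes the linearisation error of \<psi> along \<open>w\<close>
  small.\<close>

lemma differentiable_implicit:
  fixes \<psi> :: "'b::euclidean_space \<Rightarrow> 'c::euclidean_space" and w :: "'a::euclidean_space \<Rightarrow> 'b"
  assumes S: "open S" "x \<in> S" and psi: "(\<psi> has_derivative A) (at (w x))" "inj A"
    and w: "isCont w x" and h: "h differentiable (at x)" and eq: "\<And>y. y \<in> S \<Longrightarrow> \<psi> (w y) = h y"
  shows "w differentiable (at x)"
proof -
  obtain B K where B: "bounded_linear B" "\<And>v. B (A v) = v" "K > 0" "\<And>y. norm (B y) \<le> K * norm y"
    using linear_inj_left_inverse[OF has_derivative_linear[OF psi(1)] psi(2)] by blast
  interpret B: bounded_linear B by (rule B)
  \<comment> \<open>The relative error of linearising \<psi> at \<open>w x\<close>. Division by 0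
    yields 0 at \<open>w x\<close> itself, which is exactly the value that makes it continuous
    there.\<close>
  define \<rho> where "\<rho> z = norm (\<psi> z - \<psi> (w x) - A (z - w x)) / norm (z - w x)" for z
  have "(\<rho> \<longlongrightarrow> 0) (at (w x))" using psi(1) by (simp add: has_derivative_iff_norm \<rho>_def[abs_def])
  moreover have "\<rho> (w x) = 0" by (simp add: \<rho>_def)
  ultimately have "isCont \<rho> (w x)" by (simp add: isCont_def)
  then have "isCont (\<lambda>y. \<rho> (w y)) x" using w isCont_o2 by blast
  then have lim: "((\<lambda>y. \<rho> (w y)) \<longlongrightarrow> 0) (at x)" using \<open>\<rho> (w x) = 0\<close> by (simp add: isCont_def)
  define E where "E y = w y - w x - B (h y - h x)" for y
  have hd: "((\<lambda>y. h y - h x) has_derivative frechet_derivative h (at x)) (at x)"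
    using has_derivative_diff[OF h[unfolded frechet_derivative_works] has_derivative_const[of "h x"]] by simp
  have "(E has_derivative (\<lambda>v. 0)) (at x)"
  proof (rule has_derivative_zero_product_bound[OF hd])
    have "((\<lambda>y. \<rho> (w y) * (2 * K * K)) \<longlongrightarrow> 0) (at x)"
      by (rule tendsto_mult_left_zero[OF lim])
    then show "((\<lambda>y. 2 * K * K * \<rho> (w y)) \<longlongrightarrow> 0) (at x)" by (simp add: mult.commute)
    have "\<forall>\<^sub>F y in at x. \<rho> (w y) < 1 / (2 * K)" using lim by (rule order_tendstoD) (use B in simp)
    moreover have "\<forall>\<^sub>F y in at x. y \<in> S" using S by (simp add: eventually_at_in_open' )
    ultimately show "\<forall>\<^sub>F y in at x. norm (E y) \<le> 2 * K * K * \<rho> (w y) * norm (h y - h x)"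
    proof eventually_elim
      case (elim y)
      let ?R = "norm (w y - w x)"
      have "E y = - B (\<psi> (w y) - \<psi> (w x) - A (w y - w x))"
        using eq elim S B(2) by (simp add: E_def B.diff)
      then have "norm (E y) \<le> K * norm (\<psi> (w y) - \<psi> (w x) - A (w y - w x))" using B(4) by simp
      also have "norm (\<psi> (w y) - \<psi> (w x) - A (w y - w x)) = \<rho> (w y) * ?R"
        by (cases "w y = w x") (simp_all add: \<rho>_def linear_0[OF has_derivative_linear[OF psi(1)]])
      finally have 1: "norm (E y) \<le> K * (\<rho> (w y) * ?R)" .
      have "\<rho> (w y) \<ge> 0" by (simp add: \<rho>_def)
      have "\<rho> (w y) * ?R \<le> (1 / (2 * K)) * ?R" using elim by (intro mult_right_mono) auto
      then have "K * (\<rho> (w y) * ?R) \<le> K * ((1 / (2 * K)) * ?R)" using B(3) by (intro mult_left_mono) auto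
      then have "norm (E y) \<le> ?R / 2" using 1 B(3) by (simp add: field_simps)
      moreover have "?R \<le> norm (E y) + K * norm (h y - h x)"
        using B(4)[of "h y - h x"] norm_triangle_ineq[of "E y" "B (h y - h x)"] by (simp add: E_def)
      ultimately have "?R \<le> 2 * K * norm (h y - h x)" by linarith
      then have "K * (\<rho> (w y) * ?R) \<le> K * (\<rho> (w y) * (2 * K * norm (h y - h x)))"
        using B(3) \<open>\<rho> (w y) \<ge> 0\<close> by (intro mult_left_mono) auto
      then show ?case using 1 by (simp add: algebra_simps)
    qed
  qed (auto simp: E_def B.zero)
  then have "((\<lambda>y. w x + B (h y - h x) + E y) has_derivative
      (\<lambda>v. 0 + B (frechet_derivative h (at x) v) + 0)) (at x)"
    by (intro has_derivative_add has_derivative_const B.has_derivative hd)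
  moreover have "(\<lambda>y. w x + B (h y - h x) + E y) = w" by (auto simp: E_def)
  ultimately show ?thesis by (auto simp: differentiable_def)
qed

text \<open>Bootstrapping: if \<open>w\<close> is of class \<open>k\<close>, the differentiated
  equation is a linear system for the derivative of \<open>w\<close> with coefficients of class
  \<open>k\<close>, and \<open>w\<close> gains one order. Since \<psi> may map into a space of
  larger dimension, it can be a parametrisation of a submanifold.\<close>

lemma smooth_on_implicit:
  fixes \<psi> :: "'b::euclidean_space \<Rightarrow> 'c::euclidean_space" and w :: "'a::euclidean_space \<Rightarrow> 'b"
  assumes S: "open S" and T: "open T" and psi: "smooth_on T \<psi>" "\<And>z. z \<in> T \<Longrightarrow> inj (frechet_derivative \<psi> (at z))"
    and w: "continuous_on S w" "\<And>y. y \<in> S \<Longrightarrow> w y \<in> T"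
    and h: "smooth_on S h" and eq: "\<And>y. y \<in> S \<Longrightarrow> \<psi> (w y) = h y"
  shows "smooth_on S w"
proof -
  have psid: "(\<psi> has_derivative frechet_derivative \<psi> (at z)) (at z)" if "z \<in> T" for z
    using psi(1) that C_k_on_has_derivative[of 0] unfolding smooth_on_def by blast
  have hd: "(h has_derivative frechet_derivative h (at y)) (at y)" if "y \<in> S" for y
    using h that C_k_on_has_derivative[of 0] unfolding smooth_on_def by blast
  have "w differentiable (at x)" if "x \<in> S" for x
  proof (rule differentiable_implicit[where \<psi>=\<psi> and h=h])
    show "(\<psi> has_derivative frechet_derivative \<psi> (at (w x))) (at (w x))" by (rule psid[OF w(2)[OF that]])
  qed (use w that hd[OF that] eq S psi in \<open>auto simp: continuous_on_eq_continuous_at differentiable_def\<close>)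
  then have wd: "(w has_derivative frechet_derivative w (at x)) (at x)" if "x \<in> S" for x
    using that by (simp add: frechet_derivative_works)
  have deq: "frechet_derivative \<psi> (at (w x)) (frechet_derivative w (at x) v) = frechet_derivative h (at x) v"
    if "x \<in> S" for x v
  proof -
    have "((\<lambda>y. \<psi> (w y)) has_derivative (\<lambda>v. frechet_derivative \<psi> (at (w x)) (frechet_derivative w (at x) v))) (at x)"
      using has_derivative_compose[OF wd[OF that] psid[OF w(2)[OF that]]] by simp
    then have "(h has_derivative (\<lambda>v. frechet_derivative \<psi> (at (w x)) (frechet_derivative w (at x) v))) (at x)"
      using S that eq by (rule has_derivative_transform_within_open)
    from frechet_derivative_eqI[OF this] show ?thesis by simp
  qed
  have "C_k_on k S w" for k
  proof (induction k)
    case 0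
    then show ?case using w by simp
  next
    case (Suc k)
    have "C_k_on k S (\<lambda>x. frechet_derivative w (at x) v)" for v
    proof (rule C_k_on_solve[OF S, where M="\<lambda>y. frechet_derivative \<psi> (at (w y))" and r="\<lambda>x. frechet_derivative h (at x) v"])
      show "C_k_on k S (\<lambda>y. frechet_derivative \<psi> (at (w y)) e)" for e
        by (rule C_k_on_compose[OF S T w(2) Suc.IH, where g="\<lambda>z. frechet_derivative \<psi> (at z) e"])
          (use psi(1) C_k_on.simps(2)[of k T \<psi>] in \<open>auto simp: smooth_on_def simp del: C_k_on.simps\<close>)
      show "C_k_on k S (\<lambda>x. frechet_derivative h (at x) v)"
        using h C_k_on.simps(2)[of k S h] by (auto simp: smooth_on_def simp del: C_k_on.simps)
      show "linear (frechet_derivative \<psi> (at (w y)))" if "y \<in> S" for y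
        using psid[OF w(2)[OF that]] by (rule has_derivative_linear)
    qed (use w psi deq in auto)
    then show ?case using wd by (auto simp: differentiable_def)
  qed
  then show ?thesis by (simp add: smooth_on_def)
qed


section \<open>Symmetry of second derivatives\<close>

text \<open>The mean value theorem is applied in direction \<open>a\<close> to the increment of
  \<open>f\<close> under the shift by \<open>t *\<^sub>R b\<close>, then in direction
  \<open>b\<close>. The second difference is symmetric in \<open>a\<close> and \<open>b\<close>,
  which is what forces the mixed derivatives to agree.\<close>

lemma second_difference_mean_value:
  fixes f :: "'a::euclidean_space \<Rightarrow> real"
  assumes S: "open S" "C_k_on 2 S f" and t: "t > 0"
    and sub: "\<And>s s'. 0 \<le> s \<Longrightarrow> s \<le> t \<Longrightarrow> 0 \<le> s' \<Longrightarrow> s' \<le> t \<Longrightarrow> x + s *\<^sub>R a + s' *\<^sub>R b \<in> S"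
  obtains s s' where "0 < s" "s < t" "0 < s'" "s' < t"
    "f (x + t *\<^sub>R a + t *\<^sub>R b) - f (x + t *\<^sub>R a) - f (x + t *\<^sub>R b) + f x =
      t * (t * frechet_derivative (\<lambda>y. frechet_derivative f (at y) a) (at (x + s *\<^sub>R a + s' *\<^sub>R b)) b)"
proof -
  let ?f' = "\<lambda>y. frechet_derivative f (at y)"
  have f1: "(f has_derivative ?f' y) (at y)" if "y \<in> S" for y
    using S(2) that C_k_on_has_derivative[of 1] by (simp add: numeral_2_eq_2 del: C_k_on.simps)
  have "C_k_on (Suc 0) S (\<lambda>y. ?f' y a)"
    using S(2) C_k_on.simps(2)[of 1 S f] by (simp add: numeral_2_eq_2 del: C_k_on.simps)
  then have f2: "((\<lambda>y. ?f' y a) has_derivative frechet_derivative (\<lambda>y. ?f' y a) (at y)) (at y)"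
    if "y \<in> S" for y using that by (rule C_k_on_has_derivative)
  have d1: "((\<lambda>s. f (z + s *\<^sub>R a)) has_real_derivative ?f' (z + s *\<^sub>R a) a) (at s)"
    if "z + s *\<^sub>R a \<in> S" for z s
  proof -
    have "((\<lambda>s. z + s *\<^sub>R a) has_derivative (\<lambda>h. h *\<^sub>R a)) (at s)" by (auto intro!: derivative_eq_intros)
    then have "((\<lambda>s. f (z + s *\<^sub>R a)) has_derivative (\<lambda>h. ?f' (z + s *\<^sub>R a) (h *\<^sub>R a))) (at s)"
      using f1[OF that] by (rule has_derivative_compose)
    then show ?thesis
      using linear_scale[OF has_derivative_linear[OF f1[OF that]]]
      by (simp add: has_field_derivative_def mult_commute_abs)
  qed
  have d2: "((\<lambda>s. ?f' (z + s *\<^sub>R b) a) has_real_derivative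
      frechet_derivative (\<lambda>y. ?f' y a) (at (z + s *\<^sub>R b)) b) (at s)"
    if "z + s *\<^sub>R b \<in> S" for z s
  proof -
    have "((\<lambda>s. z + s *\<^sub>R b) has_derivative (\<lambda>h. h *\<^sub>R b)) (at s)" by (auto intro!: derivative_eq_intros)
    then have "((\<lambda>s. ?f' (z + s *\<^sub>R b) a) has_derivative
        (\<lambda>h. frechet_derivative (\<lambda>y. ?f' y a) (at (z + s *\<^sub>R b)) (h *\<^sub>R b))) (at s)"
      using f2[OF that] by (rule has_derivative_compose)
    then show ?thesis
      using linear_scale[OF has_derivative_linear[OF f2[OF that]]]
      by (simp add: has_field_derivative_def mult_commute_abs)
  qed
  let ?P = "\<lambda>s. f (x + t *\<^sub>R b + s *\<^sub>R a) - f (x + s *\<^sub>R a)"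
  have dP: "(?P has_real_derivative (?f' (x + t *\<^sub>R b + s *\<^sub>R a) a - ?f' (x + s *\<^sub>R a) a)) (at s)"
    if "0 \<le> s" "s \<le> t" for s
    using sub[of s t] sub[of s 0] that t by (intro DERIV_diff d1) (simp_all add: ac_simps)
  obtain s where s: "0 < s" "s < t"
    "?P t - ?P 0 = (t - 0) * (?f' (x + t *\<^sub>R b + s *\<^sub>R a) a - ?f' (x + s *\<^sub>R a) a)"
    using MVT2[OF t dP] by blast
  have d2': "((\<lambda>r. ?f' (x + s *\<^sub>R a + r *\<^sub>R b) a) has_real_derivative
      frechet_derivative (\<lambda>y. ?f' y a) (at (x + s *\<^sub>R a + r *\<^sub>R b)) b) (at r)"
    if "0 \<le> r" "r \<le> t" for r
    using s(1,2) that by (intro d2 sub) simp_all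
  obtain s' where s': "0 < s'" "s' < t"
    "?f' (x + s *\<^sub>R a + t *\<^sub>R b) a - ?f' (x + s *\<^sub>R a + 0 *\<^sub>R b) a
     = (t - 0) * frechet_derivative (\<lambda>y. ?f' y a) (at (x + s *\<^sub>R a + s' *\<^sub>R b)) b"
    using MVT2[OF t d2'] by blast
  show ?thesis
    by (rule that[OF s(1,2) s'(1,2)]) (use s s' in \<open>simp add: ac_simps\<close>)
qed

lemma second_derivative_symmetric_real:
  fixes f :: "'a::euclidean_space \<Rightarrow> real"
  assumes S: "open S" "x \<in> S" "C_k_on 2 S f"
  shows "frechet_derivative (\<lambda>y. frechet_derivative f (at y) a) (at x) b =
         frechet_derivative (\<lambda>y. frechet_derivative f (at y) b) (at x) a"
proof (rule ccontr)
  define H where "H a b z = frechet_derivative (\<lambda>y. frechet_derivative f (at y) a) (at z) b" for a b z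
  assume "\<not> ?thesis"
  then have ne: "\<bar>H a b x - H b a x\<bar> > 0" by (simp add: H_def)
  \<comment> \<open>Half of the gap: numbers at distance less than \<open>e\<close> from its two
    ends cannot coincide.\<close>
  define e where "e = \<bar>H a b x - H b a x\<bar> / 2"
  have e: "e > 0" using ne by (simp add: e_def)
  have cont: "isCont (H a b) x" for a b
    using S by (simp add: numeral_2_eq_2 H_def[abs_def] continuous_on_eq_continuous_at)
  have "\<forall>\<^sub>F z in nhds x. z \<in> S \<and> dist (H a b z) (H a b x) < e \<and> dist (H b a z) (H b a x) < e"
    using cont[of a b] cont[of b a] e S unfolding continuous_at
    by (intro eventually_conj)
      (auto simp: tendsto_iff eventually_nhds_in_open elim!: allE[of _ e] intro: eventually_nhds_conv_at[THEN iffD2])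
  then obtain d where d: "d > 0"
    "\<And>z. dist z x < d \<Longrightarrow> z \<in> S \<and> dist (H a b z) (H a b x) < e \<and> dist (H b a z) (H b a x) < e"
    unfolding eventually_nhds_metric by blast
  \<comment> \<open>Keeps the parallelogram with sides \<open>t *\<^sub>R a\<close> and
    \<open>t *\<^sub>R b\<close> within distance \<open>d\<close> of \<open>x\<close>; the summand 1
    covers \<open>a = b = 0\<close>.\<close>
  define t where "t = d / (2 * (norm a + norm b + 1))"
  have t: "t > 0" using d by (simp add: t_def add_nonneg_pos)
  have small: "dist (x + s *\<^sub>R a + s' *\<^sub>R b) x < d" if "0 \<le> s" "s \<le> t" "0 \<le> s'" "s' \<le> t" for s s'
  proof -
    have "dist (x + s *\<^sub>R a + s' *\<^sub>R b) x = norm (s *\<^sub>R a + s' *\<^sub>R b)" by (simp add: dist_norm algebra_simps)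
    also have "\<dots> \<le> s * norm a + s' * norm b"
      using norm_triangle_ineq[of "s *\<^sub>R a" "s' *\<^sub>R b"] that by simp
    also have "\<dots> \<le> t * norm a + t * norm b" using that by (intro add_mono mult_right_mono) auto
    also have "\<dots> \<le> t * (norm a + norm b + 1)" using t by (simp add: algebra_simps)
    also have "\<dots> = d / 2" by (simp add: t_def field_simps add_nonneg_eq_0_iff)
    finally show ?thesis using d by simp
  qed
  have sub: "x + s *\<^sub>R a + s' *\<^sub>R b \<in> S" if "0 \<le> s" "s \<le> t" "0 \<le> s'" "s' \<le> t" for s s'
    using d(2)[OF small[OF that]] by blast
  obtain s s' where s: "0 < s" "s < t" "0 < s'" "s' < t"
    "f (x + t *\<^sub>R a + t *\<^sub>R b) - f (x + t *\<^sub>R a) - f (x + t *\<^sub>R b) + f x = t * (t * H a b (x + s *\<^sub>R a + s' *\<^sub>R b))"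
    unfolding H_def by (rule second_difference_mean_value[OF S(1,3) t sub])
  have sub': "x + s *\<^sub>R b + s' *\<^sub>R a \<in> S" if "0 \<le> s" "s \<le> t" "0 \<le> s'" "s' \<le> t" for s s'
    using sub[of s' s] that by (simp add: ac_simps)
  obtain r r' where r: "0 < r" "r < t" "0 < r'" "r' < t"
    "f (x + t *\<^sub>R b + t *\<^sub>R a) - f (x + t *\<^sub>R b) - f (x + t *\<^sub>R a) + f x = t * (t * H b a (x + r *\<^sub>R b + r' *\<^sub>R a))"
    unfolding H_def by (rule second_difference_mean_value[OF S(1,3) t sub'])
  have "t * (t * H a b (x + s *\<^sub>R a + s' *\<^sub>R b)) = t * (t * H b a (x + r *\<^sub>R b + r' *\<^sub>R a))"
    using s(5) r(5) by (simp only: add.assoc add.commute[of "t *\<^sub>R b"])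
  then have eq: "H a b (x + s *\<^sub>R a + s' *\<^sub>R b) = H b a (x + r' *\<^sub>R a + r *\<^sub>R b)" using t by (simp add: ac_simps)
  have "\<bar>H a b (x + s *\<^sub>R a + s' *\<^sub>R b) - H a b x\<bar> < e"
    using d(2)[OF small[of s s']] s by (simp add: dist_real_def)
  moreover have "\<bar>H b a (x + r' *\<^sub>R a + r *\<^sub>R b) - H b a x\<bar> < e"
    using d(2)[OF small[of r' r]] r by (simp add: dist_real_def)
  ultimately have "\<bar>H a b x - H b a x\<bar> < e + e" using eq by linarith
  then show False by (simp add: e_def)
qed

lemma second_derivative_symmetric:
  fixes f :: "'a::euclidean_space \<Rightarrow> 'b::euclidean_space"
  assumes S: "open S" "x \<in> S" "C_k_on 2 S f"
  shows "frechet_derivative (\<lambda>y. frechet_derivative f (at y) a) (at x) b =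
         frechet_derivative (\<lambda>y. frechet_derivative f (at y) b) (at x) a"
proof (rule euclidean_eqI)
  fix c :: 'b
  have f1: "(f has_derivative frechet_derivative f (at y)) (at y)" if "y \<in> S" for y
    using S(3) that C_k_on_has_derivative[of 1] by (simp add: numeral_2_eq_2 del: C_k_on.simps)
  have "C_k_on (Suc 0) S (\<lambda>y. frechet_derivative f (at y) a)" for a
    using S(3) C_k_on.simps(2)[of 1 S f] by (simp add: numeral_2_eq_2 del: C_k_on.simps)
  then have f2: "((\<lambda>y. frechet_derivative f (at y) a) has_derivative
      frechet_derivative (\<lambda>y. frechet_derivative f (at y) a) (at x)) (at x)" for a
    using S(2) by (rule C_k_on_has_derivative)
  have g: "C_k_on 2 S (\<lambda>y. f y \<bullet> c)" using S by (intro C_k_on_inner C_k_on_const)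
  have "frechet_derivative (\<lambda>y. f y \<bullet> c) (at y) a = frechet_derivative f (at y) a \<bullet> c" if "y \<in> S" for y a
    using frechet_derivative_eqI[OF has_derivative_inner_left[OF f1[OF that], of c]] by simp
  then have "frechet_derivative (\<lambda>y. frechet_derivative (\<lambda>y. f y \<bullet> c) (at y) a) (at x) b
      = frechet_derivative (\<lambda>y. frechet_derivative f (at y) a) (at x) b \<bullet> c" for a b
    using frechet_derivative_cong_open[OF S(1,2), of "\<lambda>y. frechet_derivative (\<lambda>y. f y \<bullet> c) (at y) a"
        "\<lambda>y. frechet_derivative f (at y) a \<bullet> c"]
      frechet_derivative_eqI[OF has_derivative_inner_left[OF f2, of a c]] by simp
  then show "frechet_derivative (\<lambda>y. frechet_derivative f (at y) a) (at x) b \<bullet> c =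
         frechet_derivative (\<lambda>y. frechet_derivative f (at y) b) (at x) a \<bullet> c"
    using second_derivative_symmetric_real[OF S(1,2) g] by metis
qed


section \<open>Closure properties of smooth maps\<close>

lemma smooth_on_has_derivative:
  "smooth_on S f \<Longrightarrow> x \<in> S \<Longrightarrow> (f has_derivative frechet_derivative f (at x)) (at x)"
  unfolding smooth_on_def using C_k_on_has_derivative[of 0] by blast

lemma smooth_on_differentiable: "smooth_on S f \<Longrightarrow> x \<in> S \<Longrightarrow> f differentiable (at x)"
  using smooth_on_has_derivative differentiableI by blast

lemma smooth_on_linear: "smooth_on S f \<Longrightarrow> x \<in> S \<Longrightarrow> linear (frechet_derivative f (at x))"
  by (rule has_derivative_linear[OF smooth_on_has_derivative])

lemma smooth_on_frechet: "smooth_on S f \<Longrightarrow> smooth_on S (\<lambda>x. frechet_derivative f (at x) v)"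
  unfolding smooth_on_def using C_k_on.simps(2) by blast

lemma smooth_on_continuous: "smooth_on S f \<Longrightarrow> continuous_on S f"
  unfolding smooth_on_def using C_k_on_continuous by blast

lemma smooth_on_subset: "smooth_on S f \<Longrightarrow> T \<subseteq> S \<Longrightarrow> smooth_on T f"
  unfolding smooth_on_def using C_k_on_subset by blast

lemma smooth_on_cong: "open S \<Longrightarrow> (\<And>y. y \<in> S \<Longrightarrow> f y = g y) \<Longrightarrow> smooth_on S f \<Longrightarrow> smooth_on S g"
  unfolding smooth_on_def using C_k_on_cong[of S f g] by blast

lemma smooth_on_ident: "smooth_on S (\<lambda>x. x)"
  and smooth_on_const: "smooth_on S (\<lambda>x. c)"
  by (simp_all add: smooth_on_def C_k_on_ident C_k_on_const)

lemma smooth_on_add: "open S \<Longrightarrow> smooth_on S f \<Longrightarrow> smooth_on S g \<Longrightarrow> smooth_on S (\<lambda>x. f x + g x)"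
  and smooth_on_diff: "open S \<Longrightarrow> smooth_on S f \<Longrightarrow> smooth_on S g \<Longrightarrow> smooth_on S (\<lambda>x. f x - g x)"
  by (simp_all add: smooth_on_def C_k_on_add C_k_on_diff)

lemma smooth_on_scaleR: "open S \<Longrightarrow> smooth_on S f \<Longrightarrow> smooth_on S g \<Longrightarrow> smooth_on S (\<lambda>x. f x *\<^sub>R g x)"
  and smooth_on_inner: "open S \<Longrightarrow> smooth_on S h \<Longrightarrow> smooth_on S g \<Longrightarrow> smooth_on S (\<lambda>x. h x \<bullet> g x)"
  by (simp_all add: smooth_on_def C_k_on_scaleR C_k_on_inner)

lemma smooth_on_sum: "open S \<Longrightarrow> (\<And>i. i \<in> I \<Longrightarrow> smooth_on S (f i)) \<Longrightarrow> smooth_on S (\<lambda>x. \<Sum>i\<in>I. f i x)"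
  by (simp add: smooth_on_def C_k_on_sum)

lemma smooth_on_bounded_linear: "bounded_linear L \<Longrightarrow> open S \<Longrightarrow> smooth_on S f \<Longrightarrow> smooth_on S (\<lambda>x. L (f x))"
  by (simp add: smooth_on_def C_k_on_bounded_linear)

lemma smooth_on_compose:
  fixes f :: "'a::euclidean_space \<Rightarrow> 'b::euclidean_space"
  assumes "open S" "open T" "\<And>x. x \<in> S \<Longrightarrow> f x \<in> T" "smooth_on S f" "smooth_on T g"
  shows "smooth_on S (\<lambda>x. g (f x))"
  using assms(4,5) C_k_on_compose[OF assms(1,2), of f] assms(3) unfolding smooth_on_def by blast

lemma smooth_on_solve:
  fixes M :: "'a::euclidean_space \<Rightarrow> 'b::euclidean_space \<Rightarrow> 'c::euclidean_space"
  assumes "open S" "\<And>y. y \<in> S \<Longrightarrow> linear (M y)" "\<And>y. y \<in> S \<Longrightarrow> inj (M y)"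
    "\<And>e. smooth_on S (\<lambda>y. M y e)" "smooth_on S r" "\<And>y. y \<in> S \<Longrightarrow> M y (w y) = r y"
  shows "smooth_on S w"
  using C_k_on_solve[OF assms(1), of M _ r w] assms(2-6) unfolding smooth_on_def by blast

lemma smooth_on_symmetric:
  fixes f :: "'a::euclidean_space \<Rightarrow> 'b::euclidean_space"
  assumes "open S" "x \<in> S" "smooth_on S f"
  shows "frechet_derivative (\<lambda>y. frechet_derivative f (at y) a) (at x) b =
         frechet_derivative (\<lambda>y. frechet_derivative f (at y) b) (at x) a"
  using second_derivative_symmetric[OF assms(1,2)] assms(3) unfolding smooth_on_def by blast


text \<open>A product rule. The symmetry of second derivatives supplies the linearity in the slot of
  \<open>w x\<close> that allows the sum over \<open>Basis\<close> to be folded back.\<close>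

lemma has_derivative_frechet_field:
  fixes f :: "'a::euclidean_space \<Rightarrow> 'b::euclidean_space"
  assumes U: "open U" "x \<in> U" and f: "smooth_on U f" and w: "(w has_derivative w') (at x)"
  shows "((\<lambda>y. frechet_derivative f (at y) (w y)) has_derivative
    (\<lambda>v. frechet_derivative (\<lambda>y. frechet_derivative f (at y) (w x)) (at x) v + frechet_derivative f (at x) (w' v))) (at x)"
proof -
  let ?D = "\<lambda>y. frechet_derivative f (at y)"
  let ?D2 = "\<lambda>a. frechet_derivative (\<lambda>y. ?D y a) (at x)"
  have lin: "linear (?D y)" if "y \<in> U" for y using smooth_on_linear[OF f that] .
  have hd: "((\<lambda>y. ?D y b) has_derivative ?D2 b) (at x)" for b
    by (rule smooth_on_has_derivative[OF smooth_on_frechet[OF f] U(2)])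
  have lin2: "linear (\<lambda>a. ?D2 a v)" for v
    using has_derivative_linear[OF hd[of v]] smooth_on_symmetric[OF U f, of _ v] by simp
  have "((\<lambda>y. \<Sum>b\<in>Basis. (w y \<bullet> b) *\<^sub>R ?D y b) has_derivative
      (\<lambda>v. \<Sum>b\<in>Basis. (w x \<bullet> b) *\<^sub>R ?D2 b v + (w' v \<bullet> b) *\<^sub>R ?D x b)) (at x)"
    by (intro has_derivative_sum has_derivative_scaleR has_derivative_inner_left w hd)
  moreover have "(\<Sum>b\<in>Basis. (w y \<bullet> b) *\<^sub>R ?D y b) = ?D y (w y)" if "y \<in> U" for y
    using linear_eq_sum_Basis[OF lin[OF that]] by metis
  ultimately have "((\<lambda>y. ?D y (w y)) has_derivative
      (\<lambda>v. \<Sum>b\<in>Basis. (w x \<bullet> b) *\<^sub>R ?D2 b v + (w' v \<bullet> b) *\<^sub>R ?D x b)) (at x)"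
    using U has_derivative_transform_within_open by fastforce
  moreover have "(\<Sum>b\<in>Basis. (w x \<bullet> b) *\<^sub>R ?D2 b v + (w' v \<bullet> b) *\<^sub>R ?D x b) = ?D2 (w x) v + ?D x (w' v)" for v
    using linear_eq_sum_Basis[OF lin[OF U(2)], of "w' v"] linear_eq_sum_Basis[OF lin2, of "w x" v]
    by (simp add: sum.distrib)
  ultimately show ?thesis by simp
qed

section \<open>Submanifolds of the sphere with complex cone\<close>

locale complex_structure =
  fixes J :: "'h::euclidean_space \<Rightarrow> 'h"
  assumes linear_J: "linear J"
    and J_J [simp]: "J (J v) = - v"
    and inner_J_J [simp]: "J v \<bullet> J w = v \<bullet> w"
begin

lemmas J_simps = linear_add[OF linear_J] linear_diff[OF linear_J] linear_scale[OF linear_J]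
  linear_neg[OF linear_J] linear_0[OF linear_J]

lemma inner_J_left: "J v \<bullet> w = - (v \<bullet> J w)"
  using inner_J_J[of v "J w"] by simp

lemma inner_J_self [simp]: "v \<bullet> J v = 0" "J v \<bullet> v = 0"
  using inner_J_left[of v v] by (simp_all add: inner_commute)

lemma J_eq_0_iff [simp]: "J v = 0 \<longleftrightarrow> v = 0"
  by (metis J_J J_simps(5) neg_equal_0_iff_equal)

lemma bounded_linear_J: "bounded_linear J"
  using linear_J by (simp add: linear_conv_bounded_linear)

text \<open>The real part and, up to sign, the imaginary part of the Hermitian product are
  \<open>v \<bullet> w\<close> and \<open>v \<bullet> J w\<close>; the family is a Hermitian
  orthonormal basis and \<open>n\<close> is the complex dimension.\<close>

definition unitary_basis :: "'h set \<Rightarrow> nat \<Rightarrow> (nat \<Rightarrow> 'h) \<Rightarrow> bool" where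
  "unitary_basis V n u \<longleftrightarrow> (\<forall>i<n. u i \<in> V) \<and>
     (\<forall>i<n. \<forall>j<n. u i \<bullet> u j = (if i = j then 1 else 0) \<and> u i \<bullet> J (u j) = 0) \<and>
     (\<forall>v\<in>V. v = (\<Sum>i<n. (v \<bullet> u i) *\<^sub>R u i + (v \<bullet> J (u i)) *\<^sub>R J (u i)))"

text \<open>Gram-Schmidt by complex lines: as \<open>J\<close> is skew, the orthogonal complement of
  \<open>e\<close> and \<open>J e\<close> in \<open>V\<close> is again invariant under
  \<open>J\<close>, and its dimension is smaller.\<close>

lemma unitary_basis_exists:
  assumes "subspace V" "\<And>v. v \<in> V \<Longrightarrow> J v \<in> V"
  shows "\<exists>n u. unitary_basis V n u"
  using assms
proof (induction "dim V" arbitrary: V rule: less_induct)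
  case less
  show ?case
  proof (cases "V \<subseteq> {0}")
    case True
    then show ?thesis by (intro exI[of _ 0]) (auto simp: unitary_basis_def)
  next
    case False
    then obtain v where v: "v \<in> V" "v \<noteq> 0" by auto
    define e where "e = v /\<^sub>R norm v"
    have e: "e \<in> V" "e \<bullet> e = 1"
      using v less.prems by (simp_all add: e_def subspace_scale dot_square_norm power2_eq_square)
    define V' where "V' = {v \<in> V. v \<bullet> e = 0 \<and> v \<bullet> J e = 0}"
    have sV': "subspace V'"
      using less.prems(1) by (auto simp: V'_def subspace_def inner_add_left)
    have JV': "J v \<in> V'" if "v \<in> V'" for v
      using that less.prems(2) by (auto simp: V'_def inner_J_left)
    have "e \<notin> V'" using e by (simp add: V'_def)
    then have "V' \<noteq> V" using e by blast
    then have "dim V' < dim V"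
      using subspace_dim_equal[OF sV' less.prems(1)] dim_subset[of V' V]
      by (fastforce simp: V'_def)
    from less.hyps[OF this sV' JV'] obtain n u where u: "unitary_basis V' n u" by blast
    define u' where "u' = case_nat e u"
    have orth: "u i \<bullet> e = 0" "u i \<bullet> J e = 0" "e \<bullet> u i = 0" "e \<bullet> J (u i) = 0" "J e \<bullet> u i = 0" "u i \<in> V" if "i < n" for i
      using u that by (auto simp: unitary_basis_def V'_def inner_commute inner_J_left)
    have "unitary_basis V (Suc n) u'"
      unfolding unitary_basis_def
    proof (intro conjI ballI allI impI)
      fix i assume "i < Suc n"
      then show "u' i \<in> V" using e orth by (auto simp: u'_def split: nat.split)
      fix j assume "j < Suc n"
      then show "u' i \<bullet> u' j = (if i = j then 1 else 0)" "u' i \<bullet> J (u' j) = 0"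
        using \<open>i < Suc n\<close> e orth u by (auto simp: u'_def unitary_basis_def split: nat.split)
    next
      fix v assume v: "v \<in> V"
      define w where "w = v - (v \<bullet> e) *\<^sub>R e - (v \<bullet> J e) *\<^sub>R J e"
      have "w \<in> V'"
        using v e less.prems
        by (auto simp: w_def V'_def inner_diff_left subspace_diff subspace_scale)
      then have "w = (\<Sum>i<n. (w \<bullet> u i) *\<^sub>R u i + (w \<bullet> J (u i)) *\<^sub>R J (u i))"
        using u by (auto simp: unitary_basis_def)
      also have "\<dots> = (\<Sum>i<n. (v \<bullet> u i) *\<^sub>R u i + (v \<bullet> J (u i)) *\<^sub>R J (u i))"
        using orth by (intro sum.cong refl) (simp add: w_def inner_diff_left inner_commute[of e])
      finally show "v = (\<Sum>i<Suc n. (v \<bullet> u' i) *\<^sub>R u' i + (v \<bullet> J (u' i)) *\<^sub>R J (u' i))"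
        by (simp del: sum.lessThan_Suc add: sum.lessThan_Suc_shift u'_def w_def algebra_simps)
    qed
    then show ?thesis by blast
  qed
qed

lemma unitary_basis_dim:
  assumes "subspace V" "\<And>v. v \<in> V \<Longrightarrow> J v \<in> V" and u: "unitary_basis V n u"
  shows "dim V = 2 * n"
proof -
  let ?B = "u ` {..<n} \<union> (\<lambda>i. J (u i)) ` {..<n}"
  have o: "u i \<bullet> u j = (if i = j then 1 else 0)" "u i \<bullet> J (u j) = 0" "u i \<in> V"
    if "i < n" "j < n" for i j
    using u that by (auto simp: unitary_basis_def)
  have inj1: "inj_on u {..<n}" by (rule inj_onI) (metis lessThan_iff o(1) zero_neq_one)
  have inj2: "inj_on (\<lambda>i. J (u i)) {..<n}" by (rule inj_onI) (metis lessThan_iff o(1) zero_neq_one inner_J_J)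
  have disj: "u ` {..<n} \<inter> (\<lambda>i. J (u i)) ` {..<n} = {}"
  proof -
    have "u i \<noteq> J (u j)" if "i < n" "j < n" for i j using o[OF that] o(1)[of i i] that by auto
    then show ?thesis by auto
  qed
  have ne: "u i \<noteq> 0" if "i < n" for i using o(1)[of i i] that by auto
  have "pairwise orthogonal ?B"
    using o by (auto simp: pairwise_def orthogonal_def inner_J_left)
  then have ind: "independent ?B"
    by (rule pairwise_orthogonal_independent) (use ne in auto)
  have "?B \<subseteq> V" using o assms(2) by auto
  moreover have "V \<subseteq> span ?B"
  proof
    fix v assume "v \<in> V"
    then have "v = (\<Sum>i<n. (v \<bullet> u i) *\<^sub>R u i + (v \<bullet> J (u i)) *\<^sub>R J (u i))" using u by (auto simp: unitary_basis_def)
    also have "\<dots> \<in> span ?B" by (intro span_sum span_add span_scale span_base) auto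
    finally show "v \<in> span ?B" .
  qed
  ultimately have "dim V = card ?B" using ind by (intro dim_unique[where B="?B"]) auto
  also have "\<dots> = 2 * n" using inj1 inj2 disj by (simp add: card_Un_disjoint card_image)
  finally show ?thesis .
qed

end

text \<open>Below, \<open>tang x y\<close> is the coordinate vector of the tangential part of \<open>y\<close>, so that \<open>\<Gamma>\<close> are the
  Christoffel symbols and \<open>II\<close> is the second fundamental form of the image.\<close>

locale local_immersion =
  fixes U :: "'e::euclidean_space set" and f :: "'e \<Rightarrow> 'h::euclidean_space"
  assumes open_U: "open U" and smooth_f: "smooth_on U f"
    and inj_D: "\<And>x. x \<in> U \<Longrightarrow> inj (frechet_derivative f (at x))"
begin

definition D :: "'e \<Rightarrow> 'e \<Rightarrow> 'h" where "D x a = frechet_derivative f (at x) a"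

definition D2 :: "'e \<Rightarrow> 'e \<Rightarrow> 'e \<Rightarrow> 'h" where "D2 x a b = frechet_derivative (\<lambda>y. D y a) (at x) b"

lemma has_derivative_f: "x \<in> U \<Longrightarrow> (f has_derivative D x) (at x)"
  using smooth_on_has_derivative[OF smooth_f] by (simp add: D_def[abs_def])

lemma linear_D: "x \<in> U \<Longrightarrow> linear (D x)"
  using has_derivative_f by (rule has_derivative_linear)

lemma smooth_D: "smooth_on U (\<lambda>x. D x a)"
  using smooth_on_frechet[OF smooth_f] by (simp add: D_def)

lemma has_derivative_D: "x \<in> U \<Longrightarrow> ((\<lambda>y. D y a) has_derivative D2 x a) (at x)"
  using smooth_on_has_derivative[OF smooth_D] by (simp add: D2_def[abs_def])

lemma linear_D2: "x \<in> U \<Longrightarrow> linear (D2 x a)"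
  using has_derivative_D by (rule has_derivative_linear)

lemma smooth_D2: "smooth_on U (\<lambda>x. D2 x a b)"
  using smooth_on_frechet[OF smooth_D] by (simp add: D2_def)

lemma D2_sym: "x \<in> U \<Longrightarrow> D2 x a b = D2 x b a"
  using smooth_on_symmetric[OF open_U _ smooth_f] by (simp add: D2_def D_def[abs_def])

lemma linear_D2': "x \<in> U \<Longrightarrow> linear (\<lambda>a. D2 x a b)"
  using linear_D2[of x b] by (simp add: D2_sym[of x _ b])

lemma D_inject: "x \<in> U \<Longrightarrow> D x a = D x b \<longleftrightarrow> a = b"
  using inj_D[of x] by (auto simp: D_def inj_def)

lemma D_inner_eqI:
  assumes "x \<in> U" "\<And>e. D x a \<bullet> D x e = D x b \<bullet> D x e" shows "a = b"
proof -
  have "(D x a - D x b) \<bullet> D x (a - b) = 0" using assms(2)[of "a - b"] by (simp add: inner_diff_left)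
  then have "D x a = D x b" using linear_diff[OF linear_D[OF assms(1)], of a b] by simp
  then show ?thesis using D_inject[OF assms(1)] by simp
qed

text \<open>The Gram operator of \<open>D x\<close>, that is, the operator of the normal equations
  of least squares. \<open>tang\<close> is defined through these equations because their
  coefficients are smooth, so that \<open>smooth_on_solve\<close> applies.\<close>

definition normal_op :: "'e \<Rightarrow> 'e \<Rightarrow> 'e" where
  "normal_op x w = (\<Sum>b\<in>Basis. (D x w \<bullet> D x b) *\<^sub>R b)"

lemma linear_normal_op: "x \<in> U \<Longrightarrow> linear (normal_op x)"
  unfolding normal_op_def
  by (intro linearI) (simp_all add: linear_add[OF linear_D] linear_scale[OF linear_D] inner_add_left
      scaleR_add_left sum.distrib scaleR_sum_right)

lemma sum_D_Basis_eq_iff: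
  assumes "x \<in> U"
  shows "(\<Sum>b\<in>Basis. (y \<bullet> D x b) *\<^sub>R b) = (\<Sum>b\<in>Basis. (z \<bullet> D x b) *\<^sub>R b) \<longleftrightarrow> (\<forall>e. y \<bullet> D x e = z \<bullet> D x e)"
    (is "?L \<longleftrightarrow> ?R")
proof
  assume L: ?L
  have b: "y \<bullet> D x b = z \<bullet> D x b" if "b \<in> Basis" for b
    using arg_cong[OF L, of "\<lambda>v. v \<bullet> b"] that by simp
  show ?R
  proof
    fix e
    show "y \<bullet> D x e = z \<bullet> D x e"
      using linear_eq_sum_Basis[OF linear_D[OF assms], of e] b by (simp add: inner_sum_right)
  qed
qed simp

lemma inj_normal_op: "x \<in> U \<Longrightarrow> inj (normal_op x)"
  by (rule injI) (simp add: normal_op_def sum_D_Basis_eq_iff D_inner_eqI)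

definition tang :: "'e \<Rightarrow> 'h \<Rightarrow> 'e" where
  "tang x y = (SOME w. normal_op x w = (\<Sum>b\<in>Basis. (y \<bullet> D x b) *\<^sub>R b))"

lemma normal_op_tang:
  assumes "x \<in> U" shows "normal_op x (tang x y) = (\<Sum>b\<in>Basis. (y \<bullet> D x b) *\<^sub>R b)"
proof -
  have "surj (normal_op x)"
    using assms by (intro linear_inj_imp_surj linear_normal_op inj_normal_op)
  then have "\<exists>w. normal_op x w = (\<Sum>b\<in>Basis. (y \<bullet> D x b) *\<^sub>R b)" by (metis surjD)
  then show ?thesis unfolding tang_def by (rule someI_ex)
qed

lemma D_tang_inner: "x \<in> U \<Longrightarrow> D x (tang x y) \<bullet> D x e = y \<bullet> D x e"
  using normal_op_tang[of x y] sum_D_Basis_eq_iff[of x "D x (tang x y)" y] by (simp add: normal_op_def)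

lemma tang_eqI:
  assumes "x \<in> U" "\<And>e. D x w \<bullet> D x e = y \<bullet> D x e" shows "tang x y = w"
proof (rule D_inner_eqI[OF assms(1)])
  show "D x (tang x y) \<bullet> D x e = D x w \<bullet> D x e" for e
    using D_tang_inner[OF assms(1)] assms(2) by simp
qed

lemma tang_D [simp]: "x \<in> U \<Longrightarrow> tang x (D x w) = w"
  by (rule tang_eqI) auto

lemma linear_tang: "x \<in> U \<Longrightarrow> linear (tang x)"
  by (rule linearI; rule tang_eqI)
    (simp_all add: linear_add[OF linear_D] linear_scale[OF linear_D] D_tang_inner inner_add_left)

lemma smooth_tang:
  assumes "smooth_on U r" shows "smooth_on U (\<lambda>x. tang x (r x))"
proof (rule smooth_on_solve[OF open_U linear_normal_op inj_normal_op])
  show "smooth_on U (\<lambda>x. normal_op x e)" for e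
    unfolding normal_op_def by (intro smooth_on_sum smooth_on_scaleR smooth_on_inner smooth_on_const smooth_D open_U)
  show "smooth_on U (\<lambda>x. \<Sum>b\<in>Basis. (r x \<bullet> D x b) *\<^sub>R b)"
    by (intro smooth_on_sum smooth_on_scaleR smooth_on_inner smooth_on_const smooth_D open_U assms)
qed (simp_all add: normal_op_tang)

lemma has_derivative_D_field:
  assumes "x \<in> U" "(w has_derivative w') (at x)"
  shows "((\<lambda>y. D y (w y)) has_derivative (\<lambda>v. D2 x (w x) v + D x (w' v))) (at x)"
  using has_derivative_frechet_field[OF open_U assms(1) smooth_f assms(2)] by (simp add: D_def[abs_def] D2_def)

lemma smooth_D_field:
  assumes "smooth_on U w" shows "smooth_on U (\<lambda>y. D y (w y))"
proof (rule smooth_on_cong[OF open_U])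
  show "smooth_on U (\<lambda>y. \<Sum>b\<in>Basis. (w y \<bullet> b) *\<^sub>R D y b)"
    by (intro smooth_on_sum smooth_on_scaleR smooth_on_inner smooth_on_const smooth_D open_U assms)
  show "(\<Sum>b\<in>Basis. (w y \<bullet> b) *\<^sub>R D y b) = D y (w y)" if "y \<in> U" for y
    using linear_eq_sum_Basis[OF linear_D[OF that]] by metis
qed

definition \<Gamma> :: "'e \<Rightarrow> 'e \<Rightarrow> 'e \<Rightarrow> 'e" where "\<Gamma> b d x = tang x (D2 x b d)"

definition II :: "'e \<Rightarrow> 'e \<Rightarrow> 'e \<Rightarrow> 'h" where "II x b d = D2 x b d - D x (\<Gamma> b d x)"

lemma smooth_\<Gamma>: "smooth_on U (\<Gamma> b d)"
  unfolding \<Gamma>_def[abs_def] by (rule smooth_tang[OF smooth_D2])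

lemma smooth_II: "smooth_on U (\<lambda>x. II x b d)"
  unfolding II_def by (intro smooth_on_diff open_U smooth_D2 smooth_D_field smooth_\<Gamma>)

lemma II_normal: "x \<in> U \<Longrightarrow> II x b d \<bullet> D x e = 0"
  by (simp add: II_def \<Gamma>_def inner_diff_left D_tang_inner)

lemma II_sym: "x \<in> U \<Longrightarrow> II x b d = II x d b"
  by (simp add: II_def \<Gamma>_def D2_sym)

text \<open>The coordinates of R(a,b)d for constant coordinate fields: the covariant derivative is
  the tangential part of the ambient one, \<Gamma> is its first application, and the bracket term is
  absent as such fields commute.\<close>

definition curv :: "'e \<Rightarrow> 'e \<Rightarrow> 'e \<Rightarrow> 'e \<Rightarrow> 'e" where
  "curv x a b d = tang x (frechet_derivative (\<lambda>y. D y (\<Gamma> b d y)) (at x) a) -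
     tang x (frechet_derivative (\<lambda>y. D y (\<Gamma> a d y)) (at x) b)"

text \<open>Replacing the image of \<Gamma> by \<open>D2\<close> minus \<open>II\<close> leaves
  third derivatives of \<open>f\<close>, which cancel by symmetry, and derivatives of
  \<open>II\<close>. Tested against \<open>D x e\<close>, the latter turn into products of values of
  \<open>II\<close>, because \<open>II\<close> is normal to the image.\<close>

lemma gauss_equation:
  assumes x: "x \<in> U"
  shows "D x (curv x a b d) \<bullet> D x e = II x b d \<bullet> II x a e - II x a d \<bullet> II x b e"
proof -
  have 1: "frechet_derivative (\<lambda>y. D y (\<Gamma> b d y)) (at x) a \<bullet> D x e =
      frechet_derivative (\<lambda>y. D2 y d b) (at x) a \<bullet> D x e + II x b d \<bullet> II x a e" for a b
  proof -
    let ?I = "frechet_derivative (\<lambda>y. II y b d) (at x)"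
    have dI: "((\<lambda>y. II y b d) has_derivative ?I) (at x)"
      by (rule smooth_on_has_derivative[OF smooth_II x])
    have dD2: "((\<lambda>y. D2 y d b) has_derivative frechet_derivative (\<lambda>y. D2 y d b) (at x)) (at x)"
      by (rule smooth_on_has_derivative[OF smooth_D2 x])
    have "((\<lambda>y. D2 y d b - II y b d) has_derivative (\<lambda>v. frechet_derivative (\<lambda>y. D2 y d b) (at x) v - ?I v)) (at x)"
      by (rule has_derivative_diff[OF dD2 dI])
    then have "((\<lambda>y. D y (\<Gamma> b d y)) has_derivative (\<lambda>v. frechet_derivative (\<lambda>y. D2 y d b) (at x) v - ?I v)) (at x)"
      by (rule has_derivative_transform_within_open[OF _ open_U x]) (simp add: II_def D2_sym)
    then have "frechet_derivative (\<lambda>y. D y (\<Gamma> b d y)) (at x) a =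
       frechet_derivative (\<lambda>y. D2 y d b) (at x) a - ?I a"
      by (simp add: frechet_derivative_eqI)
    moreover have "?I a \<bullet> D x e = - (II x b d \<bullet> II x a e)"
    proof -
      have "((\<lambda>y. II y b d \<bullet> D y e) has_derivative (\<lambda>v. II x b d \<bullet> D2 x e v + ?I v \<bullet> D x e)) (at x)"
        by (rule has_derivative_inner[OF dI has_derivative_D[OF x]])
      then have "II x b d \<bullet> D2 x e a + ?I a \<bullet> D x e = 0"
        by (rule has_derivative_const_on_open[where c=0, OF open_U x]) (simp add: II_normal)
      moreover have "II x b d \<bullet> D2 x e a = II x b d \<bullet> II x a e"
        using II_normal[OF x, of b d "\<Gamma> a e x"] by (simp add: II_def[of x a e] inner_diff_right D2_sym[OF x, of e])
      ultimately show ?thesis by simp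
    qed
    ultimately show ?thesis by (simp add: inner_diff_left)
  qed
  \<comment> \<open>With \<open>d\<close> as the first argument this is the symmetry of second
    derivatives of \<open>\<lambda>y. D y d\<close>.\<close>
  have "frechet_derivative (\<lambda>y. D2 y d b) (at x) a = frechet_derivative (\<lambda>y. D2 y d a) (at x) b"
    using smooth_on_symmetric[OF open_U x smooth_D] by (simp add: D2_def[abs_def])
  then show ?thesis
    by (simp add: curv_def linear_diff[OF linear_D[OF x]] inner_diff_left D_tang_inner[OF x] 1)
qed

end


text \<open>The immersion into the unit sphere is viewed through the cone over its image, whose tangent spaces
  \<open>V x\<close> are assumed to be complex. \<open>Q x\<close> is the projection onto the normal space of the cone, and
  \<open>\<alpha>\<close> the second fundamental form of the cone.\<close>

locale complex_cone = local_immersion U f + complex_structure J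
  for U :: "'e::euclidean_space set" and f :: "'e \<Rightarrow> 'h::euclidean_space" and J :: "'h \<Rightarrow> 'h" +
  assumes unit_f: "\<And>x. x \<in> U \<Longrightarrow> f x \<bullet> f x = 1"
    and J_D: "\<And>x v. x \<in> U \<Longrightarrow> \<exists>w s. J (D x v) = D x w + s *\<^sub>R f x"
    and J_f: "\<And>x. x \<in> U \<Longrightarrow> \<exists>w. J (f x) = D x w"
begin

section \<open>Tangent and normal spaces of the cone\<close>

definition V :: "'e \<Rightarrow> 'h set" where "V x = {D x w + s *\<^sub>R f x | w s. True}"

definition Q :: "'e \<Rightarrow> 'h \<Rightarrow> 'h" where "Q x y = y - D x (tang x y) - (y \<bullet> f x) *\<^sub>R f x"

definition \<alpha> :: "'e \<Rightarrow> 'e \<Rightarrow> 'e \<Rightarrow> 'h" where "\<alpha> x a b = Q x (D2 x a b)"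

lemma f_D: assumes x: "x \<in> U" shows "f x \<bullet> D x a = 0"
proof -
  have "((\<lambda>y. f y \<bullet> f y) has_derivative (\<lambda>v. f x \<bullet> D x v + D x v \<bullet> f x)) (at x)"
    by (intro has_derivative_inner has_derivative_f x)
  then have "f x \<bullet> D x a + D x a \<bullet> f x = 0"
    by (rule has_derivative_const_on_open[where c=1, OF open_U x]) (simp add: unit_f)
  then show ?thesis by (simp add: inner_commute)
qed

lemma D_f: "x \<in> U \<Longrightarrow> D x a \<bullet> f x = 0"
  using f_D by (simp add: inner_commute)

lemma f_D2: assumes x: "x \<in> U" shows "D2 x a b \<bullet> f x = - (D x a \<bullet> D x b)"
proof -
  have "((\<lambda>y. D y a \<bullet> f y) has_derivative (\<lambda>v. D x a \<bullet> D x v + D2 x a v \<bullet> f x)) (at x)"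
    by (intro has_derivative_inner has_derivative_f has_derivative_D x)
  then have "D x a \<bullet> D x b + D2 x a b \<bullet> f x = 0"
    by (rule has_derivative_const_on_open[where c=0, OF open_U x]) (simp add: D_f)
  then show ?thesis by simp
qed

text \<open>Splits off the curvature of the ambient unit sphere: the summand along
  \<open>f x\<close> is its second fundamental form and accounts for the constant in the Ricci
  formula.\<close>

lemma II_eq: "x \<in> U \<Longrightarrow> II x a b = \<alpha> x a b - (D x a \<bullet> D x b) *\<^sub>R f x"
  by (simp add: II_def \<alpha>_def Q_def \<Gamma>_def f_D2)

lemma D_in_V: "x \<in> U \<Longrightarrow> D x w \<in> V x"
  unfolding V_def by (rule CollectI, intro exI[of _ w] exI[of _ 0]) simp

lemma f_in_V: "x \<in> U \<Longrightarrow> f x \<in> V x"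
  unfolding V_def by (rule CollectI, intro exI[of _ 0] exI[of _ 1]) (simp add: linear_0[OF linear_D])

lemma V_eq: "x \<in> U \<Longrightarrow> V x = {a + b | a b. a \<in> range (D x) \<and> b \<in> span {f x}}"
  by (auto simp: V_def span_singleton)

lemma subspace_V: "x \<in> U \<Longrightarrow> subspace (V x)"
  by (simp add: V_eq subspace_sums linear_subspace_image[OF linear_D])

lemma J_V: assumes x: "x \<in> U" and v: "v \<in> V x" shows "J v \<in> V x"
proof -
  obtain w s where v: "v = D x w + s *\<^sub>R f x" using v by (auto simp: V_def)
  have "J (D x w) \<in> V x" using J_D[OF x, of w] by (auto simp: V_def)
  moreover have "J (f x) \<in> V x" using J_f[OF x] D_in_V[OF x] by metis
  ultimately show ?thesis
    unfolding v by (simp add: J_simps subspace_add subspace_scale subspace_V x)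
qed

lemma linear_Q: "x \<in> U \<Longrightarrow> linear (Q x)"
  unfolding Q_def
  by (intro linear_compose_sub linear_compose[OF linear_tang linear_D, unfolded o_def])
    (auto intro!: linearI simp: inner_add_left scaleR_add_left)

lemma tang_f [simp]: "x \<in> U \<Longrightarrow> tang x (f x) = 0"
  by (rule tang_eqI) (simp_all add: f_D linear_0[OF linear_D])

lemma Q_D [simp]: "x \<in> U \<Longrightarrow> Q x (D x w) = 0"
  by (simp add: Q_def D_f)

lemma Q_f [simp]: "x \<in> U \<Longrightarrow> Q x (f x) = 0"
  by (simp add: Q_def unit_f linear_0[OF linear_D])

lemma Q_V: "x \<in> U \<Longrightarrow> v \<in> V x \<Longrightarrow> Q x v = 0"
  by (auto simp: V_def linear_add[OF linear_Q] linear_scale[OF linear_Q])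

lemma diff_Q_in_V: "x \<in> U \<Longrightarrow> y - Q x y \<in> V x"
  unfolding V_def by (rule CollectI, rule exI[of _ "tang x y"], rule exI[of _ "y \<bullet> f x"]) (simp add: Q_def)

lemma Q_normal: "x \<in> U \<Longrightarrow> v \<in> V x \<Longrightarrow> Q x y \<bullet> v = 0"
  by (auto simp: V_def Q_def inner_diff_left inner_add_right D_tang_inner D_f f_D unit_f)

lemma Q_normalI:
  assumes x: "x \<in> U" and y: "\<And>v. v \<in> V x \<Longrightarrow> y \<bullet> v = 0" shows "Q x y = y"
proof -
  have "(y - Q x y) \<bullet> (y - Q x y) = 0"
    using y[OF diff_Q_in_V[OF x]] Q_normal[OF x diff_Q_in_V[OF x]] by (simp add: inner_diff_left)
  then show ?thesis by simp
qed

lemma Q_eq_0_iff: "x \<in> U \<Longrightarrow> Q x y = 0 \<longleftrightarrow> y \<in> V x"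
  using Q_V diff_Q_in_V[of x y] by auto

text \<open>\<open>J\<close> preserves \<open>V x\<close> and, being orthogonal, its complement as
  well; hence it commutes with the projection.\<close>

lemma Q_J: assumes x: "x \<in> U" shows "Q x (J y) = J (Q x y)"
proof -
  have "Q x (J (y - Q x y)) = 0" by (intro Q_V J_V diff_Q_in_V x)
  moreover have "Q x (J (Q x y)) = J (Q x y)"
    by (rule Q_normalI[OF x]) (simp add: inner_J_left Q_normal J_V x)
  ultimately show ?thesis by (simp add: J_simps linear_diff[OF linear_Q[OF x]])
qed

text \<open>Opposite in sign to \<open>phi\<close>, which the convention
  \<open>d\<eta>(X,Y) = 2 g(X, \<phi> Y)\<close> makes the negative of the tangential part of
  \<open>J\<close>.\<close>

definition \<phi> :: "'e \<Rightarrow> 'e \<Rightarrow> 'e" where "\<phi> x v = tang x (J (D x v))"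

lemma J_D_eq: assumes x: "x \<in> U" shows "J (D x v) = D x (\<phi> x v) + (J (D x v) \<bullet> f x) *\<^sub>R f x"
proof -
  have "Q x (J (D x v)) = 0" by (simp add: Q_J x J_simps)
  then show ?thesis by (simp add: Q_def \<phi>_def algebra_simps)
qed

text \<open>When \<open>J_D_eq\<close> is differentiated, the derivatives of
  \<open>\<phi> y a\<close> and of the coefficient of \<open>f\<close> contribute only vectors of
  \<open>V x\<close>, which \<open>Q x\<close> removes. What survives says that \<alpha> is complex
  linear in one argument, hence by symmetry in both.\<close>

lemma \<alpha>_\<phi>: assumes x: "x \<in> U" shows "\<alpha> x (\<phi> x a) b = J (\<alpha> x a b)"
proof -
  let ?c = "\<lambda>y. J (D y a) \<bullet> f y"
  have smooth_JD: "smooth_on U (\<lambda>y. J (D y a))"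
    by (rule smooth_on_bounded_linear[OF bounded_linear_J open_U smooth_D])
  have smooth_c: "smooth_on U ?c" by (intro smooth_on_inner open_U smooth_JD smooth_f)
  have smooth_phi: "smooth_on U (\<lambda>y. \<phi> y a)" unfolding \<phi>_def by (rule smooth_tang[OF smooth_JD])
  let ?p = "frechet_derivative (\<lambda>y. \<phi> y a) (at x)"
  let ?c' = "frechet_derivative ?c (at x)"
  have "((\<lambda>y. D y (\<phi> y a) + ?c y *\<^sub>R f y) has_derivative
      (\<lambda>v. (D2 x (\<phi> x a) v + D x (?p v)) + (?c x *\<^sub>R D x v + ?c' v *\<^sub>R f x))) (at x)"
    by (intro has_derivative_add has_derivative_D_field has_derivative_scaleR has_derivative_f x
        smooth_on_has_derivative[OF smooth_phi] smooth_on_has_derivative[OF smooth_c])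
  then have "((\<lambda>y. J (D y a)) has_derivative
      (\<lambda>v. (D2 x (\<phi> x a) v + D x (?p v)) + (?c x *\<^sub>R D x v + ?c' v *\<^sub>R f x))) (at x)"
    by (rule has_derivative_transform_within_open[OF _ open_U x]) (simp only: J_D_eq[symmetric])
  moreover have "((\<lambda>y. J (D y a)) has_derivative (\<lambda>v. J (D2 x a v))) (at x)"
    by (rule bounded_linear.has_derivative[OF bounded_linear_J has_derivative_D[OF x]])
  ultimately have "(\<lambda>v. J (D2 x a v)) = (\<lambda>v. (D2 x (\<phi> x a) v + D x (?p v)) + (?c x *\<^sub>R D x v + ?c' v *\<^sub>R f x))"
    using has_derivative_unique by blast
  then have "J (D2 x a b) = (D2 x (\<phi> x a) b + D x (?p b)) + (?c x *\<^sub>R D x b + ?c' b *\<^sub>R f x)" by (rule fun_cong)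
  then have "Q x (J (D2 x a b)) = Q x (D2 x (\<phi> x a) b)"
    by (simp add: linear_add[OF linear_Q] linear_scale[OF linear_Q] x)
  then show ?thesis by (simp add: Q_J x \<alpha>_def)
qed

lemma \<alpha>_sym: "x \<in> U \<Longrightarrow> \<alpha> x a b = \<alpha> x b a"
  by (simp add: \<alpha>_def D2_sym)

lemma linear_\<alpha>: "x \<in> U \<Longrightarrow> linear (\<lambda>a. \<alpha> x a b)"
  unfolding \<alpha>_def using linear_compose[OF linear_D2' linear_Q] by (simp add: o_def)

text \<open>Two applications of complex linearity give \<open>J\<close> twice. Each complex pair of
  frame vectors therefore drops out of the trace of \<alpha>.\<close>

lemma \<alpha>_\<phi>_\<phi>: "x \<in> U \<Longrightarrow> \<alpha> x (\<phi> x a) (\<phi> x a) = - \<alpha> x a a"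
  by (metis J_J \<alpha>_\<phi> \<alpha>_sym)

text \<open>\<open>J\<close> sends \<open>J (f x)\<close> to \<open>- f x\<close>, which has no
  tangential part; so \<open>\<phi> x e = 0\<close>, and complex linearity gives the rest.\<close>

lemma \<alpha>_reeb: assumes x: "x \<in> U" and e: "D x e = J (f x)" shows "\<alpha> x e b = 0"
proof -
  have "\<phi> x e = 0" using x e linear_neg[OF linear_tang[OF x], of "f x"] by (simp add: \<phi>_def)
  then have "J (\<alpha> x e b) = \<alpha> x 0 b" using \<alpha>_\<phi>[OF x, of e b] by simp
  then show ?thesis using linear_0[OF linear_\<alpha>[OF x]] by simp
qed

lemma \<alpha>_normal: "x \<in> U \<Longrightarrow> \<alpha> x a b \<bullet> f x = 0" "x \<in> U \<Longrightarrow> f x \<bullet> \<alpha> x a b = 0"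
  using Q_normal[OF _ f_in_V] by (simp_all add: \<alpha>_def inner_commute)

definition ric :: "'e \<Rightarrow> 'e \<Rightarrow> real" where "ric x d = (\<Sum>b\<in>Basis. curv x b d d \<bullet> b)"

text \<open>\<open>curv\<close> is defined by derivatives of \<Gamma>, but the right-hand side of
  the Gauss equation is visibly linear in \<open>b\<close>. This is needed to take the trace in a
  frame other than \<open>Basis\<close>.\<close>

lemma linear_curv:
  assumes x: "x \<in> U" shows "linear (\<lambda>b. curv x b d d)"
proof -
  have la: "linear (\<lambda>b. II x b e)" for e
    unfolding II_def \<Gamma>_def
    by (intro linear_compose_sub linear_D2' linear_compose[OF linear_compose[OF linear_D2' linear_tang] linear_D, unfolded o_def] x)
  show ?thesis
  proof (rule linearI; rule D_inner_eqI[OF x])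
    show "D x (curv x (a + b) d d) \<bullet> D x e = D x (curv x a d d + curv x b d d) \<bullet> D x e" for a b e
      using linear_add[OF la] by (simp add: linear_add[OF linear_D[OF x]] gauss_equation[OF x] inner_add_left inner_add_right)
    show "D x (curv x (r *\<^sub>R b) d d) \<bullet> D x e = D x (r *\<^sub>R curv x b d d) \<bullet> D x e" for r b e
      using linear_scale[OF la] by (simp add: linear_scale[OF linear_D[OF x]] gauss_equation[OF x] algebra_simps)
  qed
qed

text \<open>The Gauss equation traced over a unitary frame; the cone is minimal as \<open>\<alpha>\<close> is complex bilinear.\<close>

lemma ric_eq:
  assumes x: "x \<in> U" and DIM: "DIM('e) = 2 * n + 1"
  shows "\<exists>e e'. (\<forall>d. ric x d = real (2 * n) * (D x d \<bullet> D x d) - (\<Sum>i<n. (norm (\<alpha> x (e i) d))\<^sup>2 + (norm (\<alpha> x (e' i) d))\<^sup>2)) \<and>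
      (\<forall>a d. (\<forall>i<n. \<alpha> x (e i) d = 0 \<and> \<alpha> x (e' i) d = 0) \<longrightarrow> \<alpha> x a d = 0)"
    and "dim (V x) = 2 * n + 2"
proof -
  define t where "t = J (f x)"
  \<comment> \<open>The Hermitian complement of \<open>f x\<close> in the tangent space of the cone,
    that is, the contact distribution. A unitary basis of it together with the Reeb direction
    \<open>t\<close> is an orthonormal frame of the image.\<close>
  define W where "W = {v \<in> V x. v \<bullet> f x = 0 \<and> v \<bullet> t = 0}"
  have sW: "subspace W" using subspace_V[OF x] by (auto simp: W_def subspace_def inner_add_left)
  have JW: "J v \<in> W" if "v \<in> W" for v
    using that J_V[OF x] by (auto simp: W_def t_def inner_J_left)
  obtain m u where u: "unitary_basis W m u" using unitary_basis_exists[OF sW JW] by blast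
  have uW: "u i \<in> W" "J (u i) \<in> W" if "i < m" for i using u JW that by (auto simp: unitary_basis_def)
  have W_D: "\<exists>w. v = D x w" if "v \<in> W" for v
  proof -
    obtain w s where v: "v = D x w + s *\<^sub>R f x" using \<open>v \<in> W\<close> by (auto simp: V_def W_def)
    then have "s = 0" using \<open>v \<in> W\<close> by (simp add: W_def inner_add_left D_f x unit_f)
    then show ?thesis using v by auto
  qed
  define e0 where "e0 = tang x t"
  define e where "e i = tang x (u i)" for i
  define e' where "e' i = \<phi> x (e i)" for i
  have De0: "D x e0 = t" using J_f[OF x] x by (auto simp: e0_def t_def)
  have De: "D x (e i) = u i" if "i < m" for i using W_D[OF uW(1)[OF that]] x by (auto simp: e_def)
  have De': "D x (e' i) = J (u i)" if "i < m" for i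
    using W_D[OF uW(2)[OF that]] x De[OF that] by (auto simp: e'_def \<phi>_def)
  have frame_V: "v = (v \<bullet> f x) *\<^sub>R f x + ((v \<bullet> t) *\<^sub>R t + (\<Sum>i<m. (v \<bullet> u i) *\<^sub>R u i + (v \<bullet> J (u i)) *\<^sub>R J (u i)))"
    if v: "v \<in> V x" for v
  proof -
    define z where "z = v - (v \<bullet> f x) *\<^sub>R f x - (v \<bullet> t) *\<^sub>R t"
    have tt: "t \<bullet> t = 1" "t \<bullet> f x = 0" "f x \<bullet> t = 0" by (simp_all add: t_def unit_f x)
    have "t \<in> V x" by (simp add: t_def J_V f_in_V x)
    then have "z \<in> W" using v f_in_V[OF x] subspace_V[OF x] tt unit_f[OF x]
      by (auto simp: W_def z_def inner_diff_left intro!: subspace_diff subspace_scale)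
    then have "z = (\<Sum>i<m. (z \<bullet> u i) *\<^sub>R u i + (z \<bullet> J (u i)) *\<^sub>R J (u i))"
      using u by (auto simp: unitary_basis_def)
    also have "\<dots> = (\<Sum>i<m. (v \<bullet> u i) *\<^sub>R u i + (v \<bullet> J (u i)) *\<^sub>R J (u i))"
      using uW by (intro sum.cong refl) (auto simp: W_def z_def inner_diff_left inner_commute[of "f x"] inner_commute[of t])
    finally show ?thesis by (simp add: z_def algebra_simps)
  qed
  have frame: "a = (D x a \<bullet> t) *\<^sub>R e0 + (\<Sum>i<m. (D x a \<bullet> u i) *\<^sub>R e i + (D x a \<bullet> J (u i)) *\<^sub>R e' i)" for a
  proof -
    have "D x a = D x ((D x a \<bullet> t) *\<^sub>R e0 + (\<Sum>i<m. (D x a \<bullet> u i) *\<^sub>R e i + (D x a \<bullet> J (u i)) *\<^sub>R e' i))"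
      using frame_V[OF D_in_V[OF x], of a] linear_D[OF x]
      by (simp add: D_f x linear_add linear_scale linear_sum De0 De De')
    then show ?thesis using D_inject[OF x] by blast
  qed
  \<comment> \<open>\<open>Basis\<close> is orthonormal for the coordinates and not for the induced
    metric; the trace is moved to the frame \<open>e0\<close>, \<open>e i\<close>,
    \<open>e' i\<close>, whose images under \<open>D x\<close> are orthonormal.\<close>
  have trace: "(\<Sum>b\<in>Basis. L b \<bullet> b) = D x (L e0) \<bullet> t + (\<Sum>i<m. D x (L (e i)) \<bullet> u i + D x (L (e' i)) \<bullet> J (u i))"
    if L: "linear L" for L :: "'e \<Rightarrow> 'e"
  proof -
    have DL: "D x y \<bullet> z = (\<Sum>b\<in>Basis. (D x b \<bullet> z) * (y \<bullet> b))" for y z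
      using arg_cong[OF linear_eq_sum_Basis[OF linear_D[OF x], of y], of "\<lambda>v. v \<bullet> z"]
      by (simp add: inner_sum_left mult.commute)
    have "L b \<bullet> b = (D x b \<bullet> t) * (L e0 \<bullet> b) + (\<Sum>i<m. (D x b \<bullet> u i) * (L (e i) \<bullet> b) + (D x b \<bullet> J (u i)) * (L (e' i) \<bullet> b))" for b
      using arg_cong[OF frame[of b], of "\<lambda>v. L v \<bullet> b"] L
      by (simp add: linear_add linear_scale linear_sum inner_add_left inner_sum_left)
    then have "(\<Sum>b\<in>Basis. L b \<bullet> b) = (\<Sum>b\<in>Basis. (D x b \<bullet> t) * (L e0 \<bullet> b))
       + (\<Sum>i<m. (\<Sum>b\<in>Basis. (D x b \<bullet> u i) * (L (e i) \<bullet> b)) + (\<Sum>b\<in>Basis. (D x b \<bullet> J (u i)) * (L (e' i) \<bullet> b)))"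
      by (simp add: sum.distrib sum.swap[of _ Basis])
    then show ?thesis unfolding DL[symmetric] .
  qed
  have norm_D: "D x d \<bullet> D x d = (D x d \<bullet> t)\<^sup>2 + (\<Sum>i<m. (D x d \<bullet> u i)\<^sup>2 + (D x d \<bullet> J (u i))\<^sup>2)" for d
    using arg_cong[OF frame_V[OF D_in_V[OF x], of d], of "\<lambda>v. D x d \<bullet> v"]
    by (simp add: D_f x inner_add_right inner_sum_right power2_eq_square)
  have dimW: "dim W = 2 * m" by (rule unitary_basis_dim[OF sW JW u])
  have VJ: "f x \<in> V x" "t \<in> V x" by (simp_all add: t_def f_in_V J_V x)
  have dimV: "dim (V x) = DIM('e) + 1"
  proof -
    have "V x = span (insert (f x) (range (D x)))"
      using linear_subspace_image[OF linear_D[OF x] subspace_UNIV]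
      by (simp add: V_eq[OF x] span_insert span_eq_iff[THEN iffD2] span_singleton set_eq_iff)
         (metis (no_types, opaque_lifting) add.commute add_diff_cancel diff_add_cancel)
    moreover have "f x \<notin> span (range (D x))"
    proof
      assume "f x \<in> span (range (D x))"
      then have "f x \<in> range (D x)"
        using linear_subspace_image[OF linear_D[OF x] subspace_UNIV] by (simp add: span_eq_iff[THEN iffD2])
      then have "f x \<bullet> f x = 0" using f_D[OF x] by (metis imageE)
      then show False using unit_f[OF x] by simp
    qed
    ultimately have "dim (V x) = dim (range (D x)) + 1" by (simp add: dim_insert)
    also have "dim (range (D x)) = DIM('e)"
      using dim_image_eq[OF linear_D[OF x], of UNIV] D_inject[OF x] by (simp add: inj_on_def dim_UNIV)
    finally show ?thesis .
  qed
  \<comment> \<open>Adding \<open>f x\<close> to \<open>u\<close> gives a unitary basis of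
    \<open>V x\<close>, so that 2m + 2 = (2n + 1) + 1.\<close>
  have "n = m"
  proof -
    define u' where "u' = case_nat (f x) u"
    have "unitary_basis (V x) (Suc m) u'"
      unfolding unitary_basis_def
    proof (intro conjI ballI allI impI)
      have W: "u i \<bullet> f x = 0" "u i \<bullet> t = 0" "f x \<bullet> u i = 0" "f x \<bullet> J (u i) = 0" "u i \<in> V x" if "i < m" for i
        using uW[OF that] by (auto simp: W_def inner_commute)
      fix i assume "i < Suc m"
      then show "u' i \<in> V x" using VJ W by (auto simp: u'_def split: nat.split)
      fix j assume "j < Suc m"
      then show "u' i \<bullet> u' j = (if i = j then 1 else 0)" "u' i \<bullet> J (u' j) = 0"
        using \<open>i < Suc m\<close> W u unit_f[OF x] by (auto simp: u'_def unitary_basis_def t_def split: nat.split)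
    next
      fix v assume "v \<in> V x"
      then show "v = (\<Sum>i<Suc m. (v \<bullet> u' i) *\<^sub>R u' i + (v \<bullet> J (u' i)) *\<^sub>R J (u' i))"
        using frame_V[of v] by (simp del: sum.lessThan_Suc add: sum.lessThan_Suc_shift u'_def t_def add.assoc)
    qed
    then have "dim (V x) = 2 * Suc m" using unitary_basis_dim[OF subspace_V[OF x] J_V[OF x]] by blast
    then show ?thesis using dimV DIM by simp
  qed
  have unit: "u i \<bullet> u i = 1" if "i < m" for i using u that by (auto simp: unitary_basis_def)
  have t1: "t \<bullet> t = 1" by (simp add: t_def unit_f x)
  have II_e0: "II x e0 d = - (t \<bullet> D x d) *\<^sub>R f x" for d
    using \<alpha>_reeb[OF x, of e0 d] De0 by (simp add: II_eq x t_def)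
  have ric: "ric x d = real (2 * n) * (D x d \<bullet> D x d) - (\<Sum>i<n. (norm (\<alpha> x (e i) d))\<^sup>2 + (norm (\<alpha> x (e' i) d))\<^sup>2)" for d
  proof -
    let ?N = "D x d \<bullet> D x d"
    have G: "D x (curv x b d d) \<bullet> D x c = II x d d \<bullet> II x b c - II x b d \<bullet> II x d c" for b c
      by (rule gauss_equation[OF x])
    have IIdd: "II x d d \<bullet> f x = - ?N" by (simp add: II_eq x inner_diff_left \<alpha>_normal unit_f)
    \<comment> \<open>The Reeb direction contributes only a term of the sphere: \<alpha> vanishes on
      \<open>e0\<close>.\<close>
    have 0: "D x (curv x e0 d d) \<bullet> t = ?N - (D x d \<bullet> t)\<^sup>2"
      using G[of e0 e0] II_sym[OF x, of d e0] IIdd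
      by (simp add: De0 II_e0 t1 unit_f x power2_eq_square inner_commute)
    have sq: "II x a d \<bullet> II x a d = (norm (\<alpha> x a d))\<^sup>2 + (D x d \<bullet> D x a)\<^sup>2" for a
      by (simp add: II_eq x inner_diff_left inner_diff_right \<alpha>_normal unit_f dot_square_norm[of "\<alpha> x a d"]
          power2_eq_square[of "D x a \<bullet> D x d"] inner_commute)
    have tr: "II x d d \<bullet> II x a a = II x d d \<bullet> \<alpha> x a a + ?N * (D x a \<bullet> D x a)" for a
      by (simp add: II_eq[OF x, of a a] inner_diff_right IIdd)
    \<comment> \<open>The values of \<alpha> on the two diagonal pairs cancel, which leaves two
      sectional contributions of the sphere and the negative squares of \<alpha>.\<close>
    have 1: "D x (curv x (e i) d d) \<bullet> u i + D x (curv x (e' i) d d) \<bullet> J (u i)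
        = 2 * ?N - ((norm (\<alpha> x (e i) d))\<^sup>2 + (norm (\<alpha> x (e' i) d))\<^sup>2) - ((D x d \<bullet> u i)\<^sup>2 + (D x d \<bullet> J (u i))\<^sup>2)"
      if i: "i < m" for i
    proof -
      have "\<alpha> x (e' i) (e' i) = - \<alpha> x (e i) (e i)" by (simp add: e'_def \<alpha>_\<phi>_\<phi> x)
      then show ?thesis
        using G[of "e i" "e i"] G[of "e' i" "e' i"] sq[of "e i"] sq[of "e' i"] tr[of "e i"] tr[of "e' i"]
          II_sym[OF x, of d "e i"] II_sym[OF x, of d "e' i"] De[OF i] De'[OF i] unit[OF i]
        by simp
    qed
    have "ric x d = ?N - (D x d \<bullet> t)\<^sup>2 + (\<Sum>i<m. 2 * ?N - ((norm (\<alpha> x (e i) d))\<^sup>2 + (norm (\<alpha> x (e' i) d))\<^sup>2) - ((D x d \<bullet> u i)\<^sup>2 + (D x d \<bullet> J (u i))\<^sup>2))"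
      unfolding ric_def trace[OF linear_curv[OF x]] 0 using 1 by simp
    also have "\<dots> = ?N - (D x d \<bullet> t)\<^sup>2 + (2 * m * ?N - (\<Sum>i<m. (norm (\<alpha> x (e i) d))\<^sup>2 + (norm (\<alpha> x (e' i) d))\<^sup>2)
        - (\<Sum>i<m. (D x d \<bullet> u i)\<^sup>2 + (D x d \<bullet> J (u i))\<^sup>2))"
      by (simp only: sum_subtractf) simp
    \<comment> \<open>By \<open>norm_D\<close> the squared components of \<open>D x d\<close> add up
      to \<open>?N\<close>, and the coefficient becomes (2n + 1) - 1.\<close>
    also have "\<dots> = 2 * n * ?N - (\<Sum>i<n. (norm (\<alpha> x (e i) d))\<^sup>2 + (norm (\<alpha> x (e' i) d))\<^sup>2)"
      using norm_D[of d] \<open>n = m\<close> by simp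
    finally show ?thesis .
  qed
  have "\<alpha> x a d = 0" if "\<forall>i<n. \<alpha> x (e i) d = 0 \<and> \<alpha> x (e' i) d = 0" for a d
  proof -
    have "\<alpha> x e0 d = 0" by (rule \<alpha>_reeb[OF x]) (simp add: De0 t_def)
    moreover have "\<alpha> x a d = (D x a \<bullet> t) *\<^sub>R \<alpha> x e0 d + (\<Sum>i<m. (D x a \<bullet> u i) *\<^sub>R \<alpha> x (e i) d + (D x a \<bullet> J (u i)) *\<^sub>R \<alpha> x (e' i) d)"
      using arg_cong[OF frame[of a], of "\<lambda>v. \<alpha> x v d"] linear_\<alpha>[OF x]
      by (simp add: linear_add[where f="\<lambda>a. \<alpha> x a d"] linear_scale[where f="\<lambda>a. \<alpha> x a d"] linear_sum[where f="\<lambda>a. \<alpha> x a d"])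
    ultimately show ?thesis using that \<open>n = m\<close> by simp
  qed
  with ric show "\<exists>e e'. (\<forall>d. ric x d = real (2 * n) * (D x d \<bullet> D x d) - (\<Sum>i<n. (norm (\<alpha> x (e i) d))\<^sup>2 + (norm (\<alpha> x (e' i) d))\<^sup>2)) \<and>
      (\<forall>a d. (\<forall>i<n. \<alpha> x (e i) d = 0 \<and> \<alpha> x (e' i) d = 0) \<longrightarrow> \<alpha> x a d = 0)"
    by blast
  show "dim (V x) = 2 * n + 2" using dimV DIM by simp
qed

theorem einstein_imp_totally_geodesic:
  assumes x: "x \<in> U" and DIM: "DIM('e) = 2 * n + 1"
    and ein: "\<And>d. ric x d = l * (D x d \<bullet> D x d)"
  shows "\<alpha> x a d = 0"
proof -
  obtain e e' where ric: "\<And>d. ric x d = real (2 * n) * (D x d \<bullet> D x d) - (\<Sum>i<n. (norm (\<alpha> x (e i) d))\<^sup>2 + (norm (\<alpha> x (e' i) d))\<^sup>2)"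
    and e: "\<And>a d. \<forall>i<n. \<alpha> x (e i) d = 0 \<and> \<alpha> x (e' i) d = 0 \<Longrightarrow> \<alpha> x a d = 0"
    using ric_eq(1)[OF x DIM] by blast
  obtain \<xi> where \<xi>: "D x \<xi> = J (f x)" using J_f[OF x] by metis
  have "\<alpha> x a \<xi> = 0" for a using \<alpha>_reeb[OF x \<xi>, of a] \<alpha>_sym[OF x] by simp
  then have "l = 2 * n" using ric[of \<xi>] ein[of \<xi>] \<xi> unit_f[OF x] by simp
  then have "(\<Sum>i<n. (norm (\<alpha> x (e i) d))\<^sup>2 + (norm (\<alpha> x (e' i) d))\<^sup>2) = 0"
    using ric[of d] ein[of d] by simp
  then have "\<forall>i\<in>{..<n}. (norm (\<alpha> x (e i) d))\<^sup>2 + (norm (\<alpha> x (e' i) d))\<^sup>2 = 0"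
    by (subst (asm) sum_nonneg_eq_0_iff) auto
  then show ?thesis by (intro e) (auto simp: sum_power2_eq_zero_iff)
qed

text \<open>With \<alpha> = 0, the derivative of \<open>Q z y\<close> in \<open>z\<close> lies in
  \<open>V x\<close>; by differentiating the relations that make \<open>Q z y\<close> normal it is
  also orthogonal to \<open>V x\<close>. So it vanishes, and \<open>V\<close>, the kernel of
  \<open>Q\<close>, is constant on the connected set \<open>U\<close>.\<close>

lemma V_constant:
  assumes flat: "\<And>x a b. x \<in> U \<Longrightarrow> \<alpha> x a b = 0" and U: "connected U" and x: "x \<in> U" "x' \<in> U"
  shows "V x = V x'"
proof -
  have Qd: "Q x (D2 x a b) = 0" if "x \<in> U" for x a b using flat[OF that] by (simp add: \<alpha>_def)
  have "Q x' y = Q x y" for y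
  proof -
    have "((\<lambda>z. Q z y) has_derivative (\<lambda>v. 0)) (at x)" if x: "x \<in> U" for x
    proof -
      have st: "smooth_on U (\<lambda>z. tang z y)" by (rule smooth_tang[OF smooth_on_const])
      let ?w = "frechet_derivative (\<lambda>z. tang z y) (at x)"
      let ?Q' = "\<lambda>v. 0 - (D2 x (tang x y) v + D x (?w v)) - ((y \<bullet> f x) *\<^sub>R D x v + (y \<bullet> D x v) *\<^sub>R f x)"
      have d: "((\<lambda>z. Q z y) has_derivative ?Q') (at x)"
        unfolding Q_def
        by (intro has_derivative_diff has_derivative_const has_derivative_D_field has_derivative_scaleR
            has_derivative_inner_right has_derivative_f x smooth_on_has_derivative[OF st])
      have inV: "?Q' v \<in> V x" for v
        using x Qd[OF x] by (simp add: Q_eq_0_iff[symmetric] linear_diff[OF linear_Q] linear_add[OF linear_Q]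
            linear_scale[OF linear_Q] linear_neg[OF linear_Q] linear_0[OF linear_Q])
      have 1: "?Q' v \<bullet> D x b = 0" for v b
      proof -
        have "((\<lambda>z. Q z y \<bullet> D z b) has_derivative (\<lambda>v. Q x y \<bullet> D2 x b v + ?Q' v \<bullet> D x b)) (at x)"
          by (rule has_derivative_inner[OF d has_derivative_D[OF x]])
        then have "Q x y \<bullet> D2 x b v + ?Q' v \<bullet> D x b = 0"
          by (rule has_derivative_const_on_open[where c=0, OF open_U x]) (simp add: Q_normal D_in_V)
        then show ?thesis using Q_normal[OF x, of "D2 x b v" y] Qd[OF x, of b v] x by (simp add: Q_eq_0_iff)
      qed
      have 2: "?Q' v \<bullet> f x = 0" for v
      proof -
        have "((\<lambda>z. Q z y \<bullet> f z) has_derivative (\<lambda>v. Q x y \<bullet> D x v + ?Q' v \<bullet> f x)) (at x)"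
          by (rule has_derivative_inner[OF d has_derivative_f[OF x]])
        then have "Q x y \<bullet> D x v + ?Q' v \<bullet> f x = 0"
          by (rule has_derivative_const_on_open[where c=0, OF open_U x]) (simp add: Q_normal f_in_V)
        then show ?thesis using Q_normal[OF x D_in_V[OF x], of y v] by simp
      qed
      have "?Q' v = 0" for v
      proof -
        obtain w s where "?Q' v = D x w + s *\<^sub>R f x" using inV[of v] by (auto simp: V_def)
        then have "?Q' v \<bullet> ?Q' v = ?Q' v \<bullet> D x w + s * (?Q' v \<bullet> f x)" by (metis inner_add_right inner_scaleR_right)
        then have "?Q' v \<bullet> ?Q' v = 0" unfolding 1 2 by simp
        then show ?thesis by (simp only: inner_eq_zero_iff)
      qed
      then have "?Q' = (\<lambda>v. 0)" by (rule ext)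
      with d show ?thesis by (simp only:)
    qed
    then show ?thesis
      using has_derivative_zero_unique_connected[OF open_U U _ x, of "\<lambda>z. Q z y"] by simp
  qed
  then show ?thesis using Q_eq_0_iff[OF x(1)] Q_eq_0_iff[OF x(2)] by (simp add: set_eq_iff)
qed

end

section \<open>Charts, tangent vectors and isometric immersions\<close>

locale smooth_mfd =
  fixes M :: "('a, 'e::euclidean_space, 'z) manifold_scheme"
  assumes smooth_manifold: "smooth_manifold M"
begin

lemma atlasD:
  assumes "c \<in> atlas M"
  shows "openin (mtop M) (fst c)" "open (snd c ` fst c)"
    "homeomorphic_map (subtopology (mtop M) (fst c)) (top_of_set (snd c ` fst c)) (snd c)"
    "fst c \<subseteq> points M"
  using assms smooth_manifold unfolding smooth_manifold_def by (auto dest: openin_subset)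

lemma inj_chart: "c \<in> atlas M \<Longrightarrow> inj_on (snd c) (fst c)"
  using homeomorphic_imp_injective_map[OF atlasD(3)[of c]] Int_absorb1[OF atlasD(4)[of c]] by simp

lemma chart_inv_chart [simp]: "c \<in> atlas M \<Longrightarrow> q \<in> fst c \<Longrightarrow> chart_inv c (snd c q) = q"
  by (simp add: chart_inv_def inj_chart)

lemma chart_chart_inv: "x \<in> snd c ` fst c \<Longrightarrow> snd c (chart_inv c x) = x"
  "x \<in> snd c ` fst c \<Longrightarrow> chart_inv c x \<in> fst c"
  by (auto simp: chart_inv_def f_inv_into_f inv_into_into)

lemma open_chart_image:
  assumes c: "c \<in> atlas M" and W: "openin (mtop M) W"
  shows "open (snd c ` (fst c \<inter> W))"
proof -
  have "openin (subtopology (mtop M) (fst c)) (fst c \<inter> W)"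
    using W by (auto simp: openin_subtopology_Int2)
  then have "openin (top_of_set (snd c ` fst c)) (snd c ` (fst c \<inter> W))"
    using homeomorphic_imp_open_map[OF atlasD(3)[OF c]] by (auto simp: open_map_def)
  then show ?thesis using atlasD(2)[OF c] openin_open_eq by blast
qed

lemma open_chart_image': "c \<in> atlas M \<Longrightarrow> openin (mtop M) W \<Longrightarrow> W \<subseteq> fst c \<Longrightarrow> open (snd c ` W)"
  using open_chart_image[of c W] by (simp add: inf_absorb2)

lemma openin_chart_preimage:
  assumes c: "c \<in> atlas M" and B: "open B" "B \<subseteq> snd c ` fst c"
  shows "openin (mtop M) (chart_inv c ` B)"
proof -
  have "openin (subtopology (mtop M) (fst c)) {q \<in> topspace (subtopology (mtop M) (fst c)). snd c q \<in> B}"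
    using homeomorphic_imp_continuous_map[OF atlasD(3)[OF c]] B
    by (intro openin_continuous_map_preimage) (auto simp: openin_open_eq[OF atlasD(2)[OF c]])
  moreover have "{q \<in> topspace (subtopology (mtop M) (fst c)). snd c q \<in> B} = chart_inv c ` B"
  proof -
    have "chart_inv c y \<in> fst c \<and> snd c (chart_inv c y) = y" if "y \<in> B" for y
      using chart_chart_inv[of y c] subsetD[OF B(2) that] by simp
    moreover have "q \<in> chart_inv c ` B" if "q \<in> fst c" "snd c q \<in> B" for q
      using that c by (intro image_eqI[of _ _ "snd c q"]) simp_all
    ultimately show ?thesis using Int_absorb1[OF atlasD(4)[OF c]] by auto
  qed
  ultimately show ?thesis
    using openin_trans_full[OF _ atlasD(1)[OF c]] by simp
qed

lemma smooth_transition: "c \<in> atlas M \<Longrightarrow> c' \<in> atlas M \<Longrightarrow> smooth_on (snd c ` (fst c \<inter> fst c')) (snd c' \<circ> chart_inv c)"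
  using smooth_manifold unfolding smooth_manifold_def by blast

lemma charts_at_D: "c \<in> charts_at M p \<Longrightarrow> c \<in> atlas M" "c \<in> charts_at M p \<Longrightarrow> p \<in> fst c"
  "c \<in> charts_at M p \<Longrightarrow> p \<in> points M"
  using atlasD(4) unfolding charts_at_def by blast+

lemma charts_atI: "c \<in> atlas M \<Longrightarrow> p \<in> fst c \<Longrightarrow> c \<in> charts_at M p"
  by (simp add: charts_at_def)

lemma chart_at: assumes "p \<in> points M" shows "chart_at M p \<in> charts_at M p"
proof -
  have "\<Union> (fst ` atlas M) = points M" using smooth_manifold unfolding smooth_manifold_def by blast
  then have "\<exists>c. c \<in> charts_at M p" using assms unfolding charts_at_def by blast
  then show ?thesis unfolding chart_at_def by (rule someI_ex)
qed

section \<open>Transition maps and tangent vectors\<close>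

definition trans :: "('a, 'e) chart \<Rightarrow> ('a, 'e) chart \<Rightarrow> 'a \<Rightarrow> 'e \<Rightarrow> 'e" where
  "trans c c' p = frechet_derivative (snd c' \<circ> chart_inv c) (at (snd c p))"

lemma has_derivative_transition:
  assumes "c \<in> charts_at M p" "c' \<in> charts_at M p"
  shows "((snd c' \<circ> chart_inv c) has_derivative trans c c' p) (at (snd c p))"
  unfolding trans_def
  using assms by (intro smooth_on_has_derivative[OF smooth_transition[of c c']]) (auto simp: charts_at_def)

lemma linear_trans: "c \<in> charts_at M p \<Longrightarrow> c' \<in> charts_at M p \<Longrightarrow> linear (trans c c' p)"
  by (rule has_derivative_linear[OF has_derivative_transition])

lemma chart_change:
  assumes c: "c \<in> charts_at M p" "c' \<in> charts_at M p"
    and h: "((h \<circ> chart_inv c') has_derivative L) (at (snd c' p))"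
  shows "((h \<circ> chart_inv c) has_derivative (\<lambda>v. L (trans c c' p v))) (at (snd c p))"
proof -
  note [simp] = charts_at_D(1,2)[OF c(1)] charts_at_D(1,2)[OF c(2)]
  let ?U = "snd c ` (fst c \<inter> fst c')"
  have "((\<lambda>x. (h \<circ> chart_inv c') ((snd c' \<circ> chart_inv c) x)) has_derivative (\<lambda>v. L (trans c c' p v))) (at (snd c p))"
    by (rule has_derivative_compose[OF has_derivative_transition[OF c]]) (use h in \<open>simp add: o_def\<close>)
  then show ?thesis
  proof (rule has_derivative_transform_within_open)
    show "open ?U" by (intro open_chart_image atlasD(1)) simp_all
    show "snd c p \<in> ?U" by simp
    show "(h \<circ> chart_inv c') ((snd c' \<circ> chart_inv c) x) = (h \<circ> chart_inv c) x" if "x \<in> ?U" for x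
      using that by auto
  qed
qed

lemma trans_self: assumes c: "c \<in> charts_at M p" shows "trans c c p v = v"
proof -
  note [simp] = charts_at_D(1,2)[OF c]
  have "((\<lambda>x. x) has_derivative (\<lambda>v. v)) (at (snd c p))" by simp
  then have "((snd c \<circ> chart_inv c) has_derivative (\<lambda>v. v)) (at (snd c p))"
    by (rule has_derivative_transform_within_open[OF _ atlasD(2)[OF charts_at_D(1)[OF c]]]) auto
  then show ?thesis by (simp add: trans_def frechet_derivative_eqI)
qed

lemma trans_trans:
  assumes "c \<in> charts_at M p" "c' \<in> charts_at M p" "c'' \<in> charts_at M p"
  shows "trans c' c'' p (trans c c' p v) = trans c c'' p v"
  using chart_change[OF assms(1,2) has_derivative_transition[OF assms(2,3)]]
  by (simp add: trans_def frechet_derivative_eqI)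

lemma tangent_space_iff:
  "v \<in> tangent_space M p \<longleftrightarrow> (\<forall>c. c \<notin> charts_at M p \<longrightarrow> v c = 0) \<and>
     (\<forall>c\<in>charts_at M p. \<forall>c'\<in>charts_at M p. v c' = trans c c' p (v c))"
  by (auto simp: tangent_space_def trans_def)

lemma tangent_trans: "v \<in> tangent_space M p \<Longrightarrow> c \<in> charts_at M p \<Longrightarrow> c' \<in> charts_at M p \<Longrightarrow> v c' = trans c c' p (v c)"
  unfolding tangent_space_iff by blast

lemma tangent_zero: "v \<in> tangent_space M p \<Longrightarrow> c \<notin> charts_at M p \<Longrightarrow> v c = 0"
  unfolding tangent_space_iff by blast

lemma tangent_spaceI:
  assumes "\<And>c. c \<notin> charts_at M p \<Longrightarrow> v c = 0"
    "\<And>c c'. c \<in> charts_at M p \<Longrightarrow> c' \<in> charts_at M p \<Longrightarrow> v c' = trans c c' p (v c)"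
  shows "v \<in> tangent_space M p"
  unfolding tangent_space_iff using assms by blast

lemma coord_field_eq: "coord_field M c e p c' = (if c' \<in> charts_at M p then trans c c' p e else 0)"
  by (simp add: coord_field_def trans_def)

lemma coord_field_self [simp]: "c \<in> charts_at M p \<Longrightarrow> coord_field M c e p c = e"
  by (simp add: coord_field_eq trans_self)

lemma coord_field_in [simp]: "c \<in> charts_at M p \<Longrightarrow> coord_field M c e p \<in> tangent_space M p"
  by (rule tangent_spaceI) (simp_all add: coord_field_eq trans_trans)

lemma tangent_eq:
  assumes "v \<in> tangent_space M p" "c \<in> charts_at M p" shows "coord_field M c (v c) p = v"
proof
  fix c'
  show "coord_field M c (v c) p c' = v c'"
    using tangent_trans[OF assms, of c'] tangent_zero[OF assms(1), of c']
    by (cases "c' \<in> charts_at M p") (simp_all add: coord_field_eq)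
qed

lemma tangent_eqI: "v \<in> tangent_space M p \<Longrightarrow> w \<in> tangent_space M p \<Longrightarrow> c \<in> charts_at M p \<Longrightarrow> v c = w c \<Longrightarrow> v = w"
  by (metis tangent_eq)

lemma tangent_add:
  assumes "v \<in> tangent_space M p" "w \<in> tangent_space M p" shows "v + w \<in> tangent_space M p"
proof (rule tangent_spaceI)
  fix c c' assume c: "c \<in> charts_at M p" "c' \<in> charts_at M p"
  show "(v + w) c' = trans c c' p ((v + w) c)"
    using tangent_trans[OF assms(1) c] tangent_trans[OF assms(2) c] by (simp add: linear_add[OF linear_trans[OF c]])
qed (simp add: tangent_zero[OF assms(1)] tangent_zero[OF assms(2)])

lemma tangent_scale:
  assumes "v \<in> tangent_space M p" shows "r *\<^sub>R v \<in> tangent_space M p"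
proof (rule tangent_spaceI)
  fix c c' assume c: "c \<in> charts_at M p" "c' \<in> charts_at M p"
  show "(r *\<^sub>R v) c' = trans c c' p ((r *\<^sub>R v) c)"
    using tangent_trans[OF assms(1) c] by (simp add: scaleR_fun_def linear_scale[OF linear_trans[OF c]])
qed (simp add: scaleR_fun_def tangent_zero[OF assms])

lemma coord_field_diff: "c \<in> charts_at M p \<Longrightarrow> coord_field M c a p - coord_field M c b p = coord_field M c (a - b) p"
  by (auto simp: coord_field_eq fun_eq_iff linear_diff[OF linear_trans])

lemma coord_field_0: "c \<in> charts_at M p \<Longrightarrow> coord_field M c 0 p = 0"
  by (auto simp: coord_field_eq fun_eq_iff linear_0[OF linear_trans])

lemma extend_vec_self: "p \<in> points M \<Longrightarrow> v \<in> tangent_space M p \<Longrightarrow> extend_vec M p v p = v"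
  by (simp add: extend_vec_def tangent_eq chart_at)

lemma dir_deriv_eq:
  assumes c: "c \<in> charts_at M p" and v: "v \<in> tangent_space M p"
    and h: "((h \<circ> chart_inv c) has_derivative L) (at (snd c p))"
  shows "dir_deriv M p v h = L (v c)"
proof -
  have c0: "chart_at M p \<in> charts_at M p" using c charts_at_D chart_at by blast
  show ?thesis
    using chart_change[OF c0 c h] tangent_trans[OF v c0 c]
    by (simp add: dir_deriv_def Let_def frechet_derivative_eqI)
qed

section \<open>Vector fields and brackets in a chart\<close>

text \<open>Weaker than \<open>vector_field\<close>: one chart, any set \<open>N\<close>, mere
  differentiability. It has to admit covariant derivatives and brackets of coordinate fields, about
  which nothing is known outside the chart domain.\<close>

definition lfield :: "('a, 'e) chart \<Rightarrow> 'a set \<Rightarrow> ('a \<Rightarrow> ('a, 'e) tvec) \<Rightarrow> bool" where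
  "lfield c N X \<longleftrightarrow> (\<forall>q\<in>N. X q \<in> tangent_space M q) \<and>
     (\<forall>q\<in>N. (\<lambda>x. X (chart_inv c x) c) differentiable (at (snd c q)))"

lemma lfield_subset: "lfield c N X \<Longrightarrow> N' \<subseteq> N \<Longrightarrow> lfield c N' X"
  by (auto simp: lfield_def)

lemma lfield_tangent: "lfield c N X \<Longrightarrow> q \<in> N \<Longrightarrow> X q \<in> tangent_space M q"
  by (simp add: lfield_def)

definition comp_deriv :: "('a, 'e) chart \<Rightarrow> ('a \<Rightarrow> ('a, 'e) tvec) \<Rightarrow> 'a \<Rightarrow> 'e \<Rightarrow> 'e" where
  "comp_deriv c X q = frechet_derivative (\<lambda>x. X (chart_inv c x) c) (at (snd c q))"

lemma lfield_has_derivative: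
  "lfield c N X \<Longrightarrow> q \<in> N \<Longrightarrow> ((\<lambda>x. X (chart_inv c x) c) has_derivative comp_deriv c X q) (at (snd c q))"
  by (simp add: lfield_def comp_deriv_def frechet_derivative_works[symmetric])

text \<open>\<open>extend_vec\<close> uses the coordinate fields of a chosen chart; on the overlap
  they become admissible in the chart \<open>c\<close> in which one computes.\<close>

lemma lfield_coord_field:
  assumes c: "c \<in> atlas M" and c': "c' \<in> atlas M"
  shows "lfield c (fst c \<inter> fst c') (coord_field M c' e)"
  unfolding lfield_def
proof safe
  fix q assume q: "q \<in> fst c" "q \<in> fst c'"
  show "coord_field M c' e q \<in> tangent_space M q" by (rule coord_field_in[OF charts_atI[OF c' q(2)]])
  let ?U = "snd c ` (fst c \<inter> fst c')" and ?U' = "snd c' ` (fst c' \<inter> fst c)"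
  have o: "open ?U" "open ?U'" by (auto intro!: open_chart_image atlasD(1) c c')
  have "smooth_on ?U (\<lambda>x. frechet_derivative (snd c \<circ> chart_inv c') (at ((snd c' \<circ> chart_inv c) x)) e)"
    by (rule smooth_on_compose[OF o _ smooth_transition[OF c c'], where g="\<lambda>y. frechet_derivative (snd c \<circ> chart_inv c') (at y) e"])
      (use c c' smooth_on_frechet[OF smooth_transition[OF c' c]] in auto)
  then have "smooth_on ?U (\<lambda>x. coord_field M c' e (chart_inv c x) c)"
    by (rule smooth_on_cong[OF o(1), rotated]) (use c c' in \<open>auto simp: coord_field_def charts_at_def\<close>)
  then show "(\<lambda>x. coord_field M c' e (chart_inv c x) c) differentiable (at (snd c q))"
    by (rule smooth_on_differentiable) (use q in auto)
qed

lemma lfield_coord_field_self: "c \<in> atlas M \<Longrightarrow> lfield c (fst c) (coord_field M c e)"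
  using lfield_coord_field[of c c e] by simp

text \<open>In another chart \<open>c'\<close> the two derivatives contain the second derivative of
  the transition map, applied to \<open>X\<close> and \<open>Y\<close> in either order; by symmetry
  it cancels, and the bracket transforms as a vector.\<close>

lemma lie_bracket_eq:
  assumes c: "c \<in> atlas M" and N: "openin (mtop M) N" "N \<subseteq> fst c" and q: "q \<in> N"
    and X: "lfield c N X" and Y: "lfield c N Y"
  shows "lie_bracket M X Y q = coord_field M c (comp_deriv c Y q (X q c) - comp_deriv c X q (Y q c)) q"
proof
  fix c'
  show "lie_bracket M X Y q c' = coord_field M c (comp_deriv c Y q (X q c) - comp_deriv c X q (Y q c)) q c'"
  proof (cases "c' \<in> charts_at M q")
    case False
    then show ?thesis by (simp add: lie_bracket_def coord_field_eq)
  next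
    case c': True
    have cq: "c \<in> charts_at M q" using c N q by (auto intro: charts_atI)
    note [simp] = charts_at_D(1,2)[OF cq] charts_at_D(1,2)[OF c']
    let ?k = "snd c' \<circ> chart_inv c" and ?U = "snd c ` (fst c \<inter> fst c')" and ?x = "snd c q"
    have U: "open ?U" "?x \<in> ?U" by (auto intro!: open_chart_image atlasD(1))
    let ?NU = "snd c ` (N \<inter> fst c')"
    have NU: "open ?NU" "?x \<in> ?NU" using N q by (auto intro!: open_chart_image' atlasD(1))
    have k: "smooth_on ?U ?k" by (intro smooth_transition) simp_all
    let ?k2 = "\<lambda>a. frechet_derivative (\<lambda>y. frechet_derivative ?k (at y) a) (at ?x)"
    have d: "dir_deriv M q (Z q) (\<lambda>r. Y r c') = ?k2 (Y q c) (Z q c) + trans c c' q (comp_deriv c Y q (Z q c))"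
      if Z: "lfield c N Z" and Y: "lfield c N Y" for Y Z
    proof (rule dir_deriv_eq[OF cq lfield_tangent[OF Z q]])
      have "((\<lambda>y. frechet_derivative ?k (at y) (Y (chart_inv c y) c)) has_derivative
        (\<lambda>v. ?k2 (Y (chart_inv c ?x) c) v + frechet_derivative ?k (at ?x) (comp_deriv c Y q v))) (at ?x)"
        by (rule has_derivative_frechet_field[OF U k lfield_has_derivative[OF Y q]])
      then have "((\<lambda>y. frechet_derivative ?k (at y) (Y (chart_inv c y) c)) has_derivative
        (\<lambda>v. ?k2 (Y q c) v + trans c c' q (comp_deriv c Y q v))) (at ?x)"
        by (simp add: trans_def)
      then show "((\<lambda>r. Y r c') \<circ> chart_inv c has_derivative (\<lambda>v. ?k2 (Y q c) v + trans c c' q (comp_deriv c Y q v))) (at ?x)"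
      proof (rule has_derivative_transform_within_open[OF _ NU])
        fix y assume "y \<in> ?NU"
        then obtain r where r: "r \<in> N" "r \<in> fst c'" "y = snd c r" "r \<in> fst c" using N by auto
        then have "Y r c' = trans c c' r (Y r c)"
          using lfield_tangent[OF Y r(1)] by (intro tangent_trans charts_atI) simp_all
        then show "frechet_derivative ?k (at y) (Y (chart_inv c y) c) = ((\<lambda>r. Y r c') \<circ> chart_inv c) y"
          using r by (simp add: trans_def)
      qed
    qed
    have "?k2 (Y q c) (X q c) = ?k2 (X q c) (Y q c)" by (rule smooth_on_symmetric[OF U k])
    then show ?thesis
      using c' cq d[OF X Y] d[OF Y X]
      by (simp add: lie_bracket_def coord_field_eq linear_diff[OF linear_trans])
  qed
qed

lemma lie_bracket_coord_fields:
  assumes c: "c \<in> atlas M" and q: "q \<in> fst c"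
  shows "lie_bracket M (coord_field M c a) (coord_field M c b) q = 0"
proof -
  have "comp_deriv c (coord_field M c a) q = (\<lambda>v. 0)" for a
  proof -
    have "((\<lambda>x. a) has_derivative (\<lambda>v. 0)) (at (snd c q))" by simp
    then have "((\<lambda>x. coord_field M c a (chart_inv c x) c) has_derivative (\<lambda>v. 0)) (at (snd c q))"
      by (rule has_derivative_transform_within_open[OF _ atlasD(2)[OF c]]) (use c q in \<open>auto simp: charts_atI\<close>)
    then show ?thesis by (simp add: comp_deriv_def frechet_derivative_eqI)
  qed
  then show ?thesis
    using lie_bracket_eq[OF c atlasD(1)[OF c] subset_refl q lfield_coord_field_self[OF c] lfield_coord_field_self[OF c], of a b]
    by (simp add: coord_field_0 charts_atI c q)
qed

end

section \<open>Levi-Civita connection and curvature of an isometric immersion\<close>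

locale isometric_immersion = smooth_mfd M
  for M :: "('a, 'e::euclidean_space, 'z) manifold_scheme" +
  fixes F :: "'a \<Rightarrow> 'h::euclidean_space" and g :: "'a \<Rightarrow> ('a, 'e) tvec \<Rightarrow> ('a, 'e) tvec \<Rightarrow> real"
  assumes smooth_F: "\<And>c. c \<in> atlas M \<Longrightarrow> smooth_on (snd c ` fst c) (F \<circ> chart_inv c)"
    and inj_F: "\<And>c p. c \<in> charts_at M p \<Longrightarrow> inj (frechet_derivative (F \<circ> chart_inv c) (at (snd c p)))"
    and g_eq: "\<And>p u v. p \<in> points M \<Longrightarrow> u \<in> tangent_space M p \<Longrightarrow> v \<in> tangent_space M p \<Longrightarrow>
      g p u v = dir_deriv M p u F \<bullet> dir_deriv M p v F"
begin

lemma local_immersion: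
  assumes "c \<in> atlas M" "open U" "U \<subseteq> snd c ` fst c"
  shows "local_immersion U (F \<circ> chart_inv c)"
proof
  show "smooth_on U (F \<circ> chart_inv c)" using smooth_F[OF assms(1)] assms(3) by (rule smooth_on_subset)
  fix x assume "x \<in> U"
  then have "snd c (chart_inv c x) = x" "chart_inv c x \<in> fst c" using assms(3) chart_chart_inv[of x c] by auto
  then show "inj (frechet_derivative (F \<circ> chart_inv c) (at x))"
    using inj_F[OF charts_atI[OF assms(1), of "chart_inv c x"]] by simp
qed (rule assms)

abbreviation "dF p v \<equiv> dir_deriv M p v F"

abbreviation (input) Dc where "Dc c \<equiv> local_immersion.D (F \<circ> chart_inv c)"
abbreviation (input) D2c where "D2c c \<equiv> local_immersion.D2 (F \<circ> chart_inv c)"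

lemma interp: "c \<in> atlas M \<Longrightarrow> local_immersion (snd c ` fst c) (F \<circ> chart_inv c)"
  by (rule local_immersion) (auto intro: atlasD)

lemma dF_eq:
  assumes c: "c \<in> charts_at M p" and v: "v \<in> tangent_space M p"
  shows "dF p v = Dc c (snd c p) (v c)"
proof -
  interpret L: local_immersion "snd c ` fst c" "F \<circ> chart_inv c" by (rule interp[OF charts_at_D(1)[OF c]])
  show ?thesis
    by (rule dir_deriv_eq[OF c v L.has_derivative_f]) (use charts_at_D(2)[OF c] in auto)
qed

lemma dF_coord_field [simp]: "c \<in> charts_at M p \<Longrightarrow> dF p (coord_field M c e p) = Dc c (snd c p) e"
  by (simp add: dF_eq)

text \<open>The derivative of the ambient-valued map \<open>\<lambda>q. dF q (Y q)\<close> in the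
  coordinate direction \<open>v\<close>, that is, the flat covariant derivative of the image of
  \<open>Y\<close>.\<close>

definition \<Phi> :: "('a, 'e) chart \<Rightarrow> ('a \<Rightarrow> ('a, 'e) tvec) \<Rightarrow> 'a \<Rightarrow> 'e \<Rightarrow> 'h" where
  "\<Phi> c Y q v = D2c c (snd c q) (Y q c) v + Dc c (snd c q) (comp_deriv c Y q v)"

lemma has_derivative_dF_field:
  assumes c: "c \<in> atlas M" and q: "q \<in> N" "q \<in> fst c" and Y: "lfield c N Y"
  shows "((\<lambda>y. Dc c y (Y (chart_inv c y) c)) has_derivative \<Phi> c Y q) (at (snd c q))"
proof -
  interpret L: local_immersion "snd c ` fst c" "F \<circ> chart_inv c" by (rule interp[OF c])
  show ?thesis
    using L.has_derivative_D_field[OF _ lfield_has_derivative[OF Y q(1)]] c q by (simp add: \<Phi>_def[abs_def])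
qed

text \<open>\<Phi> obeys the product rule for the inner product, and its antisymmetric part is the
  image of the bracket. With both inserted into the Koszul formula, all terms cancel except one,
  which occurs twice.\<close>

lemma koszul_eq:
  assumes c: "c \<in> atlas M" and N: "openin (mtop M) N" "N \<subseteq> fst c" and q: "q \<in> N"
    and X: "lfield c N X" and Y: "lfield c N Y" and Z: "lfield c N Z"
  shows "koszul M g X Y Z q = 2 * (\<Phi> c Y q (X q c) \<bullet> dF q (Z q))"
proof -
  interpret L: local_immersion "snd c ` fst c" "F \<circ> chart_inv c" by (rule interp[OF c])
  have qc: "q \<in> fst c" and cq: "c \<in> charts_at M q" using N q c by (auto intro: charts_atI)
  note [simp] = c qc
  have xU: "snd c q \<in> snd c ` fst c" by simp
  have NU: "open (snd c ` N)" "snd c q \<in> snd c ` N" using N q by (auto intro: open_chart_image')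
  have d: "dir_deriv M q (X q) (\<lambda>r. g r (Y r) (Z r)) = dF q (Y q) \<bullet> \<Phi> c Z q (X q c) + \<Phi> c Y q (X q c) \<bullet> dF q (Z q)"
    if X: "lfield c N X" and Y: "lfield c N Y" and Z: "lfield c N Z" for X Y Z
  proof (rule dir_deriv_eq[OF cq lfield_tangent[OF X q]])
    have "((\<lambda>y. L.D y (Y (chart_inv c y) c) \<bullet> L.D y (Z (chart_inv c y) c)) has_derivative
      (\<lambda>v. L.D (snd c q) (Y (chart_inv c (snd c q)) c) \<bullet> \<Phi> c Z q v + \<Phi> c Y q v \<bullet> L.D (snd c q) (Z (chart_inv c (snd c q)) c))) (at (snd c q))"
      by (intro has_derivative_inner has_derivative_dF_field[OF c q qc] Y Z)
    then have "((\<lambda>y. L.D y (Y (chart_inv c y) c) \<bullet> L.D y (Z (chart_inv c y) c)) has_derivative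
      (\<lambda>v. dF q (Y q) \<bullet> \<Phi> c Z q v + \<Phi> c Y q v \<bullet> dF q (Z q))) (at (snd c q))"
      by (simp add: dF_eq[OF cq lfield_tangent[OF Y q]] dF_eq[OF cq lfield_tangent[OF Z q]])
    then show "((\<lambda>r. g r (Y r) (Z r)) \<circ> chart_inv c has_derivative
      (\<lambda>v. dF q (Y q) \<bullet> \<Phi> c Z q v + \<Phi> c Y q v \<bullet> dF q (Z q))) (at (snd c q))"
    proof (rule has_derivative_transform_within_open[OF _ NU])
      fix y assume "y \<in> snd c ` N"
      then obtain r where r: "r \<in> N" "y = snd c r" "r \<in> fst c" using N by auto
      have cr: "c \<in> charts_at M r" by (rule charts_atI[OF c r(3)])
      show "L.D y (Y (chart_inv c y) c) \<bullet> L.D y (Z (chart_inv c y) c) = ((\<lambda>r. g r (Y r) (Z r)) \<circ> chart_inv c) y"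
        using r charts_at_D(3)[OF cr] lfield_tangent[OF Y r(1)] lfield_tangent[OF Z r(1)]
        by (simp add: g_eq dF_eq[OF cr])
    qed
  qed
  have l: "g q (lie_bracket M X Y q) (Z q) = (\<Phi> c Y q (X q c) - \<Phi> c X q (Y q c)) \<bullet> dF q (Z q)"
    if X: "lfield c N X" and Y: "lfield c N Y" and Z: "lfield c N Z" for X Y Z
    using charts_at_D(3)[OF cq] lfield_tangent[OF Z q] L.D2_sym[OF xU, of "X q c" "Y q c"]
    by (simp add: lie_bracket_eq[OF c N q X Y] g_eq cq \<Phi>_def linear_diff[OF L.linear_D[OF xU]])
  show ?thesis
    unfolding koszul_def d[OF X Y Z] d[OF Y X Z] d[OF Z X Y] l[OF X Y Z] l[OF X Z Y] l[OF Y Z X]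
    by (simp add: inner_diff_left inner_diff_right inner_commute)
qed

text \<open>The Levi-Civita derivative is the tangential part of the flat one. Uniqueness for
  \<open>THE\<close> follows by testing against coordinate fields.\<close>

lemma levi_civita_eq:
  assumes c: "c \<in> atlas M" and N: "openin (mtop M) N" "N \<subseteq> fst c" and q: "q \<in> N"
    and X: "lfield c N X" and Y: "lfield c N Y"
  shows "levi_civita M g X Y q =
    coord_field M c (local_immersion.tang (F \<circ> chart_inv c) (snd c q) (\<Phi> c Y q (X q c))) q"
proof -
  interpret L: local_immersion "snd c ` fst c" "F \<circ> chart_inv c" by (rule interp[OF c])
  have qc: "q \<in> fst c" and cq: "c \<in> charts_at M q" using N q c by (auto intro: charts_atI)
  have qM: "q \<in> points M" by (rule charts_at_D(3)[OF cq])
  have xU: "snd c q \<in> snd c ` fst c" using qc by simp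
  have k: "koszul M g X Y (extend_vec M q u) q = 2 * (\<Phi> c Y q (X q c) \<bullet> dF q u)"
    if u: "u \<in> tangent_space M q" for u
  proof -
    let ?c = "chart_at M q"
    have c': "?c \<in> atlas M" "q \<in> fst ?c" using charts_at_D[OF chart_at[OF qM]] by auto
    \<comment> \<open>The extension of \<open>u\<close> is controlled only where the chart
      \<open>chart_at M q\<close> is defined, hence the passage to the overlap.\<close>
    let ?N = "N \<inter> fst ?c"
    have "lfield c ?N (extend_vec M q u)"
      unfolding extend_vec_def by (rule lfield_subset[OF lfield_coord_field[OF c c'(1)]]) (use N in auto)
    moreover have "openin (mtop M) ?N" using N atlasD(1)[OF c'(1)] by blast
    ultimately show ?thesis
      using koszul_eq[OF c _ _ _ lfield_subset[OF X] lfield_subset[OF Y], where N="?N" and Z="extend_vec M q u" and q=q] N q c' qM u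
      by (auto simp: extend_vec_self)
  qed
  let ?w = "coord_field M c (L.tang (snd c q) (\<Phi> c Y q (X q c))) q"
  show ?thesis
    unfolding levi_civita_def
  proof (rule the_equality)
    show "?w \<in> tangent_space M q \<and> (\<forall>u\<in>tangent_space M q. 2 * g q ?w u = koszul M g X Y (extend_vec M q u) q)"
      using cq qM by (simp add: k g_eq dF_eq[OF cq] L.D_tang_inner[OF xU])
    fix w assume w: "w \<in> tangent_space M q \<and> (\<forall>u\<in>tangent_space M q. 2 * g q w u = koszul M g X Y (extend_vec M q u) q)"
    have "L.tang (snd c q) (\<Phi> c Y q (X q c)) = w c"
    proof (rule L.tang_eqI[OF xU])
      fix e
      have "2 * g q w (coord_field M c e q) = koszul M g X Y (extend_vec M q (coord_field M c e q)) q"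
        using w cq by simp
      then show "L.D (snd c q) (w c) \<bullet> L.D (snd c q) e = \<Phi> c Y q (X q c) \<bullet> L.D (snd c q) e"
        using w cq qM by (simp add: k g_eq dF_eq[OF cq])
    qed
    then show "w = ?w" using w tangent_eq[OF _ cq] by simp
  qed
qed

lemma \<Phi>_eq:
  assumes c: "c \<in> atlas M" and q: "q \<in> N" "q \<in> fst c" and Y: "lfield c N Y"
  shows "\<Phi> c Y q = frechet_derivative (\<lambda>y. Dc c y (Y (chart_inv c y) c)) (at (snd c q))"
  by (rule frechet_derivative_eqI[OF has_derivative_dF_field[OF assms], symmetric])

lemma riemann_coord_fields:
  assumes c: "c \<in> atlas M" and q: "q \<in> fst c"
  shows "riemann_fields M g (coord_field M c a) (coord_field M c b) (coord_field M c d) q =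
    coord_field M c (local_immersion.curv (F \<circ> chart_inv c) (snd c q) a b d) q"
proof -
  interpret L: local_immersion "snd c ` fst c" "F \<circ> chart_inv c" by (rule interp[OF c])
  note N = atlasD(1)[OF c] subset_refl
  have ch: "c \<in> charts_at M r" if "r \<in> fst c" for r by (rule charts_atI[OF c that])
  have xU: "snd c r \<in> snd c ` fst c" if "r \<in> fst c" for r using that by simp
  have Phi: "\<Phi> c Y r = frechet_derivative (\<lambda>y. L.D y (w y)) (at (snd c r))"
    if "lfield c (fst c) Y" "r \<in> fst c" "\<And>y. y \<in> snd c ` fst c \<Longrightarrow> Y (chart_inv c y) c = w y" for Y w r
    unfolding \<Phi>_eq[OF c that(2,2,1)]
    by (rule frechet_derivative_cong_open[OF atlasD(2)[OF c] xU[OF that(2)]]) (simp add: that)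
  have cc: "coord_field M c e (chart_inv c y) c = e" if "y \<in> snd c ` fst c" for y e
    using that c by (auto simp: ch)
  have lc: "levi_civita M g (coord_field M c b) (coord_field M c d) r = coord_field M c (L.\<Gamma> b d (snd c r)) r"
    if r: "r \<in> fst c" for b d r
    using levi_civita_eq[OF c N r lfield_coord_field_self[OF c] lfield_coord_field_self[OF c], of b d]
      Phi[OF lfield_coord_field_self[OF c] r, of d "\<lambda>y. d"] cc ch[OF r] L.D2_sym[OF xU[OF r], of b d]
    by (simp add: L.\<Gamma>_def L.D2_def)
  have comp: "levi_civita M g (coord_field M c b) (coord_field M c d) (chart_inv c y) c = L.\<Gamma> b d y"
    if "y \<in> snd c ` fst c" for b d y
    using that c by (auto simp: lc ch)
  have lf: "lfield c (fst c) (levi_civita M g (coord_field M c b) (coord_field M c d))" for b d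
    unfolding lfield_def
  proof safe
    fix r assume r: "r \<in> fst c"
    show "levi_civita M g (coord_field M c b) (coord_field M c d) r \<in> tangent_space M r"
      by (simp add: lc r ch)
    show "(\<lambda>x. levi_civita M g (coord_field M c b) (coord_field M c d) (chart_inv c x) c) differentiable at (snd c r)"
      using differentiable_cong_open[OF atlasD(2)[OF c] xU[OF r] comp[of _ b d]]
        smooth_on_differentiable[OF L.smooth_\<Gamma> xU[OF r]] by (simp del: o_apply)
  qed
  have 1: "levi_civita M g (coord_field M c a) (levi_civita M g (coord_field M c b) (coord_field M c d)) q =
      coord_field M c (L.tang (snd c q) (frechet_derivative (\<lambda>y. L.D y (L.\<Gamma> b d y)) (at (snd c q)) a)) q" for a b
    using levi_civita_eq[OF c N q lfield_coord_field_self[OF c] lf[of b d], of a] Phi[OF lf[of b d] q comp[of _ b d]] ch[OF q] by simp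
  \<comment> \<open>The bracket is known to vanish on \<open>fst c\<close> only, so its covariant
    derivative has to be computed from the values there.\<close>
  let ?B = "lie_bracket M (coord_field M c a) (coord_field M c b)"
  have B0: "?B r = 0" if "r \<in> fst c" for r using lie_bracket_coord_fields[OF c that] by simp
  have z: "0 \<in> tangent_space M r" if "r \<in> fst c" for r using coord_field_in[OF ch[OF that], of 0] coord_field_0[OF ch[OF that]] by simp
  have "lfield c (fst c) ?B"
    unfolding lfield_def
  proof safe
    fix r assume r: "r \<in> fst c"
    show "?B r \<in> tangent_space M r" by (simp add: B0 r z)
    have "(\<lambda>x. ?B (chart_inv c x) c) differentiable at (snd c r) \<longleftrightarrow> (\<lambda>x. 0 :: 'e) differentiable at (snd c r)"
      by (rule differentiable_cong_open[OF atlasD(2)[OF c] xU[OF r]]) (use B0 c in auto)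
    then show "(\<lambda>x. ?B (chart_inv c x) c) differentiable at (snd c r)" by simp
  qed
  from levi_civita_eq[OF c N q this lfield_coord_field_self[OF c], of d]
  have 2: "levi_civita M g ?B (coord_field M c d) q = coord_field M c 0 q"
    using linear_0[OF has_derivative_linear[OF has_derivative_dF_field[OF c q q lfield_coord_field_self[OF c]]]]
      linear_0[OF L.linear_tang[OF xU[OF q]]] B0[OF q] by simp
  show ?thesis
    unfolding riemann_fields_def 1 2 L.curv_def by (simp add: coord_field_diff ch q)
qed

text \<open>\<open>ricci\<close> extends vectors by \<open>chart_at M p\<close>, which fixes the
  chart of this formula; what it implies is carried to other charts by
  \<open>second_derivative_in_VV\<close>.\<close>

lemma ricci_eq:
  assumes p: "p \<in> points M" and v: "v \<in> tangent_space M p" and c: "c = chart_at M p"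
  shows "ricci M g p v v = (\<Sum>b\<in>Basis. local_immersion.curv (F \<circ> chart_inv c) (snd c p) b (v c) (v c) \<bullet> b)"
proof -
  have cp: "c \<in> charts_at M p" using chart_at[OF p] c by simp
  have e: "extend_vec M p u = coord_field M c (u c)" for u by (simp add: extend_vec_def c)
  show ?thesis
    unfolding ricci_def trace_on_tangent_def Let_def c[symmetric] e
    using cp charts_at_D[OF cp] by (simp add: riemann_coord_fields)
qed

end

section \<open>Charts of the sphere\<close>

lemma C_k_on_local:
  assumes "\<And>x. x \<in> S \<Longrightarrow> \<exists>U. open U \<and> x \<in> U \<and> C_k_on k U f"
  shows "C_k_on k S f"
  using assms
proof (induction k arbitrary: f)
  case 0
  have "isCont f x" if x: "x \<in> S" for x
  proof -
    obtain U where "open U" "x \<in> U" "continuous_on U f" using 0[OF x] by auto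
    then show ?thesis by (simp add: continuous_on_eq_continuous_at)
  qed
  then show ?case by (simp add: continuous_at_imp_continuous_on)
next
  case (Suc k)
  have "f differentiable (at x)" if x: "x \<in> S" for x
    using Suc.prems[OF x] by auto
  moreover have "C_k_on k S (\<lambda>x. frechet_derivative f (at x) v)" for v
  proof (rule Suc.IH)
    fix x assume x: "x \<in> S"
    show "\<exists>U. open U \<and> x \<in> U \<and> C_k_on k U (\<lambda>x. frechet_derivative f (at x) v)"
      using Suc.prems[OF x] by auto
  qed
  ultimately show ?case by simp
qed

lemma smooth_on_local:
  assumes "\<And>x. x \<in> S \<Longrightarrow> \<exists>U. open U \<and> x \<in> U \<and> smooth_on U f"
  shows "smooth_on S f"
  unfolding smooth_on_def
proof (intro allI C_k_on_local)
  fix k x assume "x \<in> S"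
  then show "\<exists>U. open U \<and> x \<in> U \<and> C_k_on k U f" using assms[of x] unfolding smooth_on_def by blast
qed

section \<open>Stereographic charts\<close>

text \<open>\<kappa> is the stereographic projection from \<open>- p\<close> onto the hyperplane
  orthogonal to \<open>p\<close>, which is identified with \<open>'e\<close> by a linear isometry,
  and \<psi> is its inverse.\<close>

lemma stereographic:
  fixes p :: "'h::euclidean_space"
  assumes p: "norm p = 1" and dim: "DIM('e::euclidean_space) + 1 = DIM('h)"
  obtains \<psi> :: "'e::euclidean_space \<Rightarrow> 'h" and \<kappa> where "smooth_on UNIV \<psi>"
    "\<And>y. \<psi> y \<in> sphere 0 1 - {- p}" "\<And>y. \<kappa> (\<psi> y) = y" "\<And>q. q \<in> sphere 0 1 - {- p} \<Longrightarrow> \<psi> (\<kappa> q) = q"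
    "continuous_on (sphere 0 1 - {- p}) \<kappa>" "\<And>y. inj (frechet_derivative \<psi> (at y))"
proof -
  let ?T = "{x. p \<bullet> x = 0}"
  have pp: "p \<bullet> p = 1" using p by (simp add: dot_square_norm)
  have dims: "dim (UNIV :: 'e set) = dim ?T" using p dim by (subst dim_hyperplane) auto
  obtain L :: "'e \<Rightarrow> 'h" and G where L: "linear L" "linear G" "L ` UNIV = ?T" "G ` ?T = UNIV"
    "\<And>x. norm (L x) = norm x" "\<And>x. x \<in> ?T \<Longrightarrow> norm (G x) = norm x" "\<And>x. G (L x) = x" "\<And>x. x \<in> ?T \<Longrightarrow> L (G x) = x"
    by (rule isometries_subspaces[OF subspace_UNIV subspace_hyperplane dims]) auto
  have pL: "p \<bullet> L y = 0" "L y \<bullet> p = 0" for y using L(3) by (auto simp: inner_commute)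
  have LL: "L y \<bullet> L y = y \<bullet> y" for y using L(5)[of y] by (simp add: norm_eq)
  define a where "a y = 1 + y \<bullet> y" for y :: 'e
  have a: "a y > 0" "a y \<noteq> 0" for y
    using inner_ge_zero[of y] unfolding a_def by linarith+
  define \<psi> where "\<psi> y = (1 / a y) *\<^sub>R (2 *\<^sub>R L y + (1 - y \<bullet> y) *\<^sub>R p)" for y
  define \<kappa> where "\<kappa> q = (1 / (1 + q \<bullet> p)) *\<^sub>R G (q - (q \<bullet> p) *\<^sub>R p)" for q
  have bL: "bounded_linear L" "bounded_linear G" using L by (simp_all add: linear_conv_bounded_linear)
  \<comment> \<open>Division by \<open>a y\<close> is treated as a linear system with the
    coefficient \<open>a y\<close>.\<close>
  have smooth: "smooth_on UNIV \<psi>"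
  proof (rule smooth_on_solve[where M="\<lambda>y w. a y *\<^sub>R w"])
    show "smooth_on UNIV (\<lambda>y. a y *\<^sub>R e)" for e :: 'h
      unfolding a_def by (intro smooth_on_scaleR smooth_on_add smooth_on_inner smooth_on_const smooth_on_ident open_UNIV)
    show "smooth_on UNIV (\<lambda>y. 2 *\<^sub>R L y + (1 - y \<bullet> y) *\<^sub>R p)"
      by (intro smooth_on_scaleR smooth_on_add smooth_on_diff smooth_on_inner smooth_on_const smooth_on_ident
          smooth_on_bounded_linear[OF bL(1)] open_UNIV)
  qed (use a in \<open>auto intro!: linearI injI simp: algebra_simps \<psi>_def\<close>)
  have psip: "\<psi> y \<bullet> p = (1 - y \<bullet> y) / a y" for y
    by (simp add: \<psi>_def inner_add_left pL pp)
  have one: "1 + \<psi> y \<bullet> p = 2 / a y" for y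
    using a(2)[of y] by (simp add: psip field_simps) (simp add: a_def)
  have psi_sphere: "\<psi> y \<in> sphere 0 1 - {- p}" for y
  proof -
    have "\<psi> y \<bullet> \<psi> y = (4 * (y \<bullet> y) + (1 - y \<bullet> y)\<^sup>2) / (a y)\<^sup>2"
      by (simp add: \<psi>_def inner_add_left inner_add_right pL pp LL power2_eq_square add_divide_distrib)
    also have "4 * (y \<bullet> y) + (1 - y \<bullet> y)\<^sup>2 = (a y)\<^sup>2" by (simp add: a_def power2_eq_square algebra_simps)
    finally have "norm (\<psi> y) = 1" using a(2)[of y] by (simp add: norm_eq_1)
    moreover have "\<psi> y \<noteq> - p"
    proof
      assume "\<psi> y = - p"
      then have "1 + \<psi> y \<bullet> p = 0" using pp by simp
      then show False using one[of y] a(2)[of y] by simp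
    qed
    ultimately show ?thesis by simp
  qed
  have kp: "\<kappa> (\<psi> y) = y" for y
  proof -
    have "\<psi> y - (\<psi> y \<bullet> p) *\<^sub>R p = (2 / a y) *\<^sub>R L y"
      unfolding psip by (simp add: \<psi>_def scaleR_add_right)
    then have "G (\<psi> y - (\<psi> y \<bullet> p) *\<^sub>R p) = (2 / a y) *\<^sub>R y"
      using L(7) linear_scale[OF L(2)] by simp
    then show ?thesis using a(2)[of y] by (simp add: \<kappa>_def one)
  qed
  have ne: "1 + q \<bullet> p \<noteq> 0" if q: "q \<in> sphere 0 1 - {- p}" for q
  proof
    assume *: "1 + q \<bullet> p = 0"
    have "q \<bullet> q = 1" using q by (simp add: dot_square_norm)
    then have "(q + p) \<bullet> (q + p) = 0" using * pp by (simp add: inner_add_left inner_add_right inner_commute)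
    then show False using q by (simp add: eq_neg_iff_add_eq_0)
  qed
  have pk: "\<psi> (\<kappa> q) = q" if q: "q \<in> sphere 0 1 - {- p}" for q
  proof -
    define s where "s = q \<bullet> p"
    have s: "1 + s \<noteq> 0" using ne[OF q] by (simp add: s_def)
    let ?r = "q - s *\<^sub>R p"
    have qq: "q \<bullet> q = 1" using q by (simp add: dot_square_norm)
    have r: "?r \<in> ?T" using pp by (simp add: s_def inner_diff_right inner_commute)
    have "G ?r \<bullet> G ?r = ?r \<bullet> ?r" using L(6)[OF r] by (simp add: norm_eq)
    also have "\<dots> = 1 - s\<^sup>2"
    proof -
      have "q \<bullet> p = s" "p \<bullet> q = s" by (simp_all add: s_def inner_commute)
      then show ?thesis using qq pp by (simp add: inner_diff_left inner_diff_right power2_eq_square)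
    qed
    finally have "\<kappa> q \<bullet> \<kappa> q = (1 - s\<^sup>2) / (1 + s)\<^sup>2"
      by (simp add: \<kappa>_def s_def[symmetric] power2_eq_square)
    also have "\<dots> = (1 - s) / (1 + s)"
    proof -
      have "1 - s\<^sup>2 = (1 - s) * (1 + s)" by (simp add: power2_eq_square algebra_simps)
      then show ?thesis using s by (simp add: power2_eq_square)
    qed
    finally have kk: "\<kappa> q \<bullet> \<kappa> q = (1 - s) / (1 + s)" .
    have 1: "1 / a (\<kappa> q) = (1 + s) / 2" "1 - \<kappa> q \<bullet> \<kappa> q = 2 * s / (1 + s)"
      using s by (simp_all add: a_def kk field_simps)
    have 2: "L (\<kappa> q) = (1 / (1 + s)) *\<^sub>R ?r"
      using L(8)[OF r] linear_scale[OF L(1)] by (simp add: \<kappa>_def s_def[symmetric])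
    have "2 + s * 2 \<noteq> 0"
    proof
      assume "2 + s * 2 = 0"
      then have "1 + s = 0" by linarith
      with s show False ..
    qed
    then have 3: "(2 + s * 2) / (2 + 2 * s) = 1" by (simp add: mult.commute)
    show ?thesis
      unfolding \<psi>_def 1 2 using s by (simp add: scaleR_add_right scaleR_diff_right 3)
  qed
  have cont: "continuous_on (sphere 0 1 - {- p}) \<kappa>"
    unfolding \<kappa>_def using ne by (intro continuous_intros bounded_linear.continuous_on[OF bL(2)]) auto
  \<comment> \<open>The formula for \<kappa> is differentiable in the ambient space near the sphere
    without \<open>- p\<close>; the chain rule for \<open>\<kappa> (\<psi> y) = y\<close> then gives
    the derivative of \<psi> a left inverse.\<close>
  have inj: "inj (frechet_derivative \<psi> (at y))" for y
  proof -
    have n: "1 + \<psi> y \<bullet> p \<noteq> 0" by (rule ne[OF psi_sphere])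
    have "((\<lambda>q. G (q - (q \<bullet> p) *\<^sub>R p)) has_derivative (\<lambda>v. G (v - (v \<bullet> p) *\<^sub>R p))) (at (\<psi> y))"
      by (intro bounded_linear.has_derivative[OF bL(2)] has_derivative_diff has_derivative_ident
          has_derivative_scaleR_left has_derivative_inner_left)
    then have "(\<lambda>q. G (q - (q \<bullet> p) *\<^sub>R p)) differentiable (at (\<psi> y))" by (rule differentiableI)
    moreover have "(\<lambda>q. 1 / (1 + q \<bullet> p)) differentiable (at (\<psi> y))"
      using n by (intro differentiable_divide differentiable_const
          differentiableI[OF has_derivative_add[OF has_derivative_const has_derivative_inner_left[OF has_derivative_ident]]])
    ultimately have "\<kappa> differentiable (at (\<psi> y))"
      unfolding \<kappa>_def[abs_def] by (rule differentiable_scaleR[rotated])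
    then obtain K where K: "(\<kappa> has_derivative K) (at (\<psi> y))" by (auto simp: differentiable_def)
    have "((\<lambda>y. \<kappa> (\<psi> y)) has_derivative (\<lambda>v. K (frechet_derivative \<psi> (at y) v))) (at y)"
      by (rule has_derivative_compose[OF smooth_on_has_derivative[OF smooth UNIV_I] K])
    then have "((\<lambda>y. y) has_derivative (\<lambda>v. K (frechet_derivative \<psi> (at y) v))) (at y)" by (simp add: kp)
    then have "(\<lambda>v. K (frechet_derivative \<psi> (at y) v)) = (\<lambda>v. v)"
      using has_derivative_unique has_derivative_ident by blast
    then show ?thesis by (metis injI)
  qed
  show thesis by (rule that[OF smooth psi_sphere kp pk cont inj])
qed

lemma atlas_standard_sphere: "atlas standard_sphere = atlas sphere_manifold"
  and mtop_standard_sphere: "mtop standard_sphere = top_of_set (sphere 0 1)"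
  and eta_standard_sphere: "eta standard_sphere p v =
    (\<Sum>j\<in>UNIV. Re (p $ j) * Im (ambient p v $ j) - Im (p $ j) * Re (ambient p v $ j))"
  and riem_standard_sphere: "riem standard_sphere p u v = ambient p u \<bullet> ambient p v"
  by (simp_all add: standard_sphere_def sphere_manifold_def)

lemma sphere_atlas_iff:
  "c \<in> atlas sphere_manifold \<longleftrightarrow> openin (top_of_set (sphere 0 1)) (fst c) \<and> open (snd c ` fst c) \<and>
     homeomorphism (fst c) (snd c ` fst c) (snd c) (chart_inv c) \<and>
     smooth_on (snd c ` fst c) (chart_inv c) \<and> (\<forall>x\<in>snd c ` fst c. inj (frechet_derivative (chart_inv c) (at x)))"
  by (simp add: sphere_manifold_def)

lemma charts_at_sphere: "charts_at standard_sphere p = charts_at sphere_manifold p"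
  by (simp add: charts_at_def atlas_standard_sphere)

text \<open>Projecting from \<open>- p\<close> keeps \<open>p\<close> in the domain, so each point
  gets its own stereographic chart.\<close>

lemma sphere_charts_exist:
  assumes p: "p \<in> sphere 0 (1::real)" and dim: "DIM('e::euclidean_space) + 1 = DIM(complex ^ 'k::finite)"
  shows "\<exists>c. c \<in> charts_at (sphere_manifold :: (complex ^ 'k::finite, 'e::euclidean_space) manifold) p"
proof -
  have np: "norm p = 1" using p by simp
  obtain \<psi> :: "'e \<Rightarrow> complex ^ 'k" and \<kappa> where s: "smooth_on UNIV \<psi>"
    "\<And>y. \<psi> y \<in> sphere 0 1 - {- p}" "\<And>y. \<kappa> (\<psi> y) = y" "\<And>q. q \<in> sphere 0 1 - {- p} \<Longrightarrow> \<psi> (\<kappa> q) = q"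
    "continuous_on (sphere 0 1 - {- p}) \<kappa>" "\<And>y. inj (frechet_derivative \<psi> (at y))"
    using stereographic[OF np dim] by metis
  define A where "A = sphere 0 1 - {- p}"
  have im: "\<kappa> ` A = UNIV" using s(2,3) unfolding A_def by (metis UNIV_eq_I image_eqI)
  have inj: "inj_on \<kappa> A" using s(4) unfolding A_def by (metis inj_onI)
  have inv: "chart_inv (A, \<kappa>) = \<psi>"
    using s(2,3) inj by (auto simp: chart_inv_def A_def[symmetric] intro!: inv_into_f_eq)
  have "continuous_on UNIV \<psi>" using s(1) by (rule smooth_on_continuous)
  then have hom: "homeomorphism A UNIV \<kappa> \<psi>"
    unfolding homeomorphism_def using s im by (auto simp: A_def image_iff) metis
  have "openin (top_of_set (sphere 0 1)) A"
    unfolding A_def by (intro openin_diff) (auto intro: closed_subset simp: np)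
  then have "(A, \<kappa>) \<in> atlas sphere_manifold"
    using im inv hom s by (simp add: sphere_atlas_iff)
  moreover have "p \<in> A"
  proof -
    have "p \<noteq> - p"
    proof
      assume "p = - p"
      then have "2 *\<^sub>R p = 0" by (metis add.right_inverse scaleR_2)
      then show False using np by simp
    qed
    then show ?thesis using p by (simp add: A_def)
  qed
  ultimately show ?thesis by (auto simp: charts_at_def)
qed

lemma sphere_chartD:
  assumes "c \<in> charts_at sphere_manifold p"
  shows "openin (top_of_set (sphere 0 1)) (fst c)" "open (snd c ` fst c)" "p \<in> fst c"
    "\<And>q. q \<in> fst c \<Longrightarrow> chart_inv c (snd c q) = q" "continuous_on (fst c) (snd c)"
    "smooth_on (snd c ` fst c) (chart_inv c)" "\<And>x. x \<in> snd c ` fst c \<Longrightarrow> inj (frechet_derivative (chart_inv c) (at x))"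
    "c \<in> atlas sphere_manifold" "continuous_on (snd c ` fst c) (chart_inv c)"
  using assms by (auto simp: charts_at_def sphere_atlas_iff homeomorphism_def)

section \<open>Smooth maps into the sphere\<close>

context smooth_mfd
begin

lemma open_chart_vimage:
  assumes c: "c \<in> atlas M" and F: "continuous_map (mtop M) X F" and W: "openin X W"
  shows "open (snd c ` (fst c \<inter> F -` W))"
proof -
  have "openin (mtop M) {q \<in> points M. F q \<in> W}" using F W by (rule openin_continuous_map_preimage)
  from open_chart_image[OF c this] show ?thesis
    using atlasD(4)[OF c] by (simp add: vimage_def Int_def Collect_conj_eq[symmetric] subset_iff cong: conj_cong)
qed

text \<open>Near each point \<open>F\<close> is \<open>chart_inv c'\<close> composed with the
  coordinate expression of \<open>F\<close>, and both are smooth. The chain rule then identifies the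
  ambient image of the differential with the derivative of \<open>F\<close> as an ambient-valued
  map.\<close>

lemma smooth_map_sphereD:
  fixes F :: "'a \<Rightarrow> complex ^ 'k::finite"
  assumes F: "smooth_map M (standard_sphere :: (complex ^ 'k, 'f::euclidean_space) contact_metric) F"
    and dim: "DIM('f::euclidean_space) + 1 = DIM(complex ^ 'k)"
  shows "p \<in> points M \<Longrightarrow> F p \<in> sphere 0 1"
    and "c \<in> atlas M \<Longrightarrow> smooth_on (snd c ` fst c) (F \<circ> chart_inv c)"
    and "p \<in> points M \<Longrightarrow> ambient (F p) (push M (standard_sphere :: (complex ^ 'k, 'f::euclidean_space) contact_metric) F p v) = dir_deriv M p v F"
proof -
  let ?N = "standard_sphere :: (complex ^ 'k, 'f) contact_metric"
  have cont: "continuous_map (mtop M) (top_of_set (sphere 0 1)) F"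
    using F by (simp add: smooth_map_def mtop_standard_sphere)
  show sph: "F p \<in> sphere 0 1" if "p \<in> points M" for p
    using cont that by (auto simp: continuous_map_def Pi_iff)
  have loc: "\<exists>U. open U \<and> snd c p \<in> U \<and> smooth_on U (snd c' \<circ> F \<circ> chart_inv c) \<and>
      (\<forall>x\<in>U. (snd c' \<circ> F \<circ> chart_inv c) x \<in> snd c' ` fst c') \<and>
      (\<forall>x\<in>U. chart_inv c' ((snd c' \<circ> F \<circ> chart_inv c) x) = (F \<circ> chart_inv c) x)"
    if c: "c \<in> charts_at M p" and c': "c' \<in> charts_at (sphere_manifold :: (complex ^ 'k, 'f) manifold) (F p)" for c c' p
  proof (intro exI conjI ballI)
    let ?U = "snd c ` (fst c \<inter> F -` fst c')"
    note c'' = sphere_chartD[OF c'] and cc = charts_at_D[OF c]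
    show "open ?U" by (rule open_chart_vimage[OF cc(1) cont c''(1)])
    show "snd c p \<in> ?U" using cc c'' by blast
    show "smooth_on ?U (snd c' \<circ> F \<circ> chart_inv c)"
      using F cc(1) c''(8) unfolding smooth_map_def atlas_standard_sphere by blast
    fix x assume "x \<in> ?U"
    then obtain q where "q \<in> fst c" "F q \<in> fst c'" "x = snd c q" by auto
    then show "(snd c' \<circ> F \<circ> chart_inv c) x \<in> snd c' ` fst c'"
      "chart_inv c' ((snd c' \<circ> F \<circ> chart_inv c) x) = (F \<circ> chart_inv c) x"
      using cc(1) c''(4) by simp_all
  qed
  show "smooth_on (snd c ` fst c) (F \<circ> chart_inv c)" if c: "c \<in> atlas M" for c
  proof (rule smooth_on_local)
    fix x assume "x \<in> snd c ` fst c"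
    then obtain p where p: "p \<in> fst c" "x = snd c p" by auto
    have cp: "c \<in> charts_at M p" using c p by (simp add: charts_atI)
    obtain c' where c': "c' \<in> charts_at (sphere_manifold :: (complex ^ 'k, 'f) manifold) (F p)"
      using sphere_charts_exist[OF sph[OF charts_at_D(3)[OF cp]] dim] by blast
    obtain U where U: "open U" "snd c p \<in> U" "smooth_on U (snd c' \<circ> F \<circ> chart_inv c)"
      "\<And>x. x \<in> U \<Longrightarrow> (snd c' \<circ> F \<circ> chart_inv c) x \<in> snd c' ` fst c'"
      "\<And>x. x \<in> U \<Longrightarrow> chart_inv c' ((snd c' \<circ> F \<circ> chart_inv c) x) = (F \<circ> chart_inv c) x"
      using loc[OF cp c'] by blast
    have "smooth_on U (\<lambda>x. chart_inv c' ((snd c' \<circ> F \<circ> chart_inv c) x))"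
      by (rule smooth_on_compose[OF U(1) sphere_chartD(2)[OF c'] U(4) U(3) sphere_chartD(6)[OF c']])
    then have "smooth_on U (F \<circ> chart_inv c)" by (rule smooth_on_cong[OF U(1), rotated]) (rule U(5))
    then show "\<exists>U. open U \<and> x \<in> U \<and> smooth_on U (F \<circ> chart_inv c)" using U p by blast
  qed
  show "ambient (F p) (push M ?N F p v) = dir_deriv M p v F" if p: "p \<in> points M"
  proof -
    let ?S = "sphere_manifold :: (complex ^ 'k, 'f) manifold"
    define c' where "c' = chart_at ?S (F p)"
    define c where "c = chart_at M p"
    have cp: "c \<in> charts_at M p" unfolding c_def by (rule chart_at[OF p])
    have c': "c' \<in> charts_at ?S (F p)"
      unfolding c'_def chart_at_def using sphere_charts_exist[OF sph[OF p] dim] by (rule someI_ex)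
    obtain U where U: "open U" "snd c p \<in> U" "smooth_on U (snd c' \<circ> F \<circ> chart_inv c)"
      "\<And>x. x \<in> U \<Longrightarrow> (snd c' \<circ> F \<circ> chart_inv c) x \<in> snd c' ` fst c'"
      "\<And>x. x \<in> U \<Longrightarrow> chart_inv c' ((snd c' \<circ> F \<circ> chart_inv c) x) = (F \<circ> chart_inv c) x"
      using loc[OF cp c'] by blast
    let ?h = "snd c' \<circ> F \<circ> chart_inv c"
    have hx: "?h (snd c p) = snd c' (F p)" using charts_at_D[OF cp] by simp
    have 1: "(?h has_derivative frechet_derivative ?h (at (snd c p))) (at (snd c p))"
      by (rule smooth_on_has_derivative[OF U(3,2)])
    have 2: "(chart_inv c' has_derivative frechet_derivative (chart_inv c') (at (?h (snd c p)))) (at (?h (snd c p)))"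
      by (rule smooth_on_has_derivative[OF sphere_chartD(6)[OF c'] U(4)[OF U(2)]])
    have "((F \<circ> chart_inv c) has_derivative
        (\<lambda>v. frechet_derivative (chart_inv c') (at (?h (snd c p))) (frechet_derivative ?h (at (snd c p)) v))) (at (snd c p))"
      using has_derivative_transform_within_open[OF has_derivative_compose[OF 1 2] U(1,2,5)] .
    then have "dir_deriv M p v F = frechet_derivative (chart_inv c') (at (snd c' (F p))) (frechet_derivative ?h (at (snd c p)) (v c))"
      by (simp add: dir_deriv_def c_def[symmetric] frechet_derivative_eqI charts_at_D(1,2)[OF cp])
    moreover have "push M ?N F p v c' = frechet_derivative ?h (at (snd c p)) (v c)"
      using c' by (simp add: push_def charts_at_sphere dir_deriv_def c_def[symmetric] comp_assoc)
    moreover have "(\<lambda>q. q) \<circ> chart_inv c' = chart_inv c'" by auto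
    ultimately show ?thesis
      by (simp add: ambient_def dir_deriv_def[of sphere_manifold] c'_def[symmetric])
  qed
qed

text \<open>The coordinate expression of \<open>F\<close> in a chart \<open>c'\<close> of the sphere
  solves an equation with the immersion \<open>chart_inv c'\<close> on the left and the smooth
  ambient map on the right, so \<open>smooth_on_implicit\<close> applies.\<close>

lemma smooth_map_sphereI:
  fixes F :: "'a \<Rightarrow> complex ^ 'k::finite"
  assumes cont: "continuous_map (mtop M) (top_of_set (sphere 0 1)) F"
    and smooth: "\<And>c. c \<in> atlas M \<Longrightarrow> smooth_on (snd c ` fst c) (F \<circ> chart_inv c)"
  shows "smooth_map M (standard_sphere :: (complex ^ 'k, 'f::euclidean_space) contact_metric) F"
  unfolding smooth_map_def mtop_standard_sphere
proof (intro conjI cont ballI)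
  fix c :: "('a, 'e) chart" and c' :: "(complex ^ 'k, 'f) chart"
  assume c: "c \<in> atlas M" and "c' \<in> atlas standard_sphere"
  then have c': "openin (top_of_set (sphere 0 1)) (fst c')" "open (snd c' ` fst c')"
    "homeomorphism (fst c') (snd c' ` fst c') (snd c') (chart_inv c')"
    "smooth_on (snd c' ` fst c') (chart_inv c')" "\<And>x. x\<in>snd c' ` fst c' \<Longrightarrow> inj (frechet_derivative (chart_inv c') (at x))"
    by (auto simp: atlas_standard_sphere sphere_atlas_iff)
  let ?U = "snd c ` (fst c \<inter> F -` fst c')"
  have oU: "open ?U" by (rule open_chart_vimage[OF c cont c'(1)])
  have sU: "smooth_on ?U (F \<circ> chart_inv c)" using smooth[OF c] by (rule smooth_on_subset) auto
  have FU: "(F \<circ> chart_inv c) x \<in> fst c'" if "x \<in> ?U" for x using that c by auto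
  show "smooth_on ?U (snd c' \<circ> F \<circ> chart_inv c)"
  proof (rule smooth_on_implicit[OF oU c'(2,4,5) _ _ sU])
    have "continuous_on ?U (\<lambda>x. snd c' ((F \<circ> chart_inv c) x))"
      using homeomorphism_cont1[OF c'(3)] smooth_on_continuous[OF sU]
      by (rule continuous_on_compose2) (use FU in auto)
    then show "continuous_on ?U (snd c' \<circ> F \<circ> chart_inv c)" by (simp add: o_def)
    show "(snd c' \<circ> F \<circ> chart_inv c) x \<in> snd c' ` fst c'" if "x \<in> ?U" for x
      using FU[OF that] by simp
    show "chart_inv c' ((snd c' \<circ> F \<circ> chart_inv c) x) = (F \<circ> chart_inv c) x" if "x \<in> ?U" for x
      using homeomorphism_apply1[OF c'(3) FU[OF that]] by simp
  qed
qed

end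

section \<open>Contact metric manifolds in the sphere\<close>

text \<open>A Sasakian immersion in ambient terms, free of push-forwards. \<open>J (F p)\<close> is
  the Reeb vector of the sphere at \<open>F p\<close>, so \<open>eta_eq\<close> expresses the
  pullback of the standard contact form.\<close>

locale contact_immersion = isometric_immersion S F "riem S" + complex_structure J
  for S :: "('a, 'e::euclidean_space) contact_metric" and F :: "'a \<Rightarrow> 'h::euclidean_space" and J :: "'h \<Rightarrow> 'h" +
  fixes n :: nat
  assumes dim_model: "DIM('e) = 2 * n + 1"
    and connected: "connected_space (mtop S)" "points S \<noteq> {}"
    and unit_F: "\<And>p. p \<in> points S \<Longrightarrow> F p \<bullet> F p = 1"
    and eta_eq: "\<And>p v. p \<in> points S \<Longrightarrow> v \<in> tangent_space S p \<Longrightarrow> eta S p v = J (F p) \<bullet> dir_deriv S p v F"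
    and compat: "\<And>p v. p \<in> points S \<Longrightarrow> v \<in> tangent_space S p \<Longrightarrow>
      riem S p (phi S p v) (phi S p v) = riem S p v v - (eta S p v)\<^sup>2"
    and eta_ne: "\<And>p. p \<in> points S \<Longrightarrow> \<exists>v\<in>tangent_space S p. eta S p v \<noteq> 0"
    and einstein: "\<exists>l. \<forall>p\<in>points S. \<forall>v\<in>tangent_space S p. ricci S (riem S) p v v = l * riem S p v v"
begin

text \<open>For \<open>eta\<close> written as \<open>J (F p) \<bullet> dF p v\<close>, second
  derivatives cancel by symmetry, and the two remaining terms coincide because \<open>J\<close> is
  skew. This is the origin of the 2 in \<open>d\<eta>(X,Y) = 2 g(X, \<phi> Y)\<close>.\<close>

lemma ext_deriv_eta:
  assumes p: "p \<in> points S" and u: "u \<in> tangent_space S p" and v: "v \<in> tangent_space S p"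
  shows "ext_deriv S (eta S) p u v = 2 * (J (dF p u) \<bullet> dF p v)"
proof -
  define c where "c = chart_at S p"
  have cp: "c \<in> charts_at S p" unfolding c_def by (rule chart_at[OF p])
  note c = charts_at_D(1,2)[OF cp]
  let ?U = "snd c ` fst c" and ?x = "snd c p"
  interpret L: local_immersion ?U "F \<circ> chart_inv c" by (rule interp[OF c(1)])
  have xU: "?x \<in> ?U" using c by simp
  let ?f = "F \<circ> chart_inv c"
  have d: "dir_deriv S p (coord_field S c a p) (\<lambda>r. eta S r (coord_field S c b r)) =
      J (F p) \<bullet> L.D2 ?x b a + J (L.D ?x a) \<bullet> L.D ?x b" for a b
  proof -
    have "((\<lambda>y. J (?f y) \<bullet> L.D y b) has_derivative (\<lambda>v. J (?f ?x) \<bullet> L.D2 ?x b v + J (L.D ?x v) \<bullet> L.D ?x b)) (at ?x)"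
      by (intro has_derivative_inner L.has_derivative_D xU
          bounded_linear.has_derivative[OF bounded_linear_J] L.has_derivative_f)
    then have "(((\<lambda>r. eta S r (coord_field S c b r)) \<circ> chart_inv c) has_derivative
        (\<lambda>v. J (?f ?x) \<bullet> L.D2 ?x b v + J (L.D ?x v) \<bullet> L.D ?x b)) (at ?x)"
    proof (rule has_derivative_transform_within_open[OF _ atlasD(2)[OF c(1)] xU])
      fix y assume "y \<in> ?U"
      then obtain r where r: "r \<in> fst c" "y = snd c r" by auto
      have cr: "c \<in> charts_at S r" by (rule charts_atI[OF c(1) r(1)])
      show "J (?f y) \<bullet> L.D y b = ((\<lambda>r. eta S r (coord_field S c b r)) \<circ> chart_inv c) y"
        using r c(1) cr charts_at_D(3)[OF cr] by (simp add: eta_eq)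
    qed
    from dir_deriv_eq[OF cp coord_field_in[OF cp] this, of a] show ?thesis using c cp by simp
  qed
  have "eta S p 0 = 0"
    using eta_eq[OF p, of 0] coord_field_in[OF cp, of 0] dF_coord_field[OF cp, of 0]
    by (simp add: coord_field_0[OF cp] linear_0[OF L.linear_D[OF xU]])
  moreover have "extend_vec S p w = coord_field S c (w c)" for w by (simp add: extend_vec_def c_def)
  ultimately have "ext_deriv S (eta S) p u v = J (L.D ?x (u c)) \<bullet> L.D ?x (v c) - J (L.D ?x (v c)) \<bullet> L.D ?x (u c)"
    using L.D2_sym[OF xU, of "u c" "v c"]
    by (simp add: ext_deriv_def ext_deriv_fields_def d lie_bracket_coord_fields[OF c])
  also have "\<dots> = 2 * (J (dF p u) \<bullet> dF p v)"
    using inner_J_left[of "L.D ?x (v c)" "L.D ?x (u c)"] by (simp add: dF_eq[OF cp] u v inner_commute)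
  finally show ?thesis .
qed

text \<open>By \<open>ext_deriv_eta\<close>, the defining equation makes the image of
  \<open>phi S p v\<close> the negative tangential part of \<open>J (dF p v)\<close>; the minus sign
  arises because \<open>v\<close> stands in the second slot of \<open>ext_deriv\<close>.\<close>

lemma phi_eq:
  assumes p: "p \<in> points S" and v: "v \<in> tangent_space S p"
  shows "phi S p v \<in> tangent_space S p"
    and "\<And>u. u \<in> tangent_space S p \<Longrightarrow> dF p (phi S p v) \<bullet> dF p u = - (J (dF p v) \<bullet> dF p u)"
proof -
  define c where "c = chart_at S p"
  have cp: "c \<in> charts_at S p" unfolding c_def by (rule chart_at[OF p])
  note c = charts_at_D(1,2)[OF cp]
  let ?x = "snd c p"
  interpret L: local_immersion "snd c ` fst c" "F \<circ> chart_inv c" by (rule interp[OF c(1)])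
  have xU: "?x \<in> snd c ` fst c" using c by simp
  define w where "w = coord_field S c (L.tang ?x (- J (dF p v))) p"
  have wT: "w \<in> tangent_space S p" by (simp add: w_def cp)
  have w: "dF p w \<bullet> dF p u = - (J (dF p v) \<bullet> dF p u)" if "u \<in> tangent_space S p" for u
    using that by (simp add: w_def cp dF_eq[OF cp, of u] L.D_tang_inner[OF xU])
  have iff: "ext_deriv S (eta S) p u v = 2 * riem S p u z \<longleftrightarrow> dF p z \<bullet> dF p u = - (J (dF p v) \<bullet> dF p u)"
    if "u \<in> tangent_space S p" "z \<in> tangent_space S p" for u z
    using that p v inner_J_left[of "dF p u" "dF p v"] by (simp add: ext_deriv_eta g_eq inner_commute) linarith
  have "phi S p v = w"
    unfolding phi_def
  proof (rule the_equality)
    show "w \<in> tangent_space S p \<and> (\<forall>u\<in>tangent_space S p. ext_deriv S (eta S) p u v = 2 * riem S p u w)"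
      using wT w iff by blast
    fix z assume "z \<in> tangent_space S p \<and> (\<forall>u\<in>tangent_space S p. ext_deriv S (eta S) p u v = 2 * riem S p u z)"
    then have z: "z \<in> tangent_space S p" "\<And>u. u \<in> tangent_space S p \<Longrightarrow> dF p z \<bullet> dF p u = - (J (dF p v) \<bullet> dF p u)"
      using iff by blast+
    have "z c = w c"
    proof (rule L.D_inner_eqI[OF xU])
      fix e
      show "L.D ?x (z c) \<bullet> L.D ?x e = L.D ?x (w c) \<bullet> L.D ?x e"
        using z(2)[OF coord_field_in[OF cp, of e]] w[OF coord_field_in[OF cp, of e]]
        by (simp add: cp dF_eq[OF cp z(1)] dF_eq[OF cp wT])
    qed
    then show "z = w" using tangent_eqI[OF z(1) wT cp] by simp
  qed
  then show "phi S p v \<in> tangent_space S p"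
    and "\<And>u. u \<in> tangent_space S p \<Longrightarrow> dF p (phi S p v) \<bullet> dF p u = - (J (dF p v) \<bullet> dF p u)"
    using wT w by auto
qed

lemma F_dF: "p \<in> points S \<Longrightarrow> v \<in> tangent_space S p \<Longrightarrow> F p \<bullet> dF p v = 0"
proof -
  assume p: "p \<in> points S" and v: "v \<in> tangent_space S p"
  define c where "c = chart_at S p"
  have cp: "c \<in> charts_at S p" unfolding c_def by (rule chart_at[OF p])
  note c = charts_at_D(1,2)[OF cp]
  let ?x = "snd c p" and ?f = "F \<circ> chart_inv c"
  interpret L: local_immersion "snd c ` fst c" ?f by (rule interp[OF c(1)])
  have xU: "?x \<in> snd c ` fst c" using c by simp
  have "((\<lambda>y. ?f y \<bullet> ?f y) has_derivative (\<lambda>v. ?f ?x \<bullet> L.D ?x v + L.D ?x v \<bullet> ?f ?x)) (at ?x)"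
    by (intro has_derivative_inner L.has_derivative_f xU)
  then have "?f ?x \<bullet> L.D ?x (v c) + L.D ?x (v c) \<bullet> ?f ?x = 0"
    by (rule has_derivative_const_on_open[where c=1, OF atlasD(2)[OF c(1)] xU]) (use c(1) atlasD(4)[OF c(1)] unit_F in auto)
  then show ?thesis using c by (simp add: dF_eq[OF cp v] inner_commute)
qed

lemma dF_add: "p \<in> points S \<Longrightarrow> v \<in> tangent_space S p \<Longrightarrow> w \<in> tangent_space S p \<Longrightarrow> dF p (v + w) = dF p v + dF p w"
  and dF_scale: "p \<in> points S \<Longrightarrow> v \<in> tangent_space S p \<Longrightarrow> dF p (r *\<^sub>R v) = r *\<^sub>R dF p v"
proof -
  assume p: "p \<in> points S" and v: "v \<in> tangent_space S p"
  define c where "c = chart_at S p"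
  have cp: "c \<in> charts_at S p" unfolding c_def by (rule chart_at[OF p])
  note c = charts_at_D(1,2)[OF cp]
  interpret L: local_immersion "snd c ` fst c" "F \<circ> chart_inv c" by (rule interp[OF c(1)])
  have lin: "linear (L.D (snd c p))" by (rule L.linear_D) (use c in simp)
  show "dF p (r *\<^sub>R v) = r *\<^sub>R dF p v"
    unfolding dF_eq[OF cp tangent_scale[OF v]] dF_eq[OF cp v] by (simp add: scaleR_fun_def linear_scale[OF lin])
  assume w: "w \<in> tangent_space S p"
  show "dF p (v + w) = dF p v + dF p w"
    by (simp add: dF_eq[OF cp tangent_add[OF v w]] dF_eq[OF cp v] dF_eq[OF cp w] linear_add[OF lin])
qed

text \<open>Compatibility of \<open>g\<close> and \<open>\<phi>\<close> forces \<open>J (dF v)\<close> to have no component normal to the cone.\<close>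

lemma J_dF:
  assumes p: "p \<in> points S" and v: "v \<in> tangent_space S p"
  shows "J (dF p v) = - dF p (phi S p v) - eta S p v *\<^sub>R F p"
proof -
  let ?w = "phi S p v"
  have w: "?w \<in> tangent_space S p" by (rule phi_eq(1)[OF p v])
  \<comment> \<open>The component of \<open>J (dF p v)\<close> normal to the cone. By Pythagoras its
    squared length is \<open>riem S p v v - riem S p ?w ?w - (eta S p v)\<^sup>2\<close>, which
    \<open>compat\<close> makes zero.\<close>
  define r where "r = J (dF p v) + dF p ?w + eta S p v *\<^sub>R F p"
  have 1: "dF p ?w \<bullet> dF p ?w = - (J (dF p v) \<bullet> dF p ?w)" by (rule phi_eq(2)[OF p v w])
  have 2: "dF p ?w \<bullet> dF p ?w = dF p v \<bullet> dF p v - (eta S p v)\<^sup>2"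
    using compat[OF p v] by (simp add: g_eq p v w)
  have 3: "J (dF p v) \<bullet> F p = - eta S p v" "F p \<bullet> J (dF p v) = - eta S p v"
    using eta_eq[OF p v] by (simp_all add: inner_J_left[of "F p"] inner_commute)
  have 4: "F p \<bullet> dF p ?w = 0" "dF p ?w \<bullet> F p = 0" using F_dF[OF p w] by (simp_all add: inner_commute)
  have 5: "J (dF p v) \<bullet> dF p ?w = - (dF p v \<bullet> dF p v - (eta S p v)\<^sup>2)" "dF p ?w \<bullet> J (dF p v) = - (dF p v \<bullet> dF p v - (eta S p v)\<^sup>2)"
    using 1 2 by (simp_all add: inner_commute)
  have "r \<bullet> r = 0"
    by (simp add: r_def inner_add_left inner_add_right 2 3 4 5 unit_F[OF p] power2_eq_square)
  then have "r = 0" by simp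
  moreover have "J (dF p v) = r - dF p ?w - eta S p v *\<^sub>R F p" by (simp add: r_def)
  ultimately show ?thesis by simp
qed

text \<open>Applying \<open>J\<close> to \<open>J_dF\<close> brings in \<open>J (F p)\<close> with
  the coefficient \<open>eta S p v\<close>, so one can solve for it wherever this is not zero. The
  multiple of \<open>F p\<close> that also appears vanishes, as \<open>J (F p)\<close> is orthogonal
  to \<open>F p\<close>.\<close>

lemma J_F:
  assumes p: "p \<in> points S"
  shows "\<exists>w\<in>tangent_space S p. J (F p) = dF p w"
proof -
  obtain v where v: "v \<in> tangent_space S p" "eta S p v \<noteq> 0" using eta_ne[OF p] by blast
  let ?s = "eta S p v" and ?w = "phi S p v"
  have w: "?w \<in> tangent_space S p" by (rule phi_eq(1)[OF p v(1)])
  let ?z = "phi S p ?w"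
  have z: "?z \<in> tangent_space S p" by (rule phi_eq(1)[OF p w])
  have "J (J (dF p v)) = - J (dF p ?w) - ?s *\<^sub>R J (F p)"
    unfolding J_dF[OF p v(1)] by (simp add: J_simps)
  then have eq: "?s *\<^sub>R J (F p) = dF p v + dF p ?z + eta S p ?w *\<^sub>R F p"
    unfolding J_dF[OF p w] by (simp add: algebra_simps)
  have "eta S p ?w = F p \<bullet> (?s *\<^sub>R J (F p))"
    unfolding eq using F_dF[OF p v(1)] F_dF[OF p z] unit_F[OF p] by (simp add: inner_add_right)
  also have "\<dots> = 0" by simp
  finally have "?s *\<^sub>R J (F p) = dF p (v + ?z)" using eq by (simp add: dF_add p v z)
  moreover have "J (F p) = (1 / ?s) *\<^sub>R (?s *\<^sub>R J (F p))" using v by simp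
  ultimately have "J (F p) = dF p ((1 / ?s) *\<^sub>R (v + ?z))"
    using dF_scale[OF p tangent_add[OF v(1) z], of "1 / ?s"] by simp
  then show ?thesis using tangent_scale[OF tangent_add[OF v(1) z]] by blast
qed

section \<open>Constancy of the tangent spaces of the cone\<close>

text \<open>\<open>complex_cone.V\<close> without reference to a chart, so that it can be compared
  at distant points.\<close>

definition VV :: "'a \<Rightarrow> 'h set" where "VV p = {dF p v + s *\<^sub>R F p | v s. v \<in> tangent_space S p}"

lemma complex_cone:
  assumes c: "c \<in> atlas S" and U: "open U" "U \<subseteq> snd c ` fst c"
  shows "complex_cone U (F \<circ> chart_inv c) J"
proof -
  interpret L: local_immersion U "F \<circ> chart_inv c" by (rule local_immersion[OF c U])
  show ?thesis
  proof
    fix x assume "x \<in> U"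
    then obtain p where p: "p \<in> fst c" "x = snd c p" using U by auto
    have cp: "c \<in> charts_at S p" by (rule charts_atI[OF c p(1)])
    have pS: "p \<in> points S" by (rule charts_at_D(3)[OF cp])
    have [simp]: "F (chart_inv c x) = F p" using c p by simp
    show "(F \<circ> chart_inv c) x \<bullet> (F \<circ> chart_inv c) x = 1" using unit_F[OF pS] by simp
    show "\<exists>w. J ((F \<circ> chart_inv c) x) = L.D x w" using J_F[OF pS] dF_eq[OF cp] p c by auto
    show "\<exists>w s. J (L.D x v) = L.D x w + s *\<^sub>R (F \<circ> chart_inv c) x" for v
    proof -
      let ?v = "coord_field S c v p"
      have v: "?v \<in> tangent_space S p" by (rule coord_field_in[OF cp])
      define u where "u = (-1) *\<^sub>R phi S p ?v"
      have u: "u \<in> tangent_space S p" unfolding u_def by (rule tangent_scale[OF phi_eq(1)[OF pS v]])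
      have "dF p u = - dF p (phi S p ?v)"
        unfolding u_def dF_scale[OF pS phi_eq(1)[OF pS v]] by simp
      then have "J (dF p ?v) = dF p u + (- eta S p ?v) *\<^sub>R F p"
        using J_dF[OF pS v] by simp
      then have "J (L.D x v) = L.D x (u c) + (- eta S p ?v) *\<^sub>R (F \<circ> chart_inv c) x"
        unfolding dF_coord_field[OF cp] dF_eq[OF cp u] p(2) using c p(1) by simp
      then show ?thesis by blast
    qed
  qed
qed

lemma VV_eq:
  assumes cp: "c \<in> charts_at S p"
  shows "VV p = complex_cone.V (F \<circ> chart_inv c) (snd c p)"
proof -
  note c = charts_at_D(1,2)[OF cp]
  interpret C: complex_cone "snd c ` fst c" "F \<circ> chart_inv c" J
    by (rule complex_cone[OF c(1) atlasD(2)[OF c(1)] subset_refl])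
  have f: "(F \<circ> chart_inv c) (snd c p) = F p" using c by simp
  show ?thesis
  proof (intro set_eqI iffI)
    fix h assume "h \<in> VV p"
    then obtain v s where v: "v \<in> tangent_space S p" "h = dF p v + s *\<^sub>R F p" by (auto simp: VV_def)
    show "h \<in> C.V (snd c p)" unfolding C.V_def f v(2) dF_eq[OF cp v(1)] by blast
  next
    fix h assume "h \<in> C.V (snd c p)"
    then obtain w s where "h = C.D (snd c p) w + s *\<^sub>R F p" unfolding C.V_def f by blast
    then have "h = dF p (coord_field S c w p) + s *\<^sub>R F p" by (simp add: cp)
    then show "h \<in> VV p" unfolding VV_def using coord_field_in[OF cp] by blast
  qed
qed

text \<open>The Einstein condition makes \<alpha> vanish at \<open>p\<close> in the chart
  \<open>c0\<close> chosen there. A change of chart alters second derivatives of the immersion only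
  by first derivatives, which lie in \<open>VV p\<close> anyway; so the conclusion holds in every
  chart around \<open>p\<close>.\<close>

lemma second_derivative_in_VV:
  assumes cp: "c \<in> charts_at S p"
  shows "D2c c (snd c p) a b \<in> VV p"
proof -
  define c0 where "c0 = chart_at S p"
  have pS: "p \<in> points S" by (rule charts_at_D(3)[OF cp])
  have c0p: "c0 \<in> charts_at S p" unfolding c0_def by (rule chart_at[OF pS])
  note c = charts_at_D(1,2)[OF cp] and c0 = charts_at_D(1,2)[OF c0p]
  let ?x = "snd c p" and ?z = "snd c0 p"
  let ?U = "snd c ` (fst c \<inter> fst c0)"
  let ?Uz = "snd c0 ` (fst c0 \<inter> fst c)"
  have U: "open ?U" "?x \<in> ?U" "open ?Uz" "?z \<in> ?Uz"
    using c c0 by (auto intro!: open_chart_image atlasD(1))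
  interpret L: local_immersion "snd c ` fst c" "F \<circ> chart_inv c" by (rule interp[OF c(1)])
  interpret C: complex_cone "snd c0 ` fst c0" "F \<circ> chart_inv c0" J
    by (rule complex_cone[OF c0(1) atlasD(2)[OF c0(1)] subset_refl])
  have x0: "?z \<in> snd c0 ` fst c0" and x: "?x \<in> snd c ` fst c" using c c0 by auto
  obtain l where l: "\<And>v. v \<in> tangent_space S p \<Longrightarrow> ricci S (riem S) p v v = l * riem S p v v"
    using einstein pS by blast
  have "C.ric ?z d = l * (C.D ?z d \<bullet> C.D ?z d)" for d
    using l[OF coord_field_in[OF c0p, of d]] ricci_eq[OF pS coord_field_in[OF c0p, of d] c0_def]
    by (simp add: C.ric_def c0p g_eq pS)
  then have flat: "C.\<alpha> ?z a b = 0" for a b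
    by (rule C.einstein_imp_totally_geodesic[OF x0 dim_model])
  then have D2V: "C.D2 ?z a b \<in> C.V ?z" for a b
    by (simp add: C.Q_eq_0_iff[OF x0, symmetric] C.\<alpha>_def)
  \<comment> \<open>The components in \<open>c0\<close> of the field whose components in
    \<open>c\<close> are constantly \<open>a\<close>.\<close>
  define W where "W z = frechet_derivative (snd c0 \<circ> chart_inv c) (at ((snd c \<circ> chart_inv c0) z)) a" for z
  have "smooth_on ?Uz W"
    unfolding W_def
    by (rule smooth_on_compose[OF U(3,1) _ smooth_transition[OF c0(1) c(1)],
          where g="\<lambda>y. frechet_derivative (snd c0 \<circ> chart_inv c) (at y) a"])
      (use c c0 smooth_on_frechet[OF smooth_transition[OF c(1) c0(1)]] in auto)
  then have dW: "(W has_derivative frechet_derivative W (at ?z)) (at ?z)"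
    using U(4) by (rule smooth_on_has_derivative)
  let ?E' = "\<lambda>v. C.D2 ?z (W ?z) v + C.D ?z (frechet_derivative W (at ?z) v)"
  have dE: "((\<lambda>z. C.D z (W z)) has_derivative ?E') (at ?z)"
    by (rule C.has_derivative_D_field[OF x0 dW])
  have tr: "(snd c0 \<circ> chart_inv c) ?x = ?z" using c by simp
  have "((\<lambda>y. C.D ((snd c0 \<circ> chart_inv c) y) (W ((snd c0 \<circ> chart_inv c) y))) has_derivative (\<lambda>v. ?E' (trans c c0 p v))) (at ?x)"
    by (rule has_derivative_compose[OF has_derivative_transition[OF cp c0p], where g="\<lambda>z. C.D z (W z)"])
      (simp only: tr dE)
  then have "((\<lambda>y. L.D y a) has_derivative (\<lambda>v. ?E' (trans c c0 p v))) (at ?x)"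
  proof (rule has_derivative_transform_within_open[OF _ U(1,2)])
    fix y assume "y \<in> ?U"
    then obtain r where r: "r \<in> fst c" "r \<in> fst c0" "y = snd c r" by auto
    have cr: "c \<in> charts_at S r" "c0 \<in> charts_at S r" using r c c0 by (auto intro: charts_atI)
    have "((F \<circ> chart_inv c0) has_derivative C.D (snd c0 r)) (at (snd c0 r))"
      by (rule C.has_derivative_f) (use r in simp)
    from chart_change[OF cr this]
    have "L.D (snd c r) a = C.D (snd c0 r) (trans c c0 r a)"
      by (simp add: L.D_def frechet_derivative_eqI)
    then show "C.D ((snd c0 \<circ> chart_inv c) y) (W ((snd c0 \<circ> chart_inv c) y)) = L.D y a"
      using r c c0 by (simp add: W_def trans_def)
  qed
  then have "L.D2 ?x a b = ?E' (trans c c0 p b)"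
    by (simp add: L.D2_def frechet_derivative_eqI)
  then show ?thesis
    unfolding VV_eq[OF c0p] using C.subspace_V[OF x0] D2V C.D_in_V[OF x0] by (simp add: subspace_add)
qed

text \<open>On a ball inside a single chart domain \<alpha> vanishes everywhere by
  \<open>second_derivative_in_VV\<close>, and a ball is connected, as \<open>V_constant\<close>
  requires.\<close>

lemma VV_locally_constant:
  assumes p: "p \<in> points S"
  obtains N where "openin (mtop S) N" "p \<in> N" "\<And>q. q \<in> N \<Longrightarrow> VV q = VV p"
proof -
  define c where "c = chart_at S p"
  have cp: "c \<in> charts_at S p" unfolding c_def by (rule chart_at[OF p])
  note c = charts_at_D(1,2)[OF cp]
  have "snd c p \<in> snd c ` fst c" using c by simp
  then obtain e where e: "e > 0" "ball (snd c p) e \<subseteq> snd c ` fst c"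
    using atlasD(2)[OF c(1)] open_contains_ball by blast
  let ?B = "ball (snd c p) e"
  interpret C: complex_cone ?B "F \<circ> chart_inv c" J by (rule complex_cone[OF c(1) _ e(2)]) simp
  have ch: "c \<in> charts_at S (chart_inv c x)" "snd c (chart_inv c x) = x" if "x \<in> ?B" for x
    using chart_chart_inv[of x c] subsetD[OF e(2) that] c(1) by (auto intro: charts_atI)
  have "C.\<alpha> x a b = 0" if x: "x \<in> ?B" for x a b
    using second_derivative_in_VV[OF ch(1)[OF x], of a b] C.Q_V[OF x]
    by (simp add: VV_eq[OF ch(1)[OF x]] ch(2)[OF x] C.\<alpha>_def)
  then have "C.V x = C.V (snd c p)" if "x \<in> ?B" for x
    using C.V_constant[of x "snd c p"] that e by simp
  then have "VV (chart_inv c x) = VV p" if "x \<in> ?B" for x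
    using that by (simp add: VV_eq[OF ch(1)[OF that]] ch(2)[OF that] VV_eq[OF cp])
  then show thesis
    using that[of "chart_inv c ` ?B"] openin_chart_preimage[OF c(1) _ e(2)] e c
    by (metis (no_types, lifting) centre_in_ball chart_inv_chart imageE image_eqI open_ball)
qed

text \<open>As \<open>VV\<close> is locally constant, the set where it takes a given value and the
  complement are both open; connectedness leaves a single value. It contains the image because
  \<open>F p\<close> belongs to \<open>VV p\<close>.\<close>

theorem image_in_complex_subspace:
  obtains W where "subspace W" "\<And>v. v \<in> W \<Longrightarrow> J v \<in> W" "dim W = 2 * n + 2"
    "\<And>p. p \<in> points S \<Longrightarrow> F p \<in> W" "\<And>p v. p \<in> points S \<Longrightarrow> v \<in> tangent_space S p \<Longrightarrow> dF p v \<in> W"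
proof -
  obtain p where p: "p \<in> points S" using connected by blast
  let ?A = "{q \<in> points S. VV q = VV p}" and ?B = "{q \<in> points S. VV q \<noteq> VV p}"
  have op: "openin (mtop S) {q \<in> points S. P (VV q)}" for P
  proof (subst openin_subopen, safe)
    fix q assume q: "q \<in> points S" "P (VV q)"
    obtain N where N: "openin (mtop S) N" "q \<in> N" "\<And>r. r \<in> N \<Longrightarrow> VV r = VV q"
      using VV_locally_constant[OF q(1)] by blast
    have "N \<subseteq> {q \<in> points S. P (VV q)}"
    proof
      fix r assume r: "r \<in> N"
      then show "r \<in> {q \<in> points S. P (VV q)}"
        using openin_subset[OF N(1)] q(2) by (simp only: mem_Collect_eq N(3)[OF r]) blast
    qed
    then show "\<exists>T. openin (mtop S) T \<and> q \<in> T \<and> T \<subseteq> {q \<in> points S. P (VV q)}"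
      using N(1,2) by blast
  qed
  have "openin (mtop S) ?A" "openin (mtop S) ?B"
    using op[of "\<lambda>X. X = VV p"] op[of "\<lambda>X. X \<noteq> VV p"] by simp_all
  moreover have "points S \<subseteq> ?A \<union> ?B" "?A \<inter> ?B = {}" "?A \<noteq> {}" using p by auto
  ultimately have "?B = {}"
    using connected(1) unfolding connected_space_def by meson
  then have const: "VV q = VV p" if "q \<in> points S" for q using that by blast
  define c where "c = chart_at S p"
  have cp: "c \<in> charts_at S p" unfolding c_def by (rule chart_at[OF p])
  note c = charts_at_D(1,2)[OF cp]
  interpret C: complex_cone "snd c ` fst c" "F \<circ> chart_inv c" J
    by (rule complex_cone[OF c(1) atlasD(2)[OF c(1)] subset_refl])
  have x: "snd c p \<in> snd c ` fst c" using c by simp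
  show thesis
  proof (rule that[of "VV p"])
    show "subspace (VV p)" "\<And>v. v \<in> VV p \<Longrightarrow> J v \<in> VV p" "dim (VV p) = 2 * n + 2"
      unfolding VV_eq[OF cp] using C.subspace_V[OF x] C.J_V[OF x] C.ric_eq(2)[OF x dim_model] by auto
    fix q assume q: "q \<in> points S"
    have zT: "0 \<in> tangent_space S q"
      using coord_field_in[OF chart_at[OF q], of 0] by (simp add: coord_field_0[OF chart_at[OF q]])
    have z: "0 \<in> tangent_space S q" "dF q 0 = 0"
      using zT dF_scale[OF q zT, of 0] by simp_all
    have "dF q 0 + 1 *\<^sub>R F q \<in> VV q" unfolding VV_def using z(1) by blast
    then show "F q \<in> VV p" using const[OF q] z(2) by simp
    fix v assume "v \<in> tangent_space S q"
    then have "dF q v + 0 *\<^sub>R F q \<in> VV q" unfolding VV_def by blast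
    then show "dF q v \<in> VV p" using const[OF q] by simp
  qed
qed

end

section \<open>Compact local homeomorphisms onto simply connected spaces\<close>

text \<open>By compactness the fibre over \<open>y\<close> is finite. Small disjoint balls around
  its points carry the sheets, and near \<open>y\<close> there are no other preimages, since the
  rest of \<open>T\<close> has a compact image that misses \<open>y\<close>.\<close>

lemma compact_local_homeomorphism_imp_covering_space:
  fixes q :: "'a::real_normed_vector \<Rightarrow> 'b::real_normed_vector"
  assumes T: "compact T" and cont: "continuous_on T q" and surj: "q ` T = \<Sigma>"
    and inj: "\<And>t. t \<in> T \<Longrightarrow> \<exists>r>0. inj_on q (T \<inter> ball t r)"
    and opn: "\<And>W. openin (top_of_set T) W \<Longrightarrow> openin (top_of_set \<Sigma>) (q ` W)"
  shows "covering_space T q \<Sigma>"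
proof
  fix y assume y: "y \<in> \<Sigma>"
  obtain r where r: "\<And>t. t \<in> T \<Longrightarrow> r t > 0 \<and> inj_on q (T \<inter> ball t (r t))" using inj by metis
  define K where "K = {t \<in> T. q t = y}"
  have "closedin (top_of_set T) K"
    using continuous_closedin_preimage[OF cont closed_singleton[of y]] by (simp add: K_def vimage_def Int_def)
  then have "compact K" using T closedin_compact by blast
  then obtain D where D: "D \<subseteq> K" "finite D" "K \<subseteq> (\<Union>t\<in>D. ball t (r t))"
    using compactE_image[of K K "\<lambda>t. ball t (r t)"] r by (force simp: K_def)
  \<comment> \<open>As \<open>q\<close> is injective on each of the balls, the only fibre point
    inside is the centre; the centres of a finite cover exhaust the fibre.\<close>
  have "K \<subseteq> D"
  proof
    fix s assume s: "s \<in> K"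
    then obtain t where t: "t \<in> D" "s \<in> ball t (r t)" using D by blast
    have "t \<in> T" "s \<in> T" "q s = q t" "t \<in> ball t (r t)" using D s t r by (auto simp: K_def)
    then have "s = t" using r[of t] t(2) by (auto dest!: inj_onD)
    then show "s \<in> D" using t by simp
  qed
  then have fin: "finite K" using D finite_subset by blast
  have ne: "K \<noteq> {}" using y surj by (auto simp: K_def)
  \<comment> \<open>The radii \<open>r\<close> secure injectivity, the halved distances make the
    balls disjoint, and the entry 1 keeps the set non-empty.\<close>
  define E where "E = insert 1 (r ` K \<union> (\<lambda>(s, t). dist s t / 2) ` {(s, t). s \<in> K \<and> t \<in> K \<and> s \<noteq> t})"
  have "finite {(s, t). s \<in> K \<and> t \<in> K \<and> s \<noteq> t}"
    by (rule finite_subset[of _ "K \<times> K"]) (use fin in auto)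
  then have finE: "finite E" using fin by (simp add: E_def)
  define e where "e = Min E"
  have e: "e > 0" unfolding e_def using finE r by (subst Min_gr_iff) (auto simp: E_def K_def)
  have e_r: "e \<le> r t" if "t \<in> K" for t
    unfolding e_def using finE that by (intro Min_le) (auto simp: E_def)
  have e_d: "2 * e \<le> dist s t" if "s \<in> K" "t \<in> K" "s \<noteq> t" for s t
  proof -
    have "e \<le> dist s t / 2" unfolding e_def using finE that by (intro Min_le) (auto simp: E_def)
    then show ?thesis by simp
  qed
  have disj: "ball s e \<inter> ball t e = {}" if "s \<in> K" "t \<in> K" "s \<noteq> t" for s t
  proof -
    have "False" if "z \<in> ball s e" "z \<in> ball t e" for z
      using e_d[OF \<open>s \<in> K\<close> \<open>t \<in> K\<close> \<open>s \<noteq> t\<close>] that dist_triangle2[of s t z] by (simp add: dist_commute)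
    then show ?thesis by blast
  qed
  define B where "B t = T \<inter> ball t e" for t
  have B: "openin (top_of_set T) (B t)" for t by (simp add: B_def openin_open_Int)
  have injB: "inj_on q (B t)" if "t \<in> K" for t
    using r[of t] that e_r[OF that] by (auto simp: B_def K_def intro: inj_on_subset)
  let ?C = "T - (\<Union>t\<in>K. ball t e)"
  have "compact (T \<inter> - (\<Union>t\<in>K. ball t e))" by (intro compact_Int_closed T) (simp add: closed_def open_UN)
  moreover have "T \<inter> - (\<Union>t\<in>K. ball t e) = ?C" by auto
  ultimately have "compact ?C" by simp
  then have "compact (q ` ?C)" using cont by (intro compact_continuous_image) (auto intro: continuous_on_subset)
  then have closC: "closed (q ` ?C)" by (rule compact_imp_closed)
  \<comment> \<open>Each sheet maps onto \<open>N\<close>, and all preimages of \<open>N\<close> lie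
    in sheets, because images of points outside the balls are removed.\<close>
  define N where "N = (\<Inter>t\<in>K. q ` B t) \<inter> - q ` ?C"
  have N: "openin (top_of_set \<Sigma>) N"
  proof -
    have 1: "openin (top_of_set \<Sigma>) (\<Inter>t\<in>K. q ` B t)"
      using fin ne opn[OF B] by (intro openin_INT2) auto
    have "openin (top_of_set \<Sigma>) (\<Sigma> \<inter> - q ` ?C)"
      using closC by (intro openin_open_Int) (simp add: closed_def)
    with 1 have "openin (top_of_set \<Sigma>) ((\<Inter>t\<in>K. q ` B t) \<inter> (\<Sigma> \<inter> - q ` ?C))"
      by (rule openin_Int)
    moreover have "(\<Inter>t\<in>K. q ` B t) \<inter> (\<Sigma> \<inter> - q ` ?C) = N"
      using openin_subset[OF 1] by (auto simp: N_def)
    ultimately show ?thesis by simp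
  qed
  have yN: "y \<in> N"
  proof -
    have "y \<in> q ` B t" if "t \<in> K" for t using that e by (auto simp: B_def K_def)
    moreover have "y \<notin> q ` ?C"
    proof
      assume "y \<in> q ` ?C"
      then obtain s where s: "s \<in> T" "s \<notin> (\<Union>t\<in>K. ball t e)" "q s = y" by auto
      then have "s \<in> K" by (simp add: K_def)
      with s(2) e show False by auto
    qed
    ultimately show ?thesis by (auto simp: N_def)
  qed
  define v where "v = (\<lambda>t. B t \<inter> q -` N) ` K"
  have preN: "openin (top_of_set T) (T \<inter> q -` N)"
    using continuous_openin_preimage[OF cont _ N] surj by auto
  have sheet: "openin (top_of_set T) (B t \<inter> q -` N)" for t
  proof -
    have "B t \<inter> q -` N = B t \<inter> (T \<inter> q -` N)" by (auto simp: B_def)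
    then show ?thesis using B preN by (simp add: openin_Int)
  qed
  show "\<exists>N. y \<in> N \<and> openin (top_of_set \<Sigma>) N \<and> (\<exists>v. \<Union>v = T \<inter> q -` N \<and>
      (\<forall>u\<in>v. openin (top_of_set T) u) \<and> pairwise disjnt v \<and> (\<forall>u\<in>v. \<exists>g. homeomorphism u N q g))"
  proof (intro exI[of _ N] exI[of _ v] conjI ballI)
    show "\<Union>v = T \<inter> q -` N"
    proof (intro set_eqI iffI)
      fix s assume "s \<in> T \<inter> q -` N"
      then have "s \<in> T" "q s \<in> N" by auto
      then have "s \<notin> ?C" by (auto simp: N_def)
      then show "s \<in> \<Union>v" using \<open>s \<in> T\<close> \<open>q s \<in> N\<close> by (auto simp: v_def B_def)
    qed (auto simp: v_def B_def)
    show "pairwise disjnt v"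
      using disj by (fastforce simp: v_def pairwise_def disjnt_def B_def)
    fix u assume "u \<in> v"
    then obtain t where t: "t \<in> K" "u = B t \<inter> q -` N" by (auto simp: v_def)
    show "openin (top_of_set T) u" unfolding t by (rule sheet)
    have uT: "u \<subseteq> T" by (auto simp: t B_def)
    have "\<exists>g. homeomorphism u N q g"
    proof (rule homeomorphism_injective_open_map[of u q N])
      show "continuous_on u q" using cont uT by (rule continuous_on_subset)
      show "q ` u = N"
      proof -
        have "N \<subseteq> q ` B t" using t(1) by (auto simp: N_def)
        then show ?thesis unfolding t(2) by blast
      qed
      show "inj_on q u" using injB[OF t(1)] by (rule inj_on_subset) (auto simp: t)
      show "openin (top_of_set N) (q ` W)" if W: "openin (top_of_set u) W" for W
      proof -
        have "openin (top_of_set T) W" using W sheet[of t] unfolding t(2) by (rule openin_trans)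
        then have "openin (top_of_set \<Sigma>) (q ` W)" by (rule opn)
        moreover have "q ` W \<subseteq> N" using openin_subset[OF W] t(2) by auto
        ultimately show ?thesis using openin_subset[OF N] by (auto intro: openin_subset_trans)
      qed
    qed blast
    then show "\<exists>g. homeomorphism u N q g" .
  qed (use yN N in auto)
qed (use cont surj in auto)

text \<open>Simple connectedness provides a section \<open>g\<close> of \<open>q\<close> through
  \<open>a\<close>. Both \<open>g \<circ> q\<close> and the identity are lifts of \<open>q\<close>,
  and they agree at \<open>a\<close>, hence on the connected set \<open>T\<close>.\<close>

lemma covering_space_simply_connected_injective:
  fixes q :: "'a::real_normed_vector \<Rightarrow> 'b::real_normed_vector"
  assumes cov: "covering_space T q \<Sigma>" and T: "connected T"
    and \<Sigma>: "simply_connected \<Sigma>" "locally path_connected \<Sigma>"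
  shows "inj_on q T"
proof (cases "T = {}")
  case False
  then obtain a where a: "a \<in> T" by blast
  have qT: "q ` T = \<Sigma>" and cq: "continuous_on T q"
    using cov covering_space_imp_surjective covering_space_imp_continuous by blast+
  obtain g where g: "continuous_on \<Sigma> g" "g \<in> \<Sigma> \<rightarrow> T" "g (q a) = a" "\<And>y. y \<in> \<Sigma> \<Longrightarrow> q (g y) = y"
    using covering_space_lift_strong[OF cov a _ \<Sigma>, of "q a" "\<lambda>y. y"] a qT by (auto simp: continuous_on_id)
  have "g (q x) = x" if x: "x \<in> T" for x
  proof (rule covering_space_lift_unique[OF cov, of "\<lambda>x. g (q x)" a "\<lambda>x. x" T q])
    show "continuous_on T (\<lambda>x. g (q x))"
      using g(1) cq by (rule continuous_on_compose2) (use qT in auto)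
  qed (use g a x T qT cq in auto)
  then show ?thesis by (metis inj_onI)
qed simp

lemma apply_bcontfun_sum: "apply_bcontfun (\<Sum>i\<in>I. f i) x = (\<Sum>i\<in>I. apply_bcontfun (f i) x)"
  by (induction I rule: infinite_finite_induct) simp_all

text \<open>The covering space library works with subsets of normed spaces, hence \<open>X\<close> is embedded
  over \<open>\<Sigma>\<close> into a normed space, by finitely many Urysohn functions.\<close>

theorem compact_local_homeomorphism_imp_homeomorphic_map:
  fixes G :: "'a \<Rightarrow> 'b::euclidean_space"
  assumes X: "compact_space X" "Hausdorff_space X" "connected_space X" "topspace X \<noteq> {}"
    and cont: "continuous_map X (top_of_set \<Sigma>) G"
    and inj: "\<And>p. p \<in> topspace X \<Longrightarrow> \<exists>N. openin X N \<and> p \<in> N \<and> inj_on G N"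
    and opn: "\<And>W. openin X W \<Longrightarrow> openin (top_of_set \<Sigma>) (G ` W)"
    and \<Sigma>: "simply_connected \<Sigma>" "locally path_connected \<Sigma>"
  shows "homeomorphic_map X (top_of_set \<Sigma>) G"
proof -
  let ?X = "topspace X"
  \<comment> \<open>The image is open by \<open>opn\<close>, closed by compactness and not empty,
    and \<Sigma> is connected.\<close>
  have surj: "G ` ?X = \<Sigma>"
  proof -
    have 1: "openin (top_of_set \<Sigma>) (G ` ?X)" by (rule opn) simp
    have "compactin (top_of_set \<Sigma>) (G ` ?X)"
      using X(1) cont image_compactin unfolding compact_space_def by blast
    then have "compact (G ` ?X)" by (simp add: compactin_subtopology)
    then have "closedin (top_of_set \<Sigma>) (G ` ?X)"
      using openin_subset[OF 1] by (auto intro: closed_subset compact_imp_closed)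
    moreover have "connected \<Sigma>" using \<Sigma>(1) simply_connected_imp_connected by blast
    ultimately show ?thesis using 1 X(4) by (metis connected_clopen image_is_empty)
  qed
  have "\<exists>N \<rho>. openin X N \<and> inj_on G N \<and> continuous_map X euclideanreal \<rho> \<and> \<rho> p = 1 \<and> (\<forall>x\<in>?X - N. \<rho> x = 0)"
    if p: "p \<in> ?X" for p
  proof -
    obtain N where N: "openin X N" "p \<in> N" "inj_on G N" using inj[OF p] by blast
    have "normal_space X" using X(1,2) compact_Hausdorff_or_regular_imp_normal_space by blast
    moreover have "closedin X (?X - N)" using N(1) by blast
    moreover have "closedin X {p}" using X(2) p by (simp add: closedin_Hausdorff_singleton)
    moreover have "disjnt (?X - N) {p}" using N(2) by simp
    ultimately obtain \<rho> where "continuous_map X (top_of_set {0..1::real}) \<rho>" "\<rho> ` (?X - N) \<subseteq> {0}" "\<rho> ` {p} \<subseteq> {1}"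
      using Urysohn_lemma[of X "?X - N" "{p}" 0 1] by auto
    then show ?thesis using N by (intro exI[of _ N] exI[of _ \<rho>]) (auto simp: continuous_map_in_subtopology)
  qed
  then obtain N \<rho> where N: "\<And>p. p \<in> ?X \<Longrightarrow> openin X (N p)" "\<And>p. p \<in> ?X \<Longrightarrow> inj_on G (N p)"
    "\<And>p. p \<in> ?X \<Longrightarrow> continuous_map X euclideanreal (\<rho> p)" "\<And>p. p \<in> ?X \<Longrightarrow> \<rho> p p = (1::real)"
    "\<And>p x. p \<in> ?X \<Longrightarrow> x \<in> ?X - N p \<Longrightarrow> \<rho> p x = 0"
    by metis
  \<comment> \<open>\<open>\<rho> p\<close> is not zero on this set, so it lies in
    \<open>N p\<close>, where \<open>G\<close> is injective. Membership depends only on the value of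
    \<open>\<rho> p\<close>, which \<open>emb\<close> records; this makes \<open>emb\<close>
    injective.\<close>
  define P where "P p = {x \<in> ?X. \<rho> p x \<in> {1/2<..}}" for p
  have P: "openin X (P p)" if "p \<in> ?X" for p
    unfolding P_def by (rule openin_continuous_map_preimage[OF N(3)[OF that]]) simp
  have "?X \<subseteq> \<Union> (P ` ?X)" using N(4) by (auto simp: P_def)
  then obtain \<F> where \<F>: "finite \<F>" "\<F> \<subseteq> P ` ?X" "?X \<subseteq> \<Union>\<F>"
    using X(1) P unfolding compact_space_alt by (metis (no_types, lifting) imageE)
  then obtain A where A: "finite A" "A \<subseteq> ?X" "?X \<subseteq> \<Union> (P ` A)"
    by (metis finite_subset_image)
  obtain idx :: "'a \<Rightarrow> nat" where idx: "inj_on idx A" using A(1) finite_imp_inj_to_nat_seg by blast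
  \<comment> \<open>Unit vectors in the space of bounded sequences, which has room for any number of
    Urysohn functions; \<open>idx\<close> assigns a coordinate to each.\<close>
  define \<beta> :: "nat \<Rightarrow> nat \<Rightarrow>\<^sub>C real" where "\<beta> i = Bcontfun (\<lambda>j. if j = i then 1 else 0)" for i
  have \<beta>: "apply_bcontfun (\<beta> i) j = (if j = i then 1 else 0)" for i j
  proof -
    have "(\<lambda>j. if j = i then 1 else 0 :: real) \<in> bcontfun"
      unfolding bcontfun_def by (auto intro!: boundedI[of _ 1])
    then show ?thesis by (simp add: \<beta>_def Bcontfun_inverse)
  qed
  define b where "b x = (\<Sum>p\<in>A. \<rho> p x *\<^sub>R \<beta> (idx p))" for x
  have b: "apply_bcontfun (b x) (idx p) = \<rho> p x" if "p \<in> A" for x p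
  proof -
    have "apply_bcontfun (b x) (idx p) = (\<Sum>p'\<in>A. if p' = p then \<rho> p' x else 0)"
      unfolding b_def apply_bcontfun_sum
      by (rule sum.cong) (use idx that in \<open>auto simp: \<beta> dest: inj_onD\<close>)
    then show ?thesis using A(1) that by simp
  qed
  have contb: "continuous_map X euclidean b"
    unfolding b_def
  proof (rule continuous_map_sum[OF A(1)])
    fix p assume "p \<in> A"
    then have "continuous_map X euclideanreal (\<rho> p)" using N(3) A(2) by blast
    moreover have "continuous_map euclideanreal euclidean (\<lambda>r. r *\<^sub>R \<beta> (idx p))"
      by (simp add: continuous_map_iff_continuous2) (intro continuous_intros)
    ultimately show "continuous_map X euclidean (\<lambda>x. \<rho> p x *\<^sub>R \<beta> (idx p))"
      using continuous_map_compose[of X euclideanreal "\<rho> p" euclidean "\<lambda>r. r *\<^sub>R \<beta> (idx p)"] by (simp add: o_def)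
  qed
  define emb where "emb x = (G x, b x)" for x
  have contG: "continuous_map X euclidean G" using cont by (simp add: continuous_map_in_subtopology)
  have "continuous_map X (prod_topology euclidean euclidean) emb"
    unfolding emb_def[abs_def] by (intro continuous_map_pairedI contG contb)
  then have conte: "continuous_map X euclidean emb" by simp
  have embinj: "inj_on emb ?X"
  proof (rule inj_onI)
    fix x y assume x: "x \<in> ?X" and y: "y \<in> ?X" and "emb x = emb y"
    then have e: "G x = G y" "b x = b y" by (auto simp: emb_def)
    obtain p where p: "p \<in> A" "x \<in> P p" using A(3) x by blast
    have "\<rho> p x = \<rho> p y" using b[OF p(1)] e by metis
    then have "y \<in> P p" using p y by (simp add: P_def)
    have "z \<in> N p" if "z \<in> P p" for z using N(5)[of p z] that p A(2) by (force simp: P_def)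
    then show "x = y" using N(2)[of p] e p A(2) \<open>y \<in> P p\<close> by (meson inj_onD subsetD)
  qed
  define T where "T = emb ` ?X"
  have hom: "homeomorphic_map X (top_of_set T) emb"
  proof (rule continuous_imp_homeomorphic_map)
    show "continuous_map X (top_of_set T) emb" using conte by (simp add: continuous_map_in_subtopology T_def)
    show "Hausdorff_space (top_of_set T)" by (simp add: Hausdorff_space_subtopology)
  qed (use X embinj in \<open>auto simp: T_def\<close>)
  have "compactin euclidean T"
    using X(1) conte image_compactin unfolding compact_space_def T_def by blast
  then have cT: "compact T" by simp
  have "connectedin euclidean T"
    unfolding T_def using conte X(3) by (metis connectedin_continuous_map_image connectedin_topspace)
  then have connT: "connected T" by simp
  have openT: "\<exists>W'. openin X W' \<and> W = emb ` W'" if W: "openin (top_of_set T) W" for W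
  proof (intro exI conjI)
    show "openin X {x \<in> ?X. emb x \<in> W}"
      using homeomorphic_imp_continuous_map[OF hom] W by (rule openin_continuous_map_preimage)
    show "W = emb ` {x \<in> ?X. emb x \<in> W}" using openin_subset[OF W] by (auto simp: T_def)
  qed
  have "covering_space T fst \<Sigma>"
  proof (rule compact_local_homeomorphism_imp_covering_space[OF cT])
    show "continuous_on T fst" by (intro continuous_intros)
    show "fst ` T = \<Sigma>" unfolding T_def surj[symmetric] by (auto simp: emb_def image_image)
    show "openin (top_of_set \<Sigma>) (fst ` W)" if W: "openin (top_of_set T) W" for W
    proof -
      obtain W' where "openin X W'" "W = emb ` W'" using openT[OF W] by blast
      moreover from this have "fst ` W = G ` W'" by (auto simp: emb_def image_image)
      ultimately show ?thesis using opn by simp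
    qed
    fix t assume "t \<in> T"
    then obtain p where p: "p \<in> ?X" "t = emb p" by (auto simp: T_def)
    obtain M where M: "openin X M" "p \<in> M" "inj_on G M" using inj[OF p(1)] by blast
    have "openin (top_of_set T) (emb ` M)"
      using homeomorphic_imp_open_map[OF hom] M(1) by (simp add: open_map_def)
    then obtain r where r: "r > 0" "ball t r \<inter> T \<subseteq> emb ` M"
      using M(2) p unfolding openin_contains_ball by blast
    have "inj_on fst (emb ` M)" using M(3) by (auto simp: emb_def inj_on_def)
    then have "inj_on fst (T \<inter> ball t r)" by (rule inj_on_subset) (use r(2) in blast)
    then show "\<exists>r>0. inj_on fst (T \<inter> ball t r)" using r(1) by blast
  qed
  then have "inj_on fst T" using connT \<Sigma> by (rule covering_space_simply_connected_injective)
  then have "inj_on (fst \<circ> emb) ?X" using embinj by (simp add: comp_inj_on T_def)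
  then have "inj_on G ?X" by (simp add: emb_def o_def)
  then show ?thesis
    using cont X(1) surj by (intro continuous_imp_homeomorphic_map) (auto simp: Hausdorff_space_subtopology)
qed

section \<open>Local diffeomorphisms onto the sphere\<close>

text \<open>The injectivity criterion asks for continuity of the derivative in the operator norm. It
  follows from continuity of the finitely many partial derivatives, as the sum \<open>d y\<close>
  bounds the norm of the difference.\<close>

lemma smooth_on_locally_injective:
  fixes f :: "'a::euclidean_space \<Rightarrow> 'b::euclidean_space"
  assumes U: "open U" "x \<in> U" and f: "smooth_on U f" and inj: "inj (frechet_derivative f (at x))"
  obtains r where "r > 0" "ball x r \<subseteq> U" "inj_on f (ball x r)"
proof -
  let ?D = "\<lambda>y. frechet_derivative f (at y)"
  obtain B K where B: "bounded_linear B" "\<And>v. B (?D x v) = v" "K > 0" "\<And>y. norm (B y) \<le> K * norm y"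
    using linear_inj_left_inverse[OF smooth_on_linear[OF f U(2)] inj] by blast
  have lin: "linear (?D y)" if "y \<in> U" for y by (rule smooth_on_linear[OF f that])
  show thesis
  proof (rule has_derivative_locally_injective[OF U(2,1) B(1), of ?D f])
    show "B \<circ> ?D x = id" using B(2) by auto
    show "(f has_derivative ?D y) (at y)" if "y \<in> U" for y by (rule smooth_on_has_derivative[OF f that])
    fix e :: real assume e: "e > 0"
    define d where "d y = (\<Sum>b\<in>Basis. norm (?D y b - ?D x b))" for y
    have "continuous_on U d"
      unfolding d_def by (intro continuous_intros smooth_on_continuous smooth_on_frechet f)
    then have "isCont d x" using U by (simp add: continuous_on_eq_continuous_at)
    then have "(d \<longlongrightarrow> d x) (nhds x)" by (simp add: isCont_def tendsto_at_iff_tendsto_nhds)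
    then have "\<forall>\<^sub>F y in nhds x. d y < e" by (rule order_tendstoD(2)) (use e in \<open>simp add: d_def\<close>)
    moreover have "\<forall>\<^sub>F y in nhds x. y \<in> U" using U by (rule eventually_nhds_in_open)
    ultimately have "\<forall>\<^sub>F y in nhds x. d y < e \<and> y \<in> U" by (rule eventually_conj)
    then obtain \<delta> where \<delta>: "\<delta> > 0" "\<And>y. dist y x < \<delta> \<Longrightarrow> d y < e \<and> y \<in> U"
      unfolding eventually_nhds_metric by blast
    show "\<exists>\<delta>>0. \<forall>y. dist x y < \<delta> \<longrightarrow> onorm (\<lambda>v. ?D y v - ?D x v) < e"
    proof (intro exI conjI allI impI)
      fix y assume "dist x y < \<delta>"
      then have y: "d y < e" "y \<in> U" using \<delta>(2)[of y] by (simp_all add: dist_commute)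
      have "norm (?D y v - ?D x v) \<le> d y * norm v" for v
      proof -
        have "?D y v - ?D x v = (\<Sum>b\<in>Basis. (v \<bullet> b) *\<^sub>R (?D y b - ?D x b))"
          using linear_eq_sum_Basis[OF lin[OF y(2)], of v] linear_eq_sum_Basis[OF lin[OF U(2)], of v]
          by (simp add: sum_subtractf scaleR_diff_right)
        also have "norm \<dots> \<le> (\<Sum>b\<in>Basis. norm v * norm (?D y b - ?D x b))"
          by (intro sum_norm_le) (simp add: Basis_le_norm mult_right_mono)
        finally show ?thesis by (simp add: d_def sum_distrib_left mult.commute)
      qed
      then have "onorm (\<lambda>v. ?D y v - ?D x v) \<le> d y" by (intro onorm_le)
      then show "onorm (\<lambda>v. ?D y v - ?D x v) < e" using y(1) by simp
    qed (rule \<delta>(1))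
  qed (use that in blast)
qed

context smooth_mfd
begin

lemma locally_injective:
  fixes G :: "'a \<Rightarrow> 'b::euclidean_space"
  assumes smooth: "\<And>c. c \<in> atlas M \<Longrightarrow> smooth_on (snd c ` fst c) (G \<circ> chart_inv c)"
    and inj: "\<And>c p. c \<in> charts_at M p \<Longrightarrow> inj (frechet_derivative (G \<circ> chart_inv c) (at (snd c p)))"
    and W: "openin (mtop M) W" and p: "p \<in> W" and c: "c \<in> charts_at M p"
  obtains B where "open B" "snd c p \<in> B" "B \<subseteq> snd c ` fst c" "chart_inv c ` B \<subseteq> W" "inj_on (G \<circ> chart_inv c) B"
proof -
  note cc = charts_at_D(1,2)[OF c]
  let ?U = "snd c ` (fst c \<inter> W)"
  have U: "open ?U" "snd c p \<in> ?U" using open_chart_image[OF cc(1) W] p cc(2) by auto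
  have "smooth_on ?U (G \<circ> chart_inv c)" using smooth[OF cc(1)] by (rule smooth_on_subset) auto
  then obtain r where r: "r > 0" "ball (snd c p) r \<subseteq> ?U" "inj_on (G \<circ> chart_inv c) (ball (snd c p) r)"
    using smooth_on_locally_injective[OF U _ inj[OF c]] by blast
  have "chart_inv c ` ?U \<subseteq> W" using cc(1) by auto
  then show thesis using that[of "ball (snd c p) r"] r by force
qed

text \<open>The dimensions agree, so invariance of domain makes the locally injective
  \<open>G\<close> open. The inverse is smooth since its coordinate expression solves an equation
  with the immersion \<open>G \<circ> chart_inv c'\<close>. The bound 3 makes the sphere simply
  connected.\<close>

theorem diffeomorphism_sphereI:
  fixes G :: "'a \<Rightarrow> complex ^ 'm::finite"
  assumes compact: "compact_space (mtop M)" and connected: "connected_space (mtop M)" "points M \<noteq> {}"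
    and cont: "continuous_map (mtop M) (top_of_set (sphere 0 1)) G"
    and smooth: "\<And>c. c \<in> atlas M \<Longrightarrow> smooth_on (snd c ` fst c) (G \<circ> chart_inv c)"
    and inj: "\<And>c p. c \<in> charts_at M p \<Longrightarrow> inj (frechet_derivative (G \<circ> chart_inv c) (at (snd c p)))"
    and dim: "DIM('e) + 1 = DIM(complex ^ 'm)" "3 \<le> DIM(complex ^ 'm)"
  shows "diffeomorphism M (standard_sphere :: (complex ^ 'm, 'e) contact_metric) G"
proof -
  let ?\<Sigma> = "sphere 0 1 :: (complex ^ 'm) set"
  let ?N = "standard_sphere :: (complex ^ 'm, 'e) contact_metric"
  have haus: "Hausdorff_space (mtop M)" using smooth_manifold unfolding smooth_manifold_def by blast
  have G_sphere: "G p \<in> ?\<Sigma>" if "p \<in> points M" for p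
    using cont that by (auto simp: continuous_map_def Pi_iff)
  have hom: "homeomorphic_map (mtop M) (top_of_set ?\<Sigma>) G"
  proof (rule compact_local_homeomorphism_imp_homeomorphic_map[OF compact haus connected cont])
    show "\<exists>N. openin (mtop M) N \<and> p \<in> N \<and> inj_on G N" if p: "p \<in> points M" for p
    proof -
      let ?c = "chart_at M p"
      have c: "?c \<in> charts_at M p" by (rule chart_at[OF p])
      note cc = charts_at_D(1,2)[OF c]
      obtain B where B: "open B" "snd ?c p \<in> B" "B \<subseteq> snd ?c ` fst ?c" "inj_on (G \<circ> chart_inv ?c) B"
        using locally_injective[OF smooth inj openin_topspace p c] by metis
      have "inj_on G (chart_inv ?c ` B)" using B(4) by (auto simp: inj_on_def)
      moreover have "p \<in> chart_inv ?c ` B" using B(2) cc by (intro image_eqI[of _ _ "snd ?c p"]) simp_all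
      ultimately show ?thesis using openin_chart_preimage[OF cc(1) B(1,3)] by blast
    qed
    show "openin (top_of_set ?\<Sigma>) (G ` W)" if W: "openin (mtop M) W" for W
    proof (subst openin_subopen, intro ballI)
      fix z assume "z \<in> G ` W"
      then obtain p where p: "p \<in> W" "z = G p" by blast
      have pM: "p \<in> points M" using W p openin_subset by blast
      let ?c = "chart_at M p"
      have c: "?c \<in> charts_at M p" by (rule chart_at[OF pM])
      note cc = charts_at_D(1,2)[OF c]
      obtain c' where "c' \<in> charts_at (sphere_manifold :: (complex ^ 'm, 'e) manifold) (G p)"
        using sphere_charts_exist[OF G_sphere[OF pM] dim(1)] by blast
      note c' = sphere_chartD[OF this]
      let ?V = "{q \<in> points M. G q \<in> fst c'}"
      have V: "openin (mtop M) (W \<inter> ?V)" using W openin_continuous_map_preimage[OF cont c'(1)] by blast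
      obtain B where B: "open B" "snd ?c p \<in> B" "B \<subseteq> snd ?c ` fst ?c" "chart_inv ?c ` B \<subseteq> W \<inter> ?V" "inj_on (G \<circ> chart_inv ?c) B"
        using locally_injective[OF smooth inj V _ c] p pM c'(3) by blast
      \<comment> \<open>\<open>G\<close> in charts on both sides: \<open>B\<close> is small enough
        for its image to stay in the domain of \<open>c'\<close>.\<close>
      let ?k = "\<lambda>x. snd c' ((G \<circ> chart_inv ?c) x)"
      have GB: "(G \<circ> chart_inv ?c) ` B \<subseteq> fst c'" using B(4) by auto
      have contB: "continuous_on B (G \<circ> chart_inv ?c)"
        using smooth_on_continuous[OF smooth[OF cc(1)]] B(3) by (rule continuous_on_subset)
      have contk: "continuous_on B ?k" by (rule continuous_on_compose2[OF c'(5) contB GB])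
      have "inj_on (snd c') (fst c')" using c'(4) by (metis inj_onI)
      then have "inj_on ?k B" using comp_inj_on[OF B(5) inj_on_subset[OF _ GB]] by (simp add: o_def)
      then have O: "open (?k ` B)" using contk B(1) by (intro invariance_of_domain)
      have "openin (top_of_set (fst c')) (fst c' \<inter> snd c' -` (?k ` B))"
        using c'(5) O by (rule continuous_openin_preimage_gen)
      then have "openin (top_of_set ?\<Sigma>) (fst c' \<inter> snd c' -` (?k ` B))"
        using c'(1) by (rule openin_trans)
      moreover have "fst c' \<inter> snd c' -` (?k ` B) \<subseteq> G ` W"
      proof
        fix y assume "y \<in> fst c' \<inter> snd c' -` (?k ` B)"
        then obtain x where x: "y \<in> fst c'" "x \<in> B" "snd c' y = snd c' (G (chart_inv ?c x))" by auto
        then have "y = G (chart_inv ?c x)" using c'(4)[of y] c'(4)[of "G (chart_inv ?c x)"] GB by force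
        then show "y \<in> G ` W" using B(4) x(2) by blast
      qed
      moreover have "z \<in> fst c' \<inter> snd c' -` (?k ` B)"
        using p c'(3) B(2) cc by (auto intro!: image_eqI[of _ _ "snd ?c p"])
      ultimately show "\<exists>T. openin (top_of_set ?\<Sigma>) T \<and> z \<in> T \<and> T \<subseteq> G ` W" by blast
    qed
    show "simply_connected ?\<Sigma>" by (rule simply_connected_sphere[OF dim(2)])
    show "locally path_connected ?\<Sigma>" by (rule locally_path_connected_sphere)
  qed
  let ?H = "inv_into (points M) G"
  have bij: "bij_betw G (points M) ?\<Sigma>"
    using homeomorphic_imp_surjective_map[OF hom] homeomorphic_imp_injective_map[OF hom]
    by (simp add: bij_betw_def)
  have GH: "G (?H z) = z" "?H z \<in> points M" if "z \<in> ?\<Sigma>" for z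
    using that bij bij_betw_inv_into_right[OF bij] bij_betw_imp_surj_on[OF bij] inv_into_into[of z G "points M"] by auto
  have contH: "continuous_map (top_of_set ?\<Sigma>) (mtop M) ?H"
  proof -
    obtain g where g: "homeomorphic_maps (mtop M) (top_of_set ?\<Sigma>) G g"
      using hom homeomorphic_map_maps by blast
    have "g z = ?H z" if "z \<in> ?\<Sigma>" for z
    proof -
      have "g z \<in> points M" "G (g z) = z"
        using g that by (auto simp: homeomorphic_maps_def continuous_map_def Pi_iff)
      then show ?thesis using bij by (metis bij_betw_inv_into_left)
    qed
    then show ?thesis
      using g by (auto simp: homeomorphic_maps_def intro: continuous_map_eq)
  qed
  have "smooth_map ?N M ?H"
    unfolding smooth_map_def mtop_standard_sphere atlas_standard_sphere
  proof (intro conjI contH ballI)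
    fix c :: "(complex ^ 'm, 'e) chart" and c' :: "('a, 'e) chart"
    assume c: "c \<in> atlas sphere_manifold" and c': "c' \<in> atlas M"
    from c have c1: "openin (top_of_set ?\<Sigma>) (fst c)" "open (snd c ` fst c)"
      "homeomorphism (fst c) (snd c ` fst c) (snd c) (chart_inv c)" "smooth_on (snd c ` fst c) (chart_inv c)"
      by (auto simp: sphere_atlas_iff)
    have c\<Sigma>: "fst c \<subseteq> ?\<Sigma>" using openin_subset[OF c1(1)] by simp
    let ?U = "snd c ` (fst c \<inter> ?H -` fst c')"
    have inv: "chart_inv c x \<in> fst c \<inter> ?H -` fst c'" if "x \<in> ?U" for x
      using that homeomorphism_apply1[OF c1(3)] by auto
    have U: "open ?U"
    proof -
      have "openin (top_of_set ?\<Sigma>) {z \<in> ?\<Sigma>. ?H z \<in> fst c'}"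
        using openin_continuous_map_preimage[OF contH atlasD(1)[OF c']] by simp
      then have "openin (top_of_set (fst c)) (fst c \<inter> {z \<in> ?\<Sigma>. ?H z \<in> fst c'})"
        using c\<Sigma> by (auto simp: openin_open)
      moreover have "fst c \<inter> {z \<in> ?\<Sigma>. ?H z \<in> fst c'} = fst c \<inter> ?H -` fst c'" using c\<Sigma> by auto
      ultimately have "openin (top_of_set (snd c ` fst c)) ?U"
        using homeomorphism_imp_open_map[OF c1(3)] by metis
      then show ?thesis using c1(2) openin_open_trans by blast
    qed
    have h: "smooth_on ?U (chart_inv c)" using c1(4) by (rule smooth_on_subset) auto
    show "smooth_on ?U (snd c' \<circ> ?H \<circ> chart_inv c)"
    proof (rule smooth_on_implicit[OF U atlasD(2)[OF c'] smooth[OF c'] _ _ _ h])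
      show "inj (frechet_derivative (G \<circ> chart_inv c') (at z))" if "z \<in> snd c' ` fst c'" for z
        using inj[OF charts_atI[OF c']] that by auto
      have "continuous_map (top_of_set ?U) (top_of_set ?\<Sigma>) (chart_inv c)"
        using smooth_on_continuous[OF h] inv c\<Sigma> by (auto simp: continuous_map_in_subtopology)
      from continuous_map_compose[OF this contH]
      have "continuous_map (top_of_set ?U) (subtopology (mtop M) (fst c')) (?H \<circ> chart_inv c)"
        using inv by (auto simp: continuous_map_in_subtopology)
      from continuous_map_compose[OF this homeomorphic_imp_continuous_map[OF atlasD(3)[OF c']]]
      show "continuous_on ?U (snd c' \<circ> ?H \<circ> chart_inv c)"
        by (simp add: continuous_map_in_subtopology o_assoc)
      fix x assume x: "x \<in> ?U"
      show "(snd c' \<circ> ?H \<circ> chart_inv c) x \<in> snd c' ` fst c'" using inv[OF x] by simp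
      show "(G \<circ> chart_inv c') ((snd c' \<circ> ?H \<circ> chart_inv c) x) = chart_inv c x"
        using inv[OF x] c' GH(1) c\<Sigma> by auto
    qed
  qed
  then show ?thesis
    using bij smooth_map_sphereI[OF cont smooth]
    by (simp add: diffeomorphism_def mtop_standard_sphere)
qed

end

section \<open>Unitary coordinates and the conclusion\<close>

definition mult_i :: "complex ^ 'k::finite \<Rightarrow> complex ^ 'k" where "mult_i z = (\<chi> j. \<i> * z $ j)"

lemma complex_structure_mult_i: "complex_structure (mult_i :: complex ^ 'k::finite \<Rightarrow> complex ^ 'k)"
proof (rule complex_structure.intro)
  show "linear (mult_i :: complex ^ 'k \<Rightarrow> complex ^ 'k)"
    by (rule linearI) (simp_all add: mult_i_def vec_eq_iff algebra_simps)
  fix v w :: "complex ^ 'k"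
  show "mult_i (mult_i v) = - v"
    by (simp add: mult_i_def vec_eq_iff mult.assoc[symmetric])
  show "mult_i v \<bullet> mult_i w = v \<bullet> w"
    by (simp add: mult_i_def inner_vec_def inner_complex_def algebra_simps)
qed

interpretation mult_i: complex_structure "mult_i :: complex ^ 'k::finite \<Rightarrow> complex ^ 'k"
  by (rule complex_structure_mult_i)

lemma eta_standard_sphere_inner: "eta standard_sphere p v = mult_i p \<bullet> ambient p v"
  by (simp add: eta_standard_sphere inner_vec_def inner_complex_def mult_i_def algebra_simps)

text \<open>\<open>A\<close> takes Hermitian coordinates with respect to a unitary basis of
  \<open>W\<close> and is defined on the whole ambient space. Expanding \<open>z\<close> alone in
  the basis proves the last identity, hence \<open>z'\<close> is arbitrary.\<close>

lemma unitary_coordinates: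
  fixes W :: "(complex ^ 'k::finite) set"
  assumes W: "subspace W" "\<And>v. v \<in> W \<Longrightarrow> mult_i v \<in> W" and dim: "dim W = 2 * CARD('m::finite)"
  obtains A :: "complex ^ 'k::finite \<Rightarrow> complex ^ 'm::finite" where "bounded_linear A" "\<And>z. A (mult_i z) = mult_i (A z)"
    "\<And>z z'. z \<in> W \<Longrightarrow> A z \<bullet> A z' = z \<bullet> z'"
proof -
  obtain n u where u: "mult_i.unitary_basis W n u" using mult_i.unitary_basis_exists[OF W] by blast
  have n: "n = CARD('m)" using mult_i.unitary_basis_dim[OF W u] dim by simp
  obtain h :: "'m \<Rightarrow> nat" where h: "bij_betw h UNIV {..<n}"
    using ex_bij_betw_finite_nat[of "UNIV :: 'm set"] n by (auto simp: atLeast0LessThan)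
  \<comment> \<open>With this sign of the imaginary part \<open>A\<close> is complex linear: passing
    from \<open>z\<close> to \<open>mult_i z\<close> turns the parts \<open>(a, b)\<close> of a
    coordinate into \<open>(- b, a)\<close>.\<close>
  define A :: "complex ^ 'k \<Rightarrow> complex ^ 'm" where
    "A z = (\<chi> i. Complex (z \<bullet> u (h i)) (z \<bullet> mult_i (u (h i))))" for z
  have "linear A"
    by (rule linearI) (simp_all add: A_def vec_eq_iff complex_eq_iff inner_add_left)
  then have "bounded_linear A" by (simp add: linear_conv_bounded_linear)
  moreover have "A (mult_i z) = mult_i (A z)" for z
    by (simp add: A_def vec_eq_iff complex_eq_iff mult_i.inner_J_left) (simp add: mult_i_def A_def)
  moreover have "A z \<bullet> A z' = z \<bullet> z'" if z: "z \<in> W" for z z'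
  proof -
    have "A z \<bullet> A z' = (\<Sum>i\<in>UNIV. (z \<bullet> u (h i)) * (z' \<bullet> u (h i)) + (z \<bullet> mult_i (u (h i))) * (z' \<bullet> mult_i (u (h i))))"
      by (simp add: A_def inner_vec_def inner_complex_def)
    also have "\<dots> = (\<Sum>k<n. (z \<bullet> u k) * (z' \<bullet> u k) + (z \<bullet> mult_i (u k)) * (z' \<bullet> mult_i (u k)))"
      by (rule sum.reindex_bij_betw[OF h])
    also have "\<dots> = (\<Sum>k<n. (z \<bullet> u k) *\<^sub>R u k + (z \<bullet> mult_i (u k)) *\<^sub>R mult_i (u k)) \<bullet> z'"
      by (simp add: inner_sum_left inner_add_left inner_commute[of z'])
    also have "(\<Sum>k<n. (z \<bullet> u k) *\<^sub>R u k + (z \<bullet> mult_i (u k)) *\<^sub>R mult_i (u k)) = z"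
      using u z by (simp add: mult_i.unitary_basis_def)
    finally show ?thesis .
  qed
  ultimately show thesis by (rule that)
qed

text \<open>A vector in the kernel of the ambient derivative would have length 0, so positivity of
  \<open>riem\<close> gives injectivity. If \<open>eta\<close> vanished at a point, so would every
  summand of the contact volume there.\<close>

lemma sasakian_immersion_contact_immersion:
  fixes S :: "('a, 'e::euclidean_space) contact_metric" and F :: "'a \<Rightarrow> complex ^ 'k::finite"
  assumes S: "sasakian_manifold n S" and ein: "einstein_metric S (riem S)"
    and F: "sasakian_immersion S (standard_sphere :: (complex ^ 'k, 'f::euclidean_space) contact_metric) F"
    and dim: "DIM('f) + 1 = DIM(complex ^ 'k)"
  shows "contact_immersion S F mult_i n"
proof -
  let ?N = "standard_sphere :: (complex ^ 'k, 'f) contact_metric"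
  have cmm: "contact_metric_manifold n S" using S by (simp add: sasakian_manifold_def)
  then have sm: "smooth_manifold S" and conn: "connected_space (mtop S)" "points S \<noteq> {}"
    and cf: "contact_form S n (eta S)" and rm: "riemannian_metric S (riem S)"
    and comp: "\<And>p u v. p \<in> points S \<Longrightarrow> u \<in> tangent_space S p \<Longrightarrow> v \<in> tangent_space S p \<Longrightarrow>
        riem S p (phi S p u) (phi S p v) = riem S p u v - eta S p u * eta S p v"
    unfolding contact_metric_manifold_def by auto
  interpret smooth_mfd S by (rule smooth_mfd.intro[OF sm])
  have F': "smooth_map S ?N F" using F by (simp add: sasakian_immersion_def immersion_def)
  note sph = smooth_map_sphereD[OF F' dim]
  have r: "riem S p u v = dir_deriv S p u F \<bullet> dir_deriv S p v F"
    if "p \<in> points S" "u \<in> tangent_space S p" "v \<in> tangent_space S p" for p u v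
  proof -
    have "riem S p u v = riem ?N (F p) (push S ?N F p u) (push S ?N F p v)"
      using F that unfolding sasakian_immersion_def by metis
    then show ?thesis by (simp add: riem_standard_sphere sph(3) that)
  qed
  have e: "eta S p u = mult_i (F p) \<bullet> dir_deriv S p u F" if "p \<in> points S" "u \<in> tangent_space S p" for p u
  proof -
    have "eta S p u = eta ?N (F p) (push S ?N F p u)"
      using F that unfolding sasakian_immersion_def by metis
    then show ?thesis by (simp add: eta_standard_sphere_inner sph(3) that)
  qed
  have inj: "inj (frechet_derivative (F \<circ> chart_inv c) (at (snd c p)))" if c: "c \<in> charts_at S p" for c p
  proof -
    let ?D = "frechet_derivative (F \<circ> chart_inv c) (at (snd c p))"
    have D: "(F \<circ> chart_inv c has_derivative ?D) (at (snd c p))"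
      by (rule smooth_on_has_derivative[OF sph(2)[OF charts_at_D(1)[OF c]]]) (use charts_at_D(2)[OF c] in simp)
    have "a = 0" if "?D a = 0" for a
    proof (rule ccontr)
      assume a: "a \<noteq> 0"
      let ?u = "coord_field S c a p"
      have u: "?u \<in> tangent_space S p" by (rule coord_field_in[OF c])
      have "?u \<noteq> 0"
      proof
        assume "?u = 0"
        then have "?u c = 0" by simp
        then show False using a c by simp
      qed
      then have "riem S p ?u ?u > 0"
        using rm charts_at_D(3)[OF c] u unfolding riemannian_metric_def by blast
      moreover have "dir_deriv S p ?u F = 0" using dir_deriv_eq[OF c u D] that c by simp
      ultimately show False using r[OF charts_at_D(3)[OF c] u u] by simp
    qed
    then show ?thesis using has_derivative_linear[OF D] linear_injective_0 by blast
  qed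
  show ?thesis
  proof
    show "DIM('e) = 2 * n + 1" using cf by (simp add: contact_form_def)
    show "F p \<bullet> F p = 1" if "p \<in> points S" for p using sph(1)[OF that] by (simp add: dot_square_norm)
    show "riem S p (phi S p v) (phi S p v) = riem S p v v - (eta S p v)\<^sup>2"
      if "p \<in> points S" "v \<in> tangent_space S p" for p v using comp[OF that(1,2,2)] by (simp add: power2_eq_square)
    show "\<exists>v\<in>tangent_space S p. eta S p v \<noteq> 0" if p: "p \<in> points S" for p
    proof -
      obtain v where v: "\<And>i. i < 2 * n + 1 \<Longrightarrow> v i \<in> tangent_space S p" "contact_volume S (eta S) n p v \<noteq> 0"
        using cf p unfolding contact_form_def by blast
      obtain \<sigma> where \<sigma>: "\<sigma> permutes {..<2 * n + 1}" "eta S p (v (\<sigma> 0)) \<noteq> 0"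
      proof -
        have "\<exists>\<sigma>. \<sigma> permutes {..<2 * n + 1} \<and> eta S p (v (\<sigma> 0)) \<noteq> 0"
        proof (rule ccontr)
          assume "\<not> ?thesis"
          then have "contact_volume S (eta S) n p v = 0" unfolding contact_volume_def by (intro sum.neutral) auto
          with v(2) show False by simp
        qed
        then show thesis using that by blast
      qed
      have "\<sigma> 0 < 2 * n + 1" using permutes_in_image[OF \<sigma>(1), of 0] by simp
      then show ?thesis using v(1) \<sigma>(2) by blast
    qed
    show "\<exists>l. \<forall>p\<in>points S. \<forall>v\<in>tangent_space S p. ricci S (riem S) p v v = l * riem S p v v"
      using ein unfolding einstein_metric_def by blast
  qed (use conn r e sph(2) inj in auto)
qed

text \<open>The case \<open>n = 0\<close> behaves differently: a circle of length 2k times pi winds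
  k times around the unit circle by a Sasakian immersion, and for k > 1 the two are not
  equivalent.\<close>

theorem theorem1:
  fixes S :: "('a, 'e::euclidean_space) contact_metric"
    and n N :: nat
  assumes "n \<ge> 1"
    and "sasakian_manifold n S"
    and "compact_space (mtop S)"
    and "einstein_metric S (riem S)"
    and "CARD('k) = N + 1" and "DIM('f) = 2 * N + 1"
    and "\<exists>F. sasakian_immersion S
               (standard_sphere :: (complex ^ 'k::finite, 'f::euclidean_space) contact_metric) F"
    and "CARD('m) = n + 1"
  shows "sasaki_equivalent S (standard_sphere :: (complex ^ 'm::finite, 'e) contact_metric)"
proof -
  let ?N = "standard_sphere :: (complex ^ 'm, 'e) contact_metric"
  obtain F where F: "sasakian_immersion S (standard_sphere :: (complex ^ 'k, 'f) contact_metric) F"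
    using assms(7) by blast
  have dim: "DIM('f) + 1 = DIM(complex ^ 'k)" using assms(5,6) by simp
  interpret contact_immersion S F mult_i n
    by (rule sasakian_immersion_contact_immersion[OF assms(2,4) F dim])
  obtain W where W: "subspace W" "\<And>v. v \<in> W \<Longrightarrow> mult_i v \<in> W" "dim W = 2 * n + 2"
    "\<And>p. p \<in> points S \<Longrightarrow> F p \<in> W" "\<And>p v. p \<in> points S \<Longrightarrow> v \<in> tangent_space S p \<Longrightarrow> dF p v \<in> W"
    using image_in_complex_subspace by metis
  have dimW: "dim W = 2 * CARD('m)" using W(3) assms(8) by simp
  obtain A :: "complex ^ 'k \<Rightarrow> complex ^ 'm" where A: "bounded_linear A" "\<And>z. A (mult_i z) = mult_i (A z)"
    "\<And>z z'. z \<in> W \<Longrightarrow> A z \<bullet> A z' = z \<bullet> z'"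
    using unitary_coordinates[OF W(1,2) dimW] by metis
  \<comment> \<open>The immersion in unitary coordinates of \<open>W\<close>, on which
    \<open>A\<close> is isometric; this lowers the target to a sphere of the dimension of
    \<open>S\<close>.\<close>
  define G where "G = A \<circ> F"
  have contF: "continuous_map (mtop S) euclidean F"
    using F by (simp add: sasakian_immersion_def immersion_def smooth_map_def mtop_standard_sphere continuous_map_in_subtopology)
  have G1: "G p \<in> sphere 0 1" if "p \<in> points S" for p
    using A(3)[OF W(4)[OF that], of "F p"] unit_F[OF that] by (simp add: G_def norm_eq_1)
  have "continuous_map euclidean euclidean A"
    using A(1) by (simp add: bounded_linear.continuous_on[OF A(1)])
  then have "continuous_map (mtop S) euclidean G" unfolding G_def by (rule continuous_map_compose[OF contF])
  then have contG: "continuous_map (mtop S) (top_of_set (sphere 0 1)) G"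
    using G1 by (auto simp: continuous_map_in_subtopology)
  have Gc: "G \<circ> chart_inv c = (\<lambda>x. A ((F \<circ> chart_inv c) x))" for c by (auto simp: G_def)
  have smoothG: "smooth_on (snd c ` fst c) (G \<circ> chart_inv c)" if "c \<in> atlas S" for c
    unfolding Gc by (rule smooth_on_bounded_linear[OF A(1) atlasD(2)[OF that] smooth_F[OF that]])
  have derG: "((G \<circ> chart_inv c) has_derivative (\<lambda>v. A (Dc c (snd c p) v))) (at (snd c p))"
    if c: "c \<in> charts_at S p" for c p
  proof -
    interpret L: local_immersion "snd c ` fst c" "F \<circ> chart_inv c" by (rule interp[OF charts_at_D(1)[OF c]])
    show ?thesis
      unfolding Gc by (rule bounded_linear.has_derivative[OF A(1) L.has_derivative_f]) (use charts_at_D(2)[OF c] in simp)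
  qed
  have dG: "dir_deriv S p v G = A (dF p v)" if p: "p \<in> points S" and v: "v \<in> tangent_space S p" for p v
    using dir_deriv_eq[OF chart_at[OF p] v derG[OF chart_at[OF p]]] dF_eq[OF chart_at[OF p] v] by simp
  have injG: "inj (frechet_derivative (G \<circ> chart_inv c) (at (snd c p)))" if c: "c \<in> charts_at S p" for c p
  proof -
    have pS: "p \<in> points S" by (rule charts_at_D(3)[OF c])
    have lin: "linear (\<lambda>v. A (Dc c (snd c p) v))" using derG[OF c] by (rule has_derivative_linear)
    \<comment> \<open>Derivatives of \<open>F\<close> take values in \<open>W\<close>, where
      \<open>A\<close> preserves lengths; so \<open>G\<close> remains an immersion.\<close>
    have "v = 0" if "A (Dc c (snd c p) v) = 0" for v
    proof -
      have "Dc c (snd c p) v \<in> W" using W(5)[OF pS coord_field_in[OF c, of v]] c by simp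
      then have "Dc c (snd c p) v \<bullet> Dc c (snd c p) v = 0" using A(3)[of "Dc c (snd c p) v" "Dc c (snd c p) v"] that by simp
      moreover have "local_immersion (snd c ` fst c) (F \<circ> chart_inv c)" by (rule interp[OF charts_at_D(1)[OF c]])
      ultimately show "v = 0"
        using inj_F[OF c] linear_injective_0[OF local_immersion.linear_D] charts_at_D(2)[OF c]
        by (metis image_eqI inner_eq_zero_iff local_immersion.D_inject local_immersion.linear_D linear_0)
    qed
    then show ?thesis
      unfolding frechet_derivative_eqI[OF derG[OF c]] using linear_injective_0[OF lin] by blast
  qed
  have dimm: "DIM('e) + 1 = DIM(complex ^ 'm)" "3 \<le> DIM(complex ^ 'm)"
    using dim_model assms(1,8) by simp_all
  have diff: "diffeomorphism S ?N G"
    by (rule diffeomorphism_sphereI[OF assms(3) connected contG smoothG injG dimm])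
  have amb: "ambient (G p) (push S ?N G p v) = A (dF p v)" if "p \<in> points S" "v \<in> tangent_space S p" for p v
    using smooth_map_sphereD(3)[OF smooth_map_sphereI[OF contG smoothG] dimm(1) that(1)] dG[OF that] by simp
  show ?thesis
    unfolding sasaki_equivalent_def
  proof (intro exI[of _ G] conjI ballI)
    show "diffeomorphism S ?N G" by (rule diff)
    fix p u assume p: "p \<in> points S" and u: "u \<in> tangent_space S p"
    \<comment> \<open>\<open>A\<close> commutes with \<open>mult_i\<close>, and
      \<open>mult_i (F p)\<close> lies in \<open>W\<close>; the contact form is thus preserved
      together with the metric.\<close>
    have "mult_i (G p) \<bullet> A (dF p u) = mult_i (F p) \<bullet> dF p u"
      using A(3)[OF W(2)[OF W(4)[OF p]], of "dF p u"] by (simp add: G_def A(2))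
    then show "eta ?N (G p) (push S ?N G p u) = eta S p u"
      by (simp add: eta_standard_sphere_inner amb p u eta_eq)
    fix v assume v: "v \<in> tangent_space S p"
    show "riem ?N (G p) (push S ?N G p u) (push S ?N G p v) = riem S p u v"
      by (simp add: riem_standard_sphere amb p u v g_eq A(3) W(5))
  qed
qed

end
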